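(* Let $q\in\mathbb{R}$, $q\neq0$. A quadratic functional $L:V(q)\to\mathbb{C}$ (with $L(1)=0$) is a generator of a Lévy process on $V(q)$ if and only if (1) for $q=1$: the matrix $\begin{pmatrix}L(xv)&L(xx)\\L(vv)&L(vx)\end{pmatrix}$ is positive semi-definite and $L(v)=\overline{L(x)}$; (2) for $q=-1$: the matrix $\begin{pmatrix}L(xv)&L(xx)\\L(vv)&L(vx)\end{pmatrix}$ is positive semi-definite and $L(x)=L(v)=0$; (3) for $q^2\neq1$: $L(xv)\ge0$, $L(vx)\ge0$, and $L$ vanishes on all other basis elements (words in $x$ and $v$).
   Context: $V(q)$ is the braided $*$-space associated with the one-dimensional R-matrix $R=(q)$: as an algebra it is the free complex unital algebra generated by $x$ and $v=x^*$ (with the corresponding involution), with basis the words in $x,v$. The braiding $\Psi:V(q)\otimes V(q)\to V(q)\otimes V(q)$ is given on generators by $\Psi(x\otimes x)=q\,x\otimes x$, $\Psi(x\otimes v)=q\,v\otimes x$, $\Psi(v\otimes x)=q^{-1}x\otimes v$, $\Psi(v\otimes v)=q^{-1}v\otimes v$, and extended multiplicatively to words by $\Psi(1\otimes u)=u\otimes 1$, $\Psi(u\otimes 1)=1\otimes u$ and by moving letters past each other one at a time; that is, for words $w,w'$ one has $\Psi(w\otimes w')=q^{(n_x(w)-n_v(w))|w'|}\,w'\otimes w$, where $n_x(w),n_v(w)$ are the numbers of letters $x$, $v$ in $w$ and $|w'|$ is the length of $w'$. The coproduct $\Delta:V(q)\to V(q)\otimes V(q)$ is the unital homomorphism with $\Delta(x)=x\otimes1+1\otimes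 x$, $\Delta(v)=v\otimes1+1\otimes v$, where $V(q)\otimes V(q)$ has the multiplication $(m\otimes m)\circ(\mathrm{id}\otimes\Psi\otimes\mathrm{id})$ ($m$ the multiplication of $V(q)$); the counit $\varepsilon$ is the unital homomorphism with $\varepsilon(x)=\varepsilon(v)=0$. A linear functional $L$ is quadratic if $L(abc)=0$ whenever $\varepsilon(a)=\varepsilon(b)=\varepsilon(c)=0$. A quantum probability space is a unital $*$-algebra $\mathcal{A}$ (with multiplication $m_{\mathcal A}$) together with a state $\Phi$. Quantum random variables on $V(q)$ are $*$-homomorphisms $j:V(q)\to\mathcal{A}$. An $n$-tuple $(j_1,\ldots,j_n)$ of them is ($\Psi$-)independent if $\Phi(j_{\sigma(1)}(b_1)\cdots j_{\sigma(n)}(b_n))=\Phi(j_{\sigma(1)}(b_1))\cdots\Phi(j_{\sigma(n)}(b_n))$ for all permutations $\sigma$ and all $b_1,\dots,b_n\in V(q)$, and $m_{\mathcal A}\circ(j_l\otimes j_k)=m_{\mathcal A}\circ(j_k\otimes j_l)\circ\Psi$ for all $k<l$. A Lévy process on $V(q)$ is a family $(j_{st})_{0\le s\le t\le T}$ of quantum random variables on $V(q)$ over some $(\mathcal{A},\Phi)$ such that: $m_{\mathcal A}\circ(j_{rs}\otimes j_{st})\circ\Delta=j_{rt}$ and $j_{tt}=\varepsilon\mathbf{1}$; $(j_{s_1t_1},\ldots,j_{s_nt_n})$ is independent for all $0\le s_1\le t_1\le s_2\le\cdots\le t_n\le T$; $\Phi\circ j_{st}$ depends only on $t-s$; and $\Phi\circ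 j_{st}\to\varepsilon$ pointwise as $t\searrow s$. Its marginal distributions $\varphi_t=\Phi\circ j_{0t}$ form a convolution semigroup $\varphi_t=\exp_\star tL$ (convolution $\varphi\star\theta=(\varphi\otimes\theta)\circ\Delta$), and $L=\frac{\mathrm d}{\mathrm dt}\big|_{t=0}\varphi_t$ is called the generator of the process. *)

theory Defs
  imports
    "HOL-Analysis.Analysis"
    "HOL-Library.Poly_Mapping"
    "HOL-Library.Equipollence"
    "HOL-Combinatorics.Permutations"
    "HOL-Algebra.Module"
begin

section \<open>Quantum probability spaces and quantum random variables\<close>

definition complex_ring :: "complex ring" where
  "complex_ring = \<lparr>carrier = UNIV, mult = (*), one = 1, zero = 0, add = (+)\<rparr>"

record 'a star_algebra = "(complex, 'a) module" +
  star :: "'a \<Rightarrow> 'a"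

locale unital_star_algebra = ring A + Module.module complex_ring A
  for A :: "('a, 'm) star_algebra_scheme" (structure) +
  assumes smult_mult_left:
      "\<lbrakk>a \<in> carrier A; b \<in> carrier A\<rbrakk> \<Longrightarrow> (c \<odot> a) \<otimes> b = c \<odot> (a \<otimes> b)"
    and smult_mult_right:
      "\<lbrakk>a \<in> carrier A; b \<in> carrier A\<rbrakk> \<Longrightarrow> a \<otimes> (c \<odot> b) = c \<odot> (a \<otimes> b)"
    and star_closed: "a \<in> carrier A \<Longrightarrow> star A a \<in> carrier A"
    and star_star: "a \<in> carrier A \<Longrightarrow> star A (star A a) = a"
    and star_add:
      "\<lbrakk>a \<in> carrier A; b \<in> carrier A\<rbrakk> \<Longrightarrow> star A (a \<oplus> b) = star A a \<oplus> star A b"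
    and star_smult: "a \<in> carrier A \<Longrightarrow> star A (c \<odot> a) = cnj c \<odot> star A a"
    and star_mult:
      "\<lbrakk>a \<in> carrier A; b \<in> carrier A\<rbrakk> \<Longrightarrow> star A (a \<otimes> b) = star A b \<otimes> star A a"

definition linear_functional :: "('a, 'm) star_algebra_scheme \<Rightarrow> ('a \<Rightarrow> complex) \<Rightarrow> bool" where
  "linear_functional A \<Phi> \<longleftrightarrow>
     (\<forall>a\<in>carrier A. \<forall>b\<in>carrier A. \<Phi> (a \<oplus>\<^bsub>A\<^esub> b) = \<Phi> a + \<Phi> b) \<and>
     (\<forall>c. \<forall>a\<in>carrier A. \<Phi> (c \<odot>\<^bsub>A\<^esub> a) = c * \<Phi> a)"

definition is_state :: "('a, 'm) star_algebra_scheme \<Rightarrow> ('a \<Rightarrow> complex) \<Rightarrow> bool" where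
  "is_state A \<Phi> \<longleftrightarrow> linear_functional A \<Phi> \<and> \<Phi> \<one>\<^bsub>A\<^esub> = 1 \<and>
     (\<forall>a\<in>carrier A. \<Phi> (star A a \<otimes>\<^bsub>A\<^esub> a) \<in> \<real>\<^sub>\<ge>\<^sub>0)"

definition quantum_prob_space :: "('a, 'm) star_algebra_scheme \<Rightarrow> ('a \<Rightarrow> complex) \<Rightarrow> bool" where
  "quantum_prob_space A \<Phi> \<longleftrightarrow> unital_star_algebra A \<and> is_state A \<Phi>"

definition star_hom ::
    "('a, 'm) star_algebra_scheme \<Rightarrow> ('b, 'n) star_algebra_scheme \<Rightarrow> ('a \<Rightarrow> 'b) set" where
  "star_hom A B = {h \<in> ring_hom A B.
     (\<forall>c. \<forall>a\<in>carrier A. h (c \<odot>\<^bsub>A\<^esub> a) = c \<odot>\<^bsub>B\<^esub> h a) \<and>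
     (\<forall>a\<in>carrier A. h (star A a) = star B (h a))}"


section \<open>The braided \<open>*\<close>-space \<open>V(q)\<close>\<close>

datatype letter = Lx | Lv

text \<open>Words form a monoid under concatenation, written additively so that the convolution product
  of finitely supported functions on words is the product of the free algebra.\<close>

datatype word = Word (letters: "letter list")

instantiation word :: monoid_add
begin

definition zero_word :: word where "0 = Word []"

definition plus_word :: "word \<Rightarrow> word \<Rightarrow> word" where
  "u + w = Word (letters u @ letters w)"

instance
  by standard (simp_all add: zero_word_def plus_word_def)

end

type_synonym free_alg = "word \<Rightarrow>\<^sub>0 complex"

text \<open>The tensor square is identified with the free vector space on pairs of words; only
  its linear structure is used, its product is \<open>braided_mult\<close> below.\<close>

type_synonym free_alg2 = "(word \<times> word) \<Rightarrow>\<^sub>0 complex"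

definition cscale :: "complex \<Rightarrow> ('k \<Rightarrow>\<^sub>0 complex) \<Rightarrow> ('k \<Rightarrow>\<^sub>0 complex)" where
  "cscale c p = Poly_Mapping.map ((*) c) p"

definition lin_ext :: "('k \<Rightarrow> ('l \<Rightarrow>\<^sub>0 complex)) \<Rightarrow> ('k \<Rightarrow>\<^sub>0 complex) \<Rightarrow> ('l \<Rightarrow>\<^sub>0 complex)" where
  "lin_ext f p = (\<Sum>k\<in>Poly_Mapping.keys p. cscale (Poly_Mapping.lookup p k) (f k))"

abbreviation basis :: "'k \<Rightarrow> ('k \<Rightarrow>\<^sub>0 complex)" where
  "basis k \<equiv> Poly_Mapping.single k 1"

abbreviation gx :: free_alg where "gx \<equiv> basis (Word [Lx])"
abbreviation gv :: free_alg where "gv \<equiv> basis (Word [Lv])"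

fun star_letter :: "letter \<Rightarrow> letter" where
  "star_letter Lx = Lv"
| "star_letter Lv = Lx"

definition free_star :: "free_alg \<Rightarrow> free_alg" where
  "free_star p = (\<Sum>w\<in>Poly_Mapping.keys p.
     Poly_Mapping.single (Word (rev (map star_letter (letters w)))) (cnj (Poly_Mapping.lookup p w)))"

definition V_alg :: "free_alg star_algebra" where
  "V_alg = \<lparr>carrier = UNIV, mult = (*), one = 1, zero = 0, add = (+),
            smult = cscale, star = free_star\<rparr>"

definition num_letter :: "letter \<Rightarrow> word \<Rightarrow> nat" where
  "num_letter l w = count_list (letters w) l"

definition braid :: "real \<Rightarrow> free_alg2 \<Rightarrow> free_alg2" where
  "braid q = lin_ext (\<lambda>(w, w'). Poly_Mapping.single (w', w)
     (complex_of_real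
        (q powi ((int (num_letter Lx w) - int (num_letter Lv w)) * int (length (letters w'))))))"

text \<open>\<open>(m \<otimes> m) \<circ> (id \<otimes> \<Psi> \<otimes> id)\<close>, evaluated on pairs of basis tensors
  \<open>a \<otimes> b\<close> and \<open>c \<otimes> d\<close>.\<close>

definition braided_mult :: "real \<Rightarrow> free_alg2 \<Rightarrow> free_alg2 \<Rightarrow> free_alg2" where
  "braided_mult q y z =
     lin_ext (\<lambda>(a, b). lin_ext (\<lambda>(c, d).
       lin_ext (\<lambda>(c', b'). basis (a + c', b' + d)) (braid q (basis (b, c)))) z) y"

fun comult_letters :: "real \<Rightarrow> letter list \<Rightarrow> free_alg2" where
  "comult_letters q [] = basis (0, 0)"
| "comult_letters q (l # ls) =
     braided_mult q (basis (Word [l], 0) + basis (0, Word [l])) (comult_letters q ls)"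

text \<open>The unital homomorphism with \<open>\<Delta>(l) = l \<otimes> 1 + 1 \<otimes> l\<close> on letters. Multiplicativity is lemma \<open>comult_mult\<close> below.\<close>

definition comult :: "real \<Rightarrow> free_alg \<Rightarrow> free_alg2" where
  "comult q = lin_ext (\<lambda>w. comult_letters q (letters w))"

text \<open>The coefficient of the empty word; see \<open>counit_hom\<close> below.\<close>

definition counit :: "free_alg \<Rightarrow> complex" where
  "counit p = Poly_Mapping.lookup p 0"

definition quadratic_functional :: "(free_alg \<Rightarrow> complex) \<Rightarrow> bool" where
  "quadratic_functional L \<longleftrightarrow>
     (\<forall>a b c. counit a = 0 \<and> counit b = 0 \<and> counit c = 0 \<longrightarrow> L (a * b * c) = 0)"


section \<open>Levy processes on \<open>V(q)\<close>\<close>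

text \<open>\<open>m\<^sub>A \<circ> (f \<otimes> g)\<close>.\<close>

definition mult_tensor ::
    "('a, 'm) star_algebra_scheme \<Rightarrow> (free_alg \<Rightarrow> 'a) \<Rightarrow> (free_alg \<Rightarrow> 'a) \<Rightarrow> free_alg2 \<Rightarrow> 'a" where
  "mult_tensor A f g z = (\<Oplus>\<^bsub>A\<^esub>k\<in>Poly_Mapping.keys z.
     Poly_Mapping.lookup z k \<odot>\<^bsub>A\<^esub> (f (basis (fst k)) \<otimes>\<^bsub>A\<^esub> g (basis (snd k))))"

definition ordered_prod :: "('a, 'm) star_algebra_scheme \<Rightarrow> nat \<Rightarrow> (nat \<Rightarrow> 'a) \<Rightarrow> 'a" where
  "ordered_prod A n f = foldr (mult A) (map f [0..<n]) \<one>\<^bsub>A\<^esub>"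

definition independent ::
    "real \<Rightarrow> ('a, 'm) star_algebra_scheme \<Rightarrow> ('a \<Rightarrow> complex) \<Rightarrow> nat \<Rightarrow> (nat \<Rightarrow> free_alg \<Rightarrow> 'a) \<Rightarrow> bool"
  where
  "independent q A \<Phi> n J \<longleftrightarrow>
     (\<forall>\<sigma> b. \<sigma> permutes {..<n} \<longrightarrow>
        \<Phi> (ordered_prod A n (\<lambda>i. J (\<sigma> i) (b i))) = (\<Prod>i<n. \<Phi> (J (\<sigma> i) (b i)))) \<and>
     (\<forall>l<n. \<forall>k<l. \<forall>z. mult_tensor A (J l) (J k) z = mult_tensor A (J k) (J l) (braid q z))"

definition levy_process ::
    "real \<Rightarrow> real \<Rightarrow> ('a, 'm) star_algebra_scheme \<Rightarrow> ('a \<Rightarrow> complex)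
      \<Rightarrow> (real \<Rightarrow> real \<Rightarrow> free_alg \<Rightarrow> 'a) \<Rightarrow> bool" where
  "levy_process q T A \<Phi> j \<longleftrightarrow>
     quantum_prob_space A \<Phi> \<and>
     (\<forall>s t. 0 \<le> s \<and> s \<le> t \<and> t \<le> T \<longrightarrow> j s t \<in> star_hom V_alg A) \<and>
     (\<forall>r s t b. 0 \<le> r \<and> r \<le> s \<and> s \<le> t \<and> t \<le> T \<longrightarrow>
        mult_tensor A (j r s) (j s t) (comult q b) = j r t b) \<and>
     (\<forall>t b. 0 \<le> t \<and> t \<le> T \<longrightarrow> j t t b = counit b \<odot>\<^bsub>A\<^esub> \<one>\<^bsub>A\<^esub>) \<and>
     (\<forall>n s t. (\<forall>i<n. 0 \<le> s i \<and> s i \<le> t i \<and> t i \<le> T) \<and> (\<forall>i. Suc i < n \<longrightarrow> t i \<le> s (Suc i)) \<longrightarrow>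
        independent q A \<Phi> n (\<lambda>i. j (s i) (t i))) \<and>
     (\<forall>s t s' t' b. 0 \<le> s \<and> s \<le> t \<and> t \<le> T \<and> 0 \<le> s' \<and> s' \<le> t' \<and> t' \<le> T \<and> t - s = t' - s' \<longrightarrow>
        \<Phi> (j s t b) = \<Phi> (j s' t' b)) \<and>
     (\<forall>s b. 0 \<le> s \<and> s < T \<longrightarrow> ((\<lambda>t. \<Phi> (j s t b)) \<longlongrightarrow> counit b) (at_right s))"

text \<open>
  HOL cannot quantify existentially over types, so ``some \<open>(A, \<Phi>)\<close>'' means: some algebra
  carried by a subset of a fixed type \<open>'a\<close>, where \<open>'a\<close> is any type with at least continuum many
  elements. This loses no processes: a Levy process can be restricted to the subalgebra generated
  by the values of the \<open>j s t\<close> on the two generators, which has at most continuum many elements.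
  The values of \<open>j s t\<close> outside \<open>0 \<le> s \<le> t \<le> T\<close> are irrelevant.
\<close>

definition has_generator ::
    "real \<Rightarrow> ('a \<Rightarrow> complex) \<Rightarrow> (real \<Rightarrow> real \<Rightarrow> free_alg \<Rightarrow> 'a) \<Rightarrow> (free_alg \<Rightarrow> complex) \<Rightarrow> bool" where
  "has_generator T \<Phi> j L \<longleftrightarrow>
     (\<forall>b. ((\<lambda>t. \<Phi> (j 0 t b)) has_vector_derivative L b) (at 0 within {0..T}))"

definition positive_semidefinite :: "complex^'n^'n \<Rightarrow> bool" where
  "positive_semidefinite M \<longleftrightarrow>
     (\<forall>z :: complex^'n. (\<Sum>i\<in>UNIV. \<Sum>k\<in>UNIV. cnj (z $ i) * M $ i $ k * z $ k) \<in> \<real>\<^sub>\<ge>\<^sub>0)"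


section \<open>Consistency of the definitions\<close>

lemma lookup_cscale [simp]: "Poly_Mapping.lookup (cscale c p) k = c * Poly_Mapping.lookup p k"
  by (simp add: cscale_def Poly_Mapping.map.rep_eq when_def)

lemma cscale_simps [simp]:
  "cscale c (p + r) = cscale c p + cscale c r" "cscale (c + d) p = cscale c p + cscale d p"
  "cscale c (cscale d p) = cscale (c * d) p" "cscale 1 p = p" "cscale 0 p = 0" "cscale c 0 = 0"
  "cscale c (Poly_Mapping.single k d) = Poly_Mapping.single k (c * d)"
  by (auto intro!: poly_mapping_eqI simp: lookup_add lookup_single when_def algebra_simps)

lemma cscale_sum: "cscale c (sum f S) = (\<Sum>i\<in>S. cscale c (f i))"
  by (induction S rule: infinite_finite_induct) simp_all

lemma lin_ext_superset:
  assumes "finite S" "Poly_Mapping.keys p \<subseteq> S"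
  shows "lin_ext f p = (\<Sum>k\<in>S. cscale (Poly_Mapping.lookup p k) (f k))"
  unfolding lin_ext_def using assms
  by (intro sum.mono_neutral_left) (auto simp: in_keys_iff)

lemma lin_ext_single [simp]: "lin_ext f (Poly_Mapping.single k c) = cscale c (f k)"
  by (subst lin_ext_superset[of "{k}"]) auto

lemma lin_ext_zero [simp]: "lin_ext f 0 = 0"
  by (simp add: lin_ext_def)

lemma lin_ext_add [simp]: "lin_ext f (p + r) = lin_ext f p + lin_ext f r"
proof -
  let ?S = "Poly_Mapping.keys p \<union> Poly_Mapping.keys r"
  have "finite ?S" by simp
  moreover have "Poly_Mapping.keys (p + r) \<subseteq> ?S" by (rule keys_add)
  ultimately show ?thesis
    by (simp add: lin_ext_superset[of ?S] lookup_add sum.distrib)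
qed

lemma lin_ext_cscale: "lin_ext f (cscale c p) = cscale c (lin_ext f p)"
proof -
  have "Poly_Mapping.keys (cscale c p) \<subseteq> Poly_Mapping.keys p"
    by (auto simp: in_keys_iff)
  then show ?thesis
    by (simp add: lin_ext_superset[of "Poly_Mapping.keys p"] cscale_sum)
qed

lemma free_induct [case_names single add]:
  fixes p :: "'k \<Rightarrow>\<^sub>0 complex"
  assumes s: "\<And>k c. P (Poly_Mapping.single k c)" and a: "\<And>p r. P p \<Longrightarrow> P r \<Longrightarrow> P (p + r)"
  shows "P p"
proof -
  have "P (\<Sum>k\<in>S. Poly_Mapping.single k (Poly_Mapping.lookup p k))" if "finite S" for S
    using that
  proof induction
    case empty
    then show ?case using s[of undefined 0] by simp
  next
    case (insert k S)
    then show ?case by (simp add: a s)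
  qed
  moreover have "(\<Sum>k\<in>Poly_Mapping.keys p. Poly_Mapping.single k (Poly_Mapping.lookup p k)) = p"
    by (intro poly_mapping_eqI)
       (simp add: lookup_sum lookup_single when_def sum.delta' in_keys_iff)
  ultimately show ?thesis
    by (metis finite_keys)
qed

lemma braid_generators:
  "braid q (basis (Word [Lx], Word [Lx])) = cscale q (basis (Word [Lx], Word [Lx]))"
  "braid q (basis (Word [Lx], Word [Lv])) = cscale q (basis (Word [Lv], Word [Lx]))"
  "braid q (basis (Word [Lv], Word [Lx])) = cscale (inverse q) (basis (Word [Lx], Word [Lv]))"
  "braid q (basis (Word [Lv], Word [Lv])) = cscale (inverse q) (basis (Word [Lv], Word [Lv]))"
  by (simp_all add: braid_def num_letter_def power_int_minus)

lemma lin_ext_add_fun: "lin_ext (\<lambda>k. f k + g k) p = lin_ext f p + lin_ext g p"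
  by (simp add: lin_ext_def sum.distrib)

lemma braided_mult_add [simp]:
  "braided_mult q (y + y') z = braided_mult q y z + braided_mult q y' z"
  "braided_mult q y (z + z') = braided_mult q y z + braided_mult q y z'"
  by (simp_all add: braided_mult_def case_prod_unfold lin_ext_add_fun)

lemma braided_mult_zero [simp]: "braided_mult q 0 z = 0"
  by (simp add: braided_mult_def)

lemma braided_mult_single:
  "braided_mult q (Poly_Mapping.single (a, b) s) (Poly_Mapping.single (c, d) t) =
     Poly_Mapping.single (a + c, b + d) (s * t * complex_of_real
       (q powi ((int (num_letter Lx b) - int (num_letter Lv b)) * int (length (letters c)))))"
  by (simp add: braided_mult_def braid_def mult.assoc)

lemma num_letter_plus [simp]: "num_letter l (u + w) = num_letter l u + num_letter l w"
  by (simp add: num_letter_def plus_word_def)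

lemma num_letter_zero [simp]: "num_letter l 0 = 0"
  by (simp add: num_letter_def zero_word_def)

lemma length_letters_plus [simp]:
  "length (letters (u + w)) = length (letters u) + length (letters w)"
  by (simp add: plus_word_def)

lemma braided_mult_assoc:
  assumes "q \<noteq> 0"
  shows "braided_mult q (braided_mult q y z) w = braided_mult q y (braided_mult q z w)"
proof (induction y rule: free_induct)
  case (single k c)
  show ?case
  proof (induction z rule: free_induct)
    case (single k' c')
    show ?case
    proof (induction w rule: free_induct)
      case (single k'' c'')
      show ?case
        using assms
        by (cases k; cases k'; cases k'')
           (simp add: braided_mult_single add.assoc distrib_left distrib_right left_diff_distrib
              power_int_diff power_int_add field_simps)
    qed simp
  qed simp
qed simp

lemma braided_mult_one_left: "braided_mult q (basis (0, 0)) z = z"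
proof (induction z rule: free_induct)
  case (single k c)
  show ?case by (cases k) (simp add: braided_mult_single)
qed simp

lemma comult_letters_append:
  assumes "q \<noteq> 0"
  shows "comult_letters q (u @ w) = braided_mult q (comult_letters q u) (comult_letters q w)"
proof (induction u)
  case Nil
  show ?case by (simp only: comult_letters.simps append_Nil braided_mult_one_left)
next
  case (Cons l u)
  then show ?case
    by (simp only: comult_letters.simps append_Cons braided_mult_assoc[OF assms])
qed

lemma braided_mult_cscale:
  "braided_mult q (cscale c y) z = cscale c (braided_mult q y z)"
  "braided_mult q y (cscale c z) = cscale c (braided_mult q y z)"
proof -
  show "braided_mult q (cscale c y) z = cscale c (braided_mult q y z)"
    by (simp add: braided_mult_def lin_ext_cscale)
  show "braided_mult q y (cscale c z) = cscale c (braided_mult q y z)"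
    by (simp add: braided_mult_def lin_ext_cscale lin_ext_def[of _ y] case_prod_unfold cscale_sum
        mult.commute)
qed

lemma comult_mult:
  assumes "q \<noteq> 0"
  shows "comult q (a * b) = braided_mult q (comult q a) (comult q b)"
proof (induction a rule: free_induct)
  case (single k c)
  show ?case
  proof (induction b rule: free_induct)
    case (single k' c')
    show ?case
      by (simp add: comult_def mult_single plus_word_def comult_letters_append[OF assms]
          braided_mult_cscale mult.commute)
  qed (simp add: comult_def distrib_left)
qed (simp add: comult_def distrib_right)

lemma comult_one: "comult q 1 = basis (0, 0)"
  by (simp add: comult_def zero_word_def flip: single_one)

lemma comult_generators:
  "comult q gx = basis (Word [Lx], 0) + basis (0, Word [Lx])"
  "comult q gv = basis (Word [Lv], 0) + basis (0, Word [Lv])"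
  by (simp_all add: comult_def braided_mult_single zero_word_def plus_word_def)

lemma counit_hom:
  "counit 1 = 1" "counit gx = 0" "counit gv = 0"
  "counit (a + b) = counit a + counit b" "counit (cscale c a) = c * counit a"
  "counit (a * b) = counit a * counit b"
proof -
  show "counit (a * b) = counit a * counit b"
  proof (induction a rule: free_induct)
    case (single k c)
    show ?case
    proof (induction b rule: free_induct)
      case (single k' c')
      show ?case
        by (cases k; cases k')
           (simp add: counit_def mult_single lookup_single plus_word_def zero_word_def when_def)
    qed (simp add: counit_def distrib_left lookup_add)
  qed (simp add: counit_def distrib_right lookup_add)
qed (simp_all add: counit_def lookup_single lookup_add lookup_one zero_word_def)

lemma free_star_superset:
  assumes "finite S" "Poly_Mapping.keys p \<subseteq> S"
  shows "free_star p = (\<Sum>w\<in>S. Poly_Mapping.single (Word (rev (map star_letter (letters w))))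
           (cnj (Poly_Mapping.lookup p w)))"
  unfolding free_star_def using assms
  by (intro sum.mono_neutral_left) (auto simp: in_keys_iff)

lemma free_star_single [simp]:
  "free_star (Poly_Mapping.single w c) =
     Poly_Mapping.single (Word (rev (map star_letter (letters w)))) (cnj c)"
  by (subst free_star_superset[of "{w}"]) auto

lemma free_star_add [simp]: "free_star (p + r) = free_star p + free_star r"
proof -
  let ?S = "Poly_Mapping.keys p \<union> Poly_Mapping.keys r"
  have "finite ?S" by simp
  moreover have "Poly_Mapping.keys (p + r) \<subseteq> ?S" by (rule keys_add)
  ultimately show ?thesis
    by (simp add: free_star_superset[of ?S] lookup_add sum.distrib single_add)
qed

lemma star_letter_star_letter [simp]: "star_letter (star_letter l) = l"
  by (cases l) simp_all

lemma cring_complex_ring: "cring complex_ring"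
proof (rule cringI)
  show "abelian_group complex_ring"
  proof (rule abelian_groupI)
    fix x assume "x \<in> carrier complex_ring"
    show "\<exists>y\<in>carrier complex_ring. y \<oplus>\<^bsub>complex_ring\<^esub> x = \<zero>\<^bsub>complex_ring\<^esub>"
      by (intro bexI[of _ "- x"]) (simp_all add: complex_ring_def)
  qed (simp_all add: complex_ring_def)
  show "comm_monoid complex_ring"
    by (rule comm_monoidI) (simp_all add: complex_ring_def)
qed (simp add: complex_ring_def distrib_right)

lemma unital_star_algebra_V_alg: "unital_star_algebra V_alg"
proof -
  have ag: "abelian_group V_alg"
  proof (rule abelian_groupI)
    fix x assume "x \<in> carrier V_alg"
    show "\<exists>y\<in>carrier V_alg. y \<oplus>\<^bsub>V_alg\<^esub> x = \<zero>\<^bsub>V_alg\<^esub>"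
      by (intro bexI[of _ "- x"]) (simp_all add: V_alg_def)
  qed (simp_all add: V_alg_def add.assoc add.commute)
  have mon: "monoid V_alg"
    by (rule monoidI) (simp_all add: V_alg_def mult.assoc)
  have r: "ring V_alg"
    by (rule ringI[OF ag mon]) (simp_all add: V_alg_def distrib_left distrib_right)
  have m: "Module.module complex_ring V_alg"
    by (rule moduleI[OF cring_complex_ring ag]) (simp_all add: V_alg_def complex_ring_def)
  have sl: "cscale c a * b = cscale c (a * b)" for c and a b :: free_alg
  proof (induction a rule: free_induct)
    case (single k d)
    show ?case by (induction b rule: free_induct) (simp_all add: mult_single distrib_left ac_simps)
  qed (simp add: distrib_right)
  have sr: "a * cscale c b = cscale c (a * b)" for c and a b :: free_alg
  proof (induction a rule: free_induct)
    case (single k d)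
    show ?case by (induction b rule: free_induct) (simp_all add: mult_single distrib_left ac_simps)
  qed (simp add: distrib_right)
  have ss: "free_star (free_star a) = a" for a
    by (induction a rule: free_induct) (simp_all add: rev_map o_def)
  have sc: "free_star (cscale c a) = cscale (cnj c) (free_star a)" for c a
    by (induction a rule: free_induct) simp_all
  have sm: "free_star (a * b) = free_star b * free_star a" for a b
  proof (induction a rule: free_induct)
    case (single k d)
    show ?case
      by (induction b rule: free_induct)
         (simp_all add: mult_single plus_word_def distrib_left distrib_right mult.commute)
  qed (simp add: distrib_left distrib_right)
  show ?thesis
    by (intro unital_star_algebra.intro r m unital_star_algebra_axioms.intro)
       (simp_all add: V_alg_def sl sr ss sc sm)
qed

end

theory Submission
  imports Defs "HOL-Library.Function_Algebras" "HOL-Real_Asymp.Real_Asymp"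
begin

text \<open>
  Necessity: the marginals of a process are states, so \<open>L\<close> is hermitian and conditionally positive;
  exchanging the order of two independent increments forces \<open>\<phi>\<^sub>t(w)\<^sup>2 = q\<^sup>k \<phi>\<^sub>t(w)\<^sup>2\<close> with
  \<open>k = (n\<^sub>x(w) - n\<^sub>v(w)) |w|\<close>, which kills \<open>L(w)\<close> unless \<open>q\<^sup>k = 1\<close>.

  Sufficiency is a braided central limit theorem. On an infinite ladder of three-level sites let
  \<open>b\<^sub>i\<close> act on site \<open>i\<close> by a matrix with the prescribed second moments and on all later sites by a
  diagonal charge operator; then the \<open>b\<^sub>i\<close> satisfy the braid relations exactly and are independent in
  the vacuum state. The increment over \<open>[s, t)\<close> is the sequence of normalised sums
  \<open>n\<^sup>-\<^sup>1\<^sup>/\<^sup>2 \<Sum> b\<^sub>i\<close> over \<open>n s \<le> i < n t\<close> (plus a scalar drift if \<open>q = 1\<close>). Additivity, braid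
  relations and independence hold at each level \<open>n\<close>. Mixed vacuum moments are bounded in \<open>n\<close>,
  because tuples of sites with a singleton do not contribute, so by compactness they converge along
  some filter, which gives the state. The moments of one increment are polynomials in the number of sites,
  so they converge in the usual sense, to a function of \<open>t - s\<close> with derivative \<open>L\<close> at \<open>0\<close>.
\<close>

section \<open>Complex star algebras as a type class\<close>

text \<open>Both directions turn on the charge \<open>n_x - n_v\<close>. It decides which words
  survive in the necessity part; in the construction \<open>wt\<close> realises it on levels, and
  the matrix entry \<open>\<eta>\<close> behind L(xx) respects it only when q^2 = 1. Three levels
  suffice because only the Gram matrix of v|0> and x|0> is prescribed: a Cholesky factorisation
  writes them as \<alpha>|1> and \<eta>|1> + \<beta>|2>. The site operators need not be bounded when
  |q| differs from 1, so the work is done with finitely supported vectors, l1 norms and adjoint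
  pairs. Increments over uncountably many, possibly overlapping intervals must converge
  simultaneously. Exchanging two words of independent increments costs a power of q. Charge
  conservation makes this power 1 unless some factor has mean 0, which is why one state can
  factorise in every order.\<close>

class complex_star_algebra = ring_1 +
  fixes cmult :: "complex \<Rightarrow> 'a \<Rightarrow> 'a" (infixr "*\<^sub>C" 75)
    and adj :: "'a \<Rightarrow> 'a"
  assumes cmult_add_right: "c *\<^sub>C (a + b) = c *\<^sub>C a + c *\<^sub>C b"
    and cmult_add_left: "(c + d) *\<^sub>C a = c *\<^sub>C a + d *\<^sub>C a"
    and cmult_cmult [simp]: "c *\<^sub>C d *\<^sub>C a = (c * d) *\<^sub>C a"
    and cmult_one [simp]: "1 *\<^sub>C a = a"
    and cmult_times_left [simp]: "(c *\<^sub>C a) * b = c *\<^sub>C (a * b)"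
    and cmult_times_right [simp]: "a * (c *\<^sub>C b) = c *\<^sub>C (a * b)"
    and adj_adj [simp]: "adj (adj a) = a"
    and adj_add [simp]: "adj (a + b) = adj a + adj b"
    and adj_cmult [simp]: "adj (c *\<^sub>C a) = cnj c *\<^sub>C adj a"
    and adj_times [simp]: "adj (a * b) = adj b * adj a"
begin

lemma cmult_zero_left [simp]: "0 *\<^sub>C a = 0"
  using cmult_add_left[of 0 0 a] by simp

lemma cmult_zero_right [simp]: "c *\<^sub>C 0 = 0"
  using cmult_add_right[of c 0 0] by simp

lemma cmult_sum_right: "c *\<^sub>C sum f S = (\<Sum>i\<in>S. c *\<^sub>C f i)"
  by (induction S rule: infinite_finite_induct) (simp_all add: cmult_add_right)

lemma adj_one [simp]: "adj 1 = 1"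
  using adj_times[of "adj 1" 1] by simp

lemma adj_zero [simp]: "adj 0 = 0"
  using adj_add[of 0 0] by simp

lemma adj_sum: "adj (sum f S) = (\<Sum>i\<in>S. adj (f i))"
  by (induction S rule: infinite_finite_induct) simp_all

lemma adj_prod_list: "adj (prod_list as) = prod_list (rev (map adj as))"
  by (induction as) simp_all

end

text \<open>The process lives in sequences of operators indexed by the level n. With pointwise
  operations every algebraic law is checked level by level, and no quotient by null sequences is
  taken.\<close>

instantiation "fun" :: (type, complex_star_algebra) complex_star_algebra
begin

definition cmult_fun :: "complex \<Rightarrow> ('a \<Rightarrow> 'b) \<Rightarrow> 'a \<Rightarrow> 'b" where
  "cmult_fun c a = (\<lambda>n. c *\<^sub>C a n)"

definition adj_fun :: "('a \<Rightarrow> 'b) \<Rightarrow> 'a \<Rightarrow> 'b" where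
  "adj_fun a = (\<lambda>n. adj (a n))"

instance
  by standard
     (simp_all add: cmult_fun_def adj_fun_def fun_eq_iff cmult_add_right cmult_add_left)

end

lemma prod_list_fun: "prod_list as n = prod_list (map (\<lambda>a. a n) as)"
  for as :: "('b \<Rightarrow> 'a::monoid_mult) list"
  by (induction as) simp_all


section \<open>Evaluation homomorphisms of the free algebra\<close>

definition pext :: "('k \<Rightarrow> 'a) \<Rightarrow> ('k \<Rightarrow>\<^sub>0 complex) \<Rightarrow> 'a::complex_star_algebra" where
  "pext f p = (\<Sum>k\<in>Poly_Mapping.keys p. Poly_Mapping.lookup p k *\<^sub>C f k)"

lemma pext_superset:
  assumes "finite S" "Poly_Mapping.keys p \<subseteq> S"
  shows "pext f p = (\<Sum>k\<in>S. Poly_Mapping.lookup p k *\<^sub>C f k)"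
  unfolding pext_def using assms
  by (intro sum.mono_neutral_left) (auto simp: in_keys_iff)

lemma pext_single [simp]: "pext f (Poly_Mapping.single k c) = c *\<^sub>C f k"
  by (subst pext_superset[of "{k}"]) auto

lemma pext_add [simp]: "pext f (p + r) = pext f p + pext f r"
proof -
  let ?S = "Poly_Mapping.keys p \<union> Poly_Mapping.keys r"
  have "finite ?S" by simp
  moreover have "Poly_Mapping.keys (p + r) \<subseteq> ?S" by (rule keys_add)
  ultimately show ?thesis
    by (simp add: pext_superset[of ?S] lookup_add sum.distrib cmult_add_left)
qed

lemma pext_zero [simp]: "pext f 0 = 0"
  by (simp add: pext_def)

lemma pext_cscale [simp]: "pext f (cscale c p) = c *\<^sub>C pext f p"
  by (induction p rule: free_induct) (simp_all add: cmult_add_right)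

lemma pext_fun: "pext f p n = pext (\<lambda>k. f k n) p"
  by (induction p rule: free_induct) (simp_all add: cmult_fun_def)

abbreviation word_eval :: "(letter \<Rightarrow> 'a) \<Rightarrow> letter list \<Rightarrow> 'a::monoid_mult" where
  "word_eval X ls \<equiv> prod_list (map X ls)"

definition eval :: "(letter \<Rightarrow> 'a) \<Rightarrow> free_alg \<Rightarrow> 'a::complex_star_algebra" where
  "eval X = pext (\<lambda>w. word_eval X (letters w))"

lemma eval_single: "eval X (Poly_Mapping.single w c) = c *\<^sub>C word_eval X (letters w)"
  by (simp add: eval_def)

lemma eval_add: "eval X (p + r) = eval X p + eval X r"
  by (simp add: eval_def)

lemma eval_cscale: "eval X (cscale c p) = c *\<^sub>C eval X p"
  by (simp add: eval_def)

lemma eval_one: "eval X 1 = 1"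
  by (simp add: eval_single zero_word_def flip: single_one)

lemma eval_mult: "eval X (p * r) = eval X p * eval X r"
proof (induction p rule: free_induct)
  case (single k c)
  show ?case
    by (induction r rule: free_induct)
       (simp_all add: eval_single mult_single plus_word_def eval_add distrib_left mult.commute)
qed (simp add: eval_add distrib_right)

lemma eval_free_star:
  assumes "\<And>l. adj (X l) = X (star_letter l)"
  shows "eval X (free_star p) = adj (eval X p)"
proof (induction p rule: free_induct)
  case (single k c)
  show ?case
    by (simp add: eval_single adj_prod_list rev_map o_def assms)
qed (simp add: eval_add)

lemma eval_zero_letters: "eval (\<lambda>_. 0) p = counit p *\<^sub>C 1"
proof (induction p rule: free_induct)
  case (single k c)
  show ?case
    by (cases k; cases "letters k")
       (simp_all add: eval_single counit_def lookup_single zero_word_def when_def)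
qed (simp add: eval_add counit_hom cmult_add_left)

text \<open>Counterpart of \<open>mult_tensor\<close> for two evaluation homomorphisms, placed in
  the type class so that it is computed by linearity; \<open>mult_tensor_transport\<close> is the
  link.\<close>

definition tensor_eval :: "(letter \<Rightarrow> 'a) \<Rightarrow> (letter \<Rightarrow> 'a) \<Rightarrow> free_alg2 \<Rightarrow> 'a::complex_star_algebra"
  where "tensor_eval X Y = pext (\<lambda>(u, w). word_eval X (letters u) * word_eval Y (letters w))"

definition charge :: "letter list \<Rightarrow> int" where
  "charge ls = int (count_list ls Lx) - int (count_list ls Lv)"

lemma charge_simps [simp]:
  "charge [] = 0" "charge (Lx # ls) = charge ls + 1" "charge (Lv # ls) = charge ls - 1"
  "charge (ls @ ms) = charge ls + charge ms"
  by (simp_all add: charge_def)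

lemma charge_Cons: "charge (l # ls) = charge [l] + charge ls"
  by (cases l) simp_all

abbreviation qpow :: "real \<Rightarrow> int \<Rightarrow> complex" where
  "qpow q m \<equiv> complex_of_real (q powi m)"

text \<open>\<open>X\<close> belongs to the earlier and \<open>Y\<close> to the later increment. On
  single letters the braiding exponent is the charge of the letter of \<open>Y\<close> times the
  length 1.\<close>

definition braid_commute ::
    "real \<Rightarrow> (letter \<Rightarrow> 'a::complex_star_algebra) \<Rightarrow> (letter \<Rightarrow> 'a) \<Rightarrow> bool" where
  "braid_commute q X Y \<longleftrightarrow>
    (\<forall>l l'. Y l * X l' = qpow q (charge [l]) *\<^sub>C (X l' * Y l))"

lemma braid_commute_letter_word:
  assumes "braid_commute q X Y" "q \<noteq> 0"
  shows "Y l * word_eval X ms = qpow q (charge [l] * int (length ms)) *\<^sub>C (word_eval X ms * Y l)"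
proof (induction ms)
  case (Cons m ms)
  have "Y l * word_eval X (m # ms) = (Y l * X m) * word_eval X ms"
    by (simp add: mult.assoc)
  also have "\<dots> = qpow q (charge [l]) *\<^sub>C (X m * (Y l * word_eval X ms))"
    using assms(1) by (simp add: braid_commute_def mult.assoc)
  also have "\<dots> = (qpow q (charge [l]) * qpow q (charge [l] * int (length ms)))
      *\<^sub>C (word_eval X (m # ms) * Y l)"
    by (simp add: Cons mult.assoc)
  finally show ?case
    using assms(2) by (simp add: distrib_left power_int_add)
qed simp

lemma braid_commute_word_word:
  assumes "braid_commute q X Y" "q \<noteq> 0"
  shows "word_eval Y ls * word_eval X ms =
    qpow q (charge ls * int (length ms)) *\<^sub>C (word_eval X ms * word_eval Y ls)"
proof (induction ls)
  case (Cons l ls)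
  have "word_eval Y (l # ls) * word_eval X ms = Y l * (word_eval Y ls * word_eval X ms)"
    by (simp add: mult.assoc)
  also have "\<dots> = qpow q (charge ls * int (length ms)) *\<^sub>C ((Y l * word_eval X ms) * word_eval Y ls)"
    by (simp add: Cons mult.assoc)
  also have "\<dots> = (qpow q (charge ls * int (length ms)) * qpow q (charge [l] * int (length ms)))
      *\<^sub>C (word_eval X ms * word_eval Y (l # ls))"
    by (simp add: braid_commute_letter_word[OF assms] mult.assoc)
  finally show ?case
    using assms(2) by (simp add: charge_Cons[of l ls] algebra_simps power_int_add)
qed simp

lemma tensor_eval_braid:
  assumes "braid_commute q X Y" "q \<noteq> 0"
  shows "tensor_eval Y X z = tensor_eval X Y (braid q z)"
proof (induction z rule: free_induct)
  case (single k c)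
  obtain u w where k: "k = (u, w)" by (cases k)
  show ?case
    using braid_commute_word_word[OF assms, of "letters u" "letters w"]
    by (simp add: k tensor_eval_def braid_def num_letter_def flip: charge_def)
qed (simp_all add: tensor_eval_def braid_def)

lemma tensor_eval_braided_mult_letter:
  assumes "braid_commute q X Y" "q \<noteq> 0"
  shows "tensor_eval X Y (braided_mult q (basis (Word [l], 0) + basis (0, Word [l])) z) =
    (X l + Y l) * tensor_eval X Y z"
proof (induction z rule: free_induct)
  case (single k c)
  obtain u w where k: "k = (u, w)" by (cases k)
  have ch: "int (num_letter Lx (Word [l])) - int (num_letter Lv (Word [l])) = charge [l]"
    by (simp add: num_letter_def charge_def)
  \<comment> \<open>The factor created by \<open>braided_mult\<close> is exactly what lets
    \<open>Y l\<close> move from behind the word in \<open>X\<close> to its front.\<close>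
  have "qpow q (charge [l] * int (length (letters u))) *\<^sub>C
      (word_eval X (letters u) * (Y l * word_eval Y (letters w))) =
      (Y l * word_eval X (letters u)) * word_eval Y (letters w)"
    by (simp add: braid_commute_letter_word[OF assms] mult.assoc)
  then show ?case
    by (simp add: k tensor_eval_def braided_mult_single ch plus_word_def zero_word_def
        num_letter_zero[unfolded zero_word_def] distrib_right cmult_add_right mult.assoc
        del: cmult_cmult add: cmult_cmult[symmetric])
qed (simp add: tensor_eval_def distrib_left)

text \<open>A braid-commuting pair turns the braided product of the tensor square into the operator
  product, so \<Delta> becomes substitution of \<open>X + Y\<close>. The increment axiom thus
  reduces to additivity on letters.\<close>

lemma tensor_eval_comult:
  assumes "braid_commute q X Y" "q \<noteq> 0"
  shows "tensor_eval X Y (comult q p) = eval (\<lambda>l. X l + Y l) p"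
proof (induction p rule: free_induct)
  case (single k c)
  have "tensor_eval X Y (comult_letters q ls) = word_eval (\<lambda>l. X l + Y l) ls" for ls
  proof (induction ls)
    case Nil
    show ?case by (simp add: tensor_eval_def zero_word_def)
  next
    case (Cons l ls)
    then show ?case
      by (simp add: tensor_eval_braided_mult_letter[OF assms] del: braided_mult_add)
  qed
  then show ?case
    by (simp add: comult_def eval_single tensor_eval_def)
qed (simp add: comult_def eval_add tensor_eval_def)

section \<open>Adjointable operators on finitely supported functions\<close>

definition ip :: "('k \<Rightarrow>\<^sub>0 complex) \<Rightarrow> ('k \<Rightarrow>\<^sub>0 complex) \<Rightarrow> complex" where
  "ip u v = (\<Sum>k\<in>Poly_Mapping.keys u. cnj (Poly_Mapping.lookup u k) * Poly_Mapping.lookup v k)"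

lemma ip_superset:
  assumes "finite S" "Poly_Mapping.keys u \<subseteq> S"
  shows "ip u v = (\<Sum>k\<in>S. cnj (Poly_Mapping.lookup u k) * Poly_Mapping.lookup v k)"
  unfolding ip_def using assms
  by (intro sum.mono_neutral_left) (auto simp: in_keys_iff)

lemma ip_single_left [simp]: "ip (Poly_Mapping.single k c) v = cnj c * Poly_Mapping.lookup v k"
  by (subst ip_superset[of "{k}"]) auto

lemma ip_add_left [simp]: "ip (u + u') v = ip u v + ip u' v"
proof -
  let ?S = "Poly_Mapping.keys u \<union> Poly_Mapping.keys u'"
  have "finite ?S" by simp
  moreover have "Poly_Mapping.keys (u + u') \<subseteq> ?S" by (rule keys_add)
  ultimately show ?thesis
    by (simp add: ip_superset[of ?S] lookup_add sum.distrib distrib_right)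
qed

lemma ip_add_right [simp]: "ip u (v + v') = ip u v + ip u v'"
  by (simp add: ip_def lookup_add distrib_left sum.distrib)

lemma ip_cscale_right [simp]: "ip u (cscale c v) = c * ip u v"
  by (simp add: ip_def sum_distrib_left ac_simps)

lemma ip_cscale_left [simp]: "ip (cscale c u) v = cnj c * ip u v"
  by (induction u rule: free_induct) (simp_all add: distrib_left)

lemma ip_zero [simp]: "ip 0 v = 0" "ip u 0 = 0"
  by (simp_all add: ip_def)

lemma ip_commute: "ip v u = cnj (ip u v)"
proof -
  let ?S = "Poly_Mapping.keys u \<union> Poly_Mapping.keys v"
  show ?thesis
    by (simp add: ip_superset[of ?S] mult.commute)
qed

lemma ip_self_nonneg: "ip u u \<in> \<real>\<^sub>\<ge>\<^sub>0"
proof -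
  have "ip u u = (\<Sum>k\<in>Poly_Mapping.keys u. complex_of_real ((cmod (Poly_Mapping.lookup u k))\<^sup>2))"
    unfolding ip_def by (intro sum.cong) (simp_all add: complex_norm_square mult.commute del: of_real_power)
  also have "\<dots> = complex_of_real (\<Sum>k\<in>Poly_Mapping.keys u. (cmod (Poly_Mapping.lookup u k))\<^sup>2)"
    by simp
  finally show ?thesis
    by (simp add: sum_nonneg del: of_real_sum)
qed

text \<open>Basis vectors are orthonormal, so only the common support point contributes. With
  \<open>k\<close> the vacuum this turns locality into factorisation of the state.\<close>

lemma ip_disjoint:
  assumes "Poly_Mapping.keys u \<inter> Poly_Mapping.keys v \<subseteq> {k}"
  shows "ip u v = cnj (Poly_Mapping.lookup u k) * Poly_Mapping.lookup v k"
proof -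
  have "ip u v = (\<Sum>j\<in>insert k (Poly_Mapping.keys u).
      cnj (Poly_Mapping.lookup u j) * Poly_Mapping.lookup v j)"
    by (rule ip_superset) auto
  also have "\<dots> = (\<Sum>j\<in>{k}. cnj (Poly_Mapping.lookup u j) * Poly_Mapping.lookup v j)"
    using assms by (intro sum.mono_neutral_right) (auto simp: in_keys_iff)
  finally show ?thesis by simp
qed

definition clin :: "(('k \<Rightarrow>\<^sub>0 complex) \<Rightarrow> ('l \<Rightarrow>\<^sub>0 complex)) \<Rightarrow> bool" where
  "clin S \<longleftrightarrow> (\<forall>u v. S (u + v) = S u + S v) \<and> (\<forall>c u. S (cscale c u) = cscale c (S u))"

lemma cscale_uminus: "cscale c (- u) = - cscale c u"
  by (intro poly_mapping_eqI) (simp add: lookup_uminus)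

lemma cscale_minus: "cscale c (u - v) = cscale c u - cscale c v"
  by (intro poly_mapping_eqI) (simp add: lookup_minus algebra_simps)

lemma ip_uminus [simp]: "ip (- u) v = - ip u v" "ip u (- v) = - ip u v"
  by (simp_all add: ip_def sum_negf lookup_uminus)

lemma ip_minus [simp]: "ip (u - u') v = ip u v - ip u' v" "ip u (v - v') = ip u v - ip u v'"
  using ip_add_left[of u "- u'" v] ip_add_right[of u v "- v'"] by simp_all

text \<open>An operator is stored together with its adjoint: on a space that is not complete an
  adjoint need not exist, and the site operators need not be bounded.\<close>

typedef 'k adj_op =
  "{(S :: ('k \<Rightarrow>\<^sub>0 complex) \<Rightarrow> ('k \<Rightarrow>\<^sub>0 complex), S').
     clin S \<and> clin S' \<and> (\<forall>u v. ip (S u) v = ip u (S' v))}"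
  by (rule exI[of _ "(\<lambda>_. 0, \<lambda>_. 0)"]) (simp add: clin_def)

lifting_forget poly_mapping.lifting
setup_lifting type_definition_adj_op

lift_definition app :: "'k adj_op \<Rightarrow> ('k \<Rightarrow>\<^sub>0 complex) \<Rightarrow> ('k \<Rightarrow>\<^sub>0 complex)" is fst .

instantiation adj_op :: (type) complex_star_algebra
begin

lift_definition zero_adj_op :: "'k adj_op" is "(\<lambda>_. 0, \<lambda>_. 0)"
  by (simp add: clin_def)

lift_definition one_adj_op :: "'k adj_op" is "(\<lambda>u. u, \<lambda>u. u)"
  by (simp add: clin_def)

lift_definition plus_adj_op :: "'k adj_op \<Rightarrow> 'k adj_op \<Rightarrow> 'k adj_op" is
  "\<lambda>(S, S') (R, R'). (\<lambda>u. S u + R u, \<lambda>u. S' u + R' u)"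
  by (auto simp: clin_def algebra_simps)

lift_definition minus_adj_op :: "'k adj_op \<Rightarrow> 'k adj_op \<Rightarrow> 'k adj_op" is
  "\<lambda>(S, S') (R, R'). (\<lambda>u. S u - R u, \<lambda>u. S' u - R' u)"
  by (auto simp: clin_def algebra_simps cscale_minus)

lift_definition uminus_adj_op :: "'k adj_op \<Rightarrow> 'k adj_op" is
  "\<lambda>(S, S'). (\<lambda>u. - S u, \<lambda>u. - S' u)"
  by (auto simp: clin_def algebra_simps cscale_uminus)

lift_definition times_adj_op :: "'k adj_op \<Rightarrow> 'k adj_op \<Rightarrow> 'k adj_op" is
  "\<lambda>(S, S') (R, R'). (\<lambda>u. S (R u), \<lambda>u. R' (S' u))"
  by (auto simp: clin_def)

lift_definition cmult_adj_op :: "complex \<Rightarrow> 'k adj_op \<Rightarrow> 'k adj_op" is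
  "\<lambda>c (S, S'). (\<lambda>u. cscale c (S u), \<lambda>u. cscale (cnj c) (S' u))"
  by (auto simp: clin_def mult.commute)

lift_definition adj_adj_op :: "'k adj_op \<Rightarrow> 'k adj_op" is "\<lambda>(S, S'). (S', S)"
  by (auto simp: clin_def) (metis ip_commute)

instance
proof
  show "(0::'k adj_op) \<noteq> 1"
  proof transfer
    have "(\<lambda>_. 0) \<noteq> (\<lambda>u :: 'k \<Rightarrow>\<^sub>0 complex. u)"
      by (metis one_neq_zero lookup_single_eq lookup_zero)
    then show "((\<lambda>_. 0 :: 'k \<Rightarrow>\<^sub>0 complex, \<lambda>_. 0 :: 'k \<Rightarrow>\<^sub>0 complex)) \<noteq> (\<lambda>u. u, \<lambda>u. u)"
      by simp
  qed
qed (transfer; auto simp: clin_def algebra_simps fun_eq_iff; fail)+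

end

lemma app_simps [simp]:
  "app 0 u = 0" "app 1 u = u" "app (a + b) u = app a u + app b u" "app (a - b) u = app a u - app b u"
  "app (a * b) u = app a (app b u)" "app (c *\<^sub>C a) u = cscale c (app a u)"
  by (transfer; auto)+

lemma app_clin [simp]:
  "app a (u + v) = app a u + app a v" "app a (cscale c u) = cscale c (app a u)" "app a 0 = 0"
proof -
  show add: "app a (u + v) = app a u + app a v" for u v
    by transfer (auto simp: clin_def)
  show "app a (cscale c u) = cscale c (app a u)"
    by transfer (auto simp: clin_def)
  show "app a 0 = 0"
    using add[of 0 0] by simp
qed

lemma app_sum: "app (sum f S) u = (\<Sum>i\<in>S. app (f i) u)"
  by (induction S rule: infinite_finite_induct) simp_all

lemma ip_app: "ip (app a u) v = ip u (app (adj a) v)"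
  by transfer auto

text \<open>The matrix entries of an adjoint are read off by \<open>ip\<close>, so the first
  component of the pair determines the second.\<close>

lemma app_inject:
  assumes "\<And>k. app a (basis k) = app b (basis k)"
  shows "a = b"
proof -
  have *: "app a u = app b u" for u
  proof (induction u rule: free_induct)
    case (single k c)
    then show ?case
      using app_clin(2)[of a c "basis k"] app_clin(2)[of b c "basis k"] assms[of k] by simp
  qed simp
  have adj: "app (adj a) v = app (adj b) v" for v
  proof (rule poly_mapping_eqI)
    fix k
    have "ip (basis k) (app (adj a) v) = ip (basis k) (app (adj b) v)"
      by (simp only: ip_app[symmetric] *)
    then show "Poly_Mapping.lookup (app (adj a) v) k = Poly_Mapping.lookup (app (adj b) v) k"
      by simp
  qed
  show ?thesis
    using * adj by transfer (auto simp: fun_eq_iff)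
qed

definition mk_op :: "('k \<Rightarrow> ('k \<Rightarrow>\<^sub>0 complex)) \<Rightarrow> ('k \<Rightarrow> ('k \<Rightarrow>\<^sub>0 complex)) \<Rightarrow> 'k adj_op" where
  "mk_op f f' = Abs_adj_op (lin_ext f, lin_ext f')"

text \<open>The hypothesis says that \<open>f'\<close> is the conjugate transpose of
  \<open>f\<close>; the types make the columns of both matrices finite.\<close>

lemma
  assumes "\<And>k k'. Poly_Mapping.lookup (f' k') k = cnj (Poly_Mapping.lookup (f k) k')"
  shows app_mk_op: "app (mk_op f f') = lin_ext f"
    and adj_mk_op: "adj (mk_op f f') = mk_op f' f"
proof -
  have *: "ip (lin_ext f u) v = ip u (lin_ext f' v)"
    if "\<And>k k'. Poly_Mapping.lookup (f' k') k = cnj (Poly_Mapping.lookup (f k) k')"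
    for u v and f f' :: "'a \<Rightarrow> ('a \<Rightarrow>\<^sub>0 complex)"
  proof (induction v rule: free_induct)
    case (single k c)
    show ?case
    proof (induction u rule: free_induct)
      case (single k' c')
      show ?case
        using arg_cong[OF ip_commute[of "Poly_Mapping.single k c" "f k'"], of cnj]
        by (simp add: that ac_simps)
    qed (simp add: distrib_left)
  qed simp
  have mem: "(lin_ext f, lin_ext f') \<in> {(S, S'). clin S \<and> clin S' \<and> (\<forall>u v. ip (S u) v = ip u (S' v))}"
    using *[of f' f, OF assms] by (simp add: clin_def lin_ext_cscale)
  show "app (mk_op f f') = lin_ext f"
    using mem by (simp add: app_def mk_op_def Abs_adj_op_inverse)
  show "adj (mk_op f f') = mk_op f' f"
    using mem by (simp add: adj_adj_op_def mk_op_def Abs_adj_op_inverse)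
qed

definition vec_state :: "'k \<Rightarrow> 'k adj_op \<Rightarrow> complex" where
  "vec_state k a = Poly_Mapping.lookup (app a (basis k)) k"

lemma vec_state_linear [simp]:
  "vec_state k 0 = 0" "vec_state k 1 = 1"
  "vec_state k (a + b) = vec_state k a + vec_state k b"
  "vec_state k (c *\<^sub>C a) = c * vec_state k a"
  by (simp_all add: vec_state_def lookup_add)

lemma vec_state_sum: "vec_state k (sum f S) = (\<Sum>i\<in>S. vec_state k (f i))"
  by (induction S rule: infinite_finite_induct) simp_all

lemma vec_state_times: "vec_state k (a * b) = ip (app (adj a) (basis k)) (app b (basis k))"
  by (simp add: ip_app vec_state_def)

lemma vec_state_adj: "vec_state k (adj a) = cnj (vec_state k a)"
  using ip_commute[of "app a (basis k)" "basis k"] by (simp add: ip_app vec_state_def)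

lemma vec_state_nonneg: "vec_state k (adj a * a) \<in> \<real>\<^sub>\<ge>\<^sub>0"
  by (simp add: vec_state_times ip_self_nonneg del: app_simps)

lemma app_sum_right: "app a (sum f S) = (\<Sum>i\<in>S. app a (f i))"
  by (induction S rule: infinite_finite_induct) simp_all

lemma app_single: "app a (Poly_Mapping.single k c) = cscale c (app a (basis k))"
  using app_clin(2)[of a c "basis k"] by simp

lemma app_lin_ext: "app a u = lin_ext (\<lambda>k. app a (basis k)) u"
proof (induction u rule: free_induct)
  case (single k c)
  show ?case using app_single[of a k c] by simp
qed simp

lemma keys_lin_ext: "Poly_Mapping.keys (lin_ext f u) \<subseteq> (\<Union>k\<in>Poly_Mapping.keys u. Poly_Mapping.keys (f k))"
proof
  fix j assume "j \<in> Poly_Mapping.keys (lin_ext f u)"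
  then have "(\<Sum>k\<in>Poly_Mapping.keys u. Poly_Mapping.lookup u k * Poly_Mapping.lookup (f k) j) \<noteq> 0"
    by (simp add: lin_ext_def in_keys_iff lookup_sum)
  then obtain k where "k \<in> Poly_Mapping.keys u" "Poly_Mapping.lookup (f k) j \<noteq> 0"
    by (metis (no_types, lifting) mult_eq_0_iff sum.not_neutral_contains_not_neutral)
  then show "j \<in> (\<Union>k\<in>Poly_Mapping.keys u. Poly_Mapping.keys (f k))"
    by (auto simp: in_keys_iff)
qed

lemma keys_app:
  assumes "\<And>k. k \<in> Poly_Mapping.keys u \<Longrightarrow> Poly_Mapping.keys (app a (basis k)) \<subseteq> S"
  shows "Poly_Mapping.keys (app a u) \<subseteq> S"
  using keys_lin_ext[of "\<lambda>k. app a (basis k)" u] assms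
  by (auto simp: app_lin_ext[of a u, symmetric])

text \<open>The l1 norm dominates every coefficient, hence \<open>vec_state\<close>, and is
  controlled column by column.\<close>

definition norm1 :: "('k \<Rightarrow>\<^sub>0 complex) \<Rightarrow> real" where
  "norm1 u = (\<Sum>k\<in>Poly_Mapping.keys u. cmod (Poly_Mapping.lookup u k))"

lemma norm1_superset:
  assumes "finite S" "Poly_Mapping.keys u \<subseteq> S"
  shows "norm1 u = (\<Sum>k\<in>S. cmod (Poly_Mapping.lookup u k))"
  unfolding norm1_def using assms
  by (intro sum.mono_neutral_left) (auto simp: in_keys_iff)

lemma norm1_single [simp]: "norm1 (Poly_Mapping.single k c) = cmod c"
  by (subst norm1_superset[of "{k}"]) auto

lemma norm1_add: "norm1 (u + v) \<le> norm1 u + norm1 v"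
proof -
  let ?S = "Poly_Mapping.keys u \<union> Poly_Mapping.keys v"
  have "finite ?S" by simp
  moreover have "Poly_Mapping.keys (u + v) \<subseteq> ?S" by (rule keys_add)
  ultimately show ?thesis
    by (simp add: norm1_superset[of ?S] lookup_add sum_mono norm_triangle_ineq flip: sum.distrib)
qed

lemma norm1_sum: "norm1 (sum f S) \<le> (\<Sum>i\<in>S. norm1 (f i))"
proof (induction S rule: infinite_finite_induct)
  case (insert i S)
  then show ?case
    using norm1_add[of "f i" "sum f S"] by simp
qed (simp_all add: norm1_def)

lemma norm1_cscale: "norm1 (cscale c u) = cmod c * norm1 u"
proof -
  have "Poly_Mapping.keys (cscale c u) \<subseteq> Poly_Mapping.keys u"
    by (auto simp: in_keys_iff)
  then show ?thesis
    by (simp add: norm1_superset[of "Poly_Mapping.keys u"] norm_mult sum_distrib_left)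
qed

lemma norm1_nonneg: "0 \<le> norm1 u"
  by (simp add: norm1_def sum_nonneg)

lemma norm_lookup_le_norm1: "cmod (Poly_Mapping.lookup u k) \<le> norm1 u"
proof (cases "k \<in> Poly_Mapping.keys u")
  case True
  then show ?thesis
    unfolding norm1_def by (intro member_le_sum) auto
qed (simp add: in_keys_iff norm1_nonneg)

text \<open>Only the columns that \<open>u\<close> meets enter. This matters because the columns of
  a site operator need not be uniformly bounded.\<close>

lemma norm1_app:
  assumes "\<And>k. k \<in> Poly_Mapping.keys u \<Longrightarrow> norm1 (app a (basis k)) \<le> B"
  shows "norm1 (app a u) \<le> B * norm1 u"
proof -
  have "norm1 (app a u) \<le>
      (\<Sum>k\<in>Poly_Mapping.keys u. norm1 (cscale (Poly_Mapping.lookup u k) (app a (basis k))))"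
    by (subst app_lin_ext) (simp add: lin_ext_def norm1_sum)
  also have "\<dots> \<le> (\<Sum>k\<in>Poly_Mapping.keys u. cmod (Poly_Mapping.lookup u k) * B)"
    using assms by (intro sum_mono) (simp add: norm1_cscale mult_left_mono)
  finally show ?thesis
    by (simp add: norm1_def sum_distrib_left mult.commute)
qed


section \<open>A ladder of braided three-level sites\<close>

text \<open>Levels of all sites. Finite support leaves all but finitely many sites in level 0, and
  the zero map is the vacuum.\<close>

type_synonym config = "nat \<Rightarrow>\<^sub>0 nat"

abbreviation upd :: "nat \<Rightarrow> nat \<Rightarrow> config \<Rightarrow> config" where
  "upd \<equiv> Poly_Mapping.update"

lemma upd_commute: "i \<noteq> j \<Longrightarrow> upd i m (upd j p \<kappa>) = upd j p (upd i m \<kappa>)"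
  by (intro poly_mapping_eqI) (simp add: lookup_update)

lemma upd_upd [simp]: "upd i m (upd i p \<kappa>) = upd i m \<kappa>"
  by (intro poly_mapping_eqI) (simp add: lookup_update)

lemma upd_zero [simp]: "upd i 0 0 = 0"
  by (intro poly_mapping_eqI) (simp add: lookup_update)

lemma upd_eq_zero_iff [simp]: "upd i m 0 = 0 \<longleftrightarrow> m = 0"
  by (metis lookup_update upd_zero lookup_zero)

lemma keys_upd: "Poly_Mapping.keys (upd i m \<kappa>) \<subseteq> insert i (Poly_Mapping.keys \<kappa>)"
  by (auto simp: in_keys_iff lookup_update split: if_splits)

text \<open>The entry \<open>\<eta>\<close> lets \<open>x\<close> reach level 1, which
  \<open>v\<close> reaches too, although the letters have opposite charges. The weights
  \<open>q\<close> and \<open>inverse q\<close> of these charges agree exactly if q^2 = 1.\<close>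

locale braided_sites =
  fixes q :: real and \<alpha> \<beta> :: real and \<eta> :: complex
  assumes q_nz: "q \<noteq> 0" and charge_constraint: "\<eta> = 0 \<or> q\<^sup>2 = 1"
begin

text \<open>Level \<open>0\<close> is the vacuum; \<open>x\<close> acts as
  \<open>|0\<rangle> \<mapsto> \<eta>|1\<rangle> + \<beta>|2\<rangle>\<close> and \<open>|1\<rangle> \<mapsto> \<alpha>|0\<rangle>\<close>.\<close>

definition x_mat :: "nat \<Rightarrow> nat \<Rightarrow> complex" where
  "x_mat m p = (if p = 0 then if m = 1 then \<eta> else if m = 2 then of_real \<beta> else 0
     else if p = 1 \<and> m = 0 then of_real \<alpha> else 0)"

primrec site_mat :: "letter \<Rightarrow> nat \<Rightarrow> nat \<Rightarrow> complex" where
  "site_mat Lx = x_mat"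
| "site_mat Lv = (\<lambda>m p. cnj (x_mat p m))"

lemma site_mat_star: "site_mat (star_letter l) m p = cnj (site_mat l p m)"
  by (cases l) simp_all

lemma site_mat_range: "site_mat l m p \<noteq> 0 \<Longrightarrow> m < 3"
  by (cases l) (simp_all add: x_mat_def split: if_splits)

lemma site_mat_vacuum: "site_mat l 0 0 = 0"
  by (cases l) (simp_all add: x_mat_def)

text \<open>Level 1 is reached from the vacuum by \<open>v\<close> and level 2 by \<open>x\<close>;
  the weight is \<open>q\<close> to minus the charge of that letter.\<close>

definition wt :: "nat \<Rightarrow> real" where
  "wt p = (if p = 1 then q else if p = 2 then inverse q else 1)"

lemma wt_nz: "wt p \<noteq> 0"
  using q_nz by (simp add: wt_def)

lemma wt_0 [simp]: "wt 0 = 1"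
  by (simp add: wt_def)

lemma wt_site_mat: "site_mat l m p \<noteq> 0 \<Longrightarrow> wt p = q powi charge [l] * wt m"
proof -
  have *: "\<eta> \<noteq> 0 \<Longrightarrow> q * q = 1"
    using charge_constraint by (simp add: power2_eq_square)
  assume "site_mat l m p \<noteq> 0"
  with * q_nz show ?thesis
    by (cases l) (simp_all add: x_mat_def wt_def power_int_minus field_simps split: if_splits)
qed

text \<open>A Jordan-Wigner string attached to the sites after \<open>i\<close>. Vacuum sites have
  weight 1, so the product over occupied sites is the whole infinite product.\<close>

definition tail :: "nat \<Rightarrow> config \<Rightarrow> real" where
  "tail i \<kappa> = (\<Prod>j\<in>{j\<in>Poly_Mapping.keys \<kappa>. i < j}. wt (Poly_Mapping.lookup \<kappa> j))"

lemma tail_superset: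
  assumes "finite S" "Poly_Mapping.keys \<kappa> \<subseteq> S"
  shows "tail i \<kappa> = (\<Prod>j\<in>{j\<in>S. i < j}. wt (Poly_Mapping.lookup \<kappa> j))"
  unfolding tail_def using assms
  by (intro prod.mono_neutral_left) (auto simp: in_keys_iff intro!: gr0I)

lemma tail_upd_le:
  assumes "i \<le> l"
  shows "tail l (upd i m \<kappa>) = tail l \<kappa>"
proof -
  let ?S = "insert i (Poly_Mapping.keys \<kappa>)"
  have "tail l (upd i m \<kappa>) = (\<Prod>j\<in>{j\<in>?S. l < j}. wt (Poly_Mapping.lookup (upd i m \<kappa>) j))"
    using keys_upd by (intro tail_superset) auto
  also have "\<dots> = (\<Prod>j\<in>{j\<in>?S. l < j}. wt (Poly_Mapping.lookup \<kappa> j))"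
    using assms by (intro prod.cong) (auto simp: lookup_update)
  also have "\<dots> = tail l \<kappa>"
    by (intro tail_superset[symmetric]) auto
  finally show ?thesis .
qed

lemma tail_upd_gr:
  assumes "i < l"
  shows "wt (Poly_Mapping.lookup \<kappa> l) * tail i (upd l m \<kappa>) = wt m * tail i \<kappa>"
proof -
  let ?S = "insert l (Poly_Mapping.keys \<kappa>)"
  let ?S' = "{j\<in>Poly_Mapping.keys \<kappa> - {l}. i < j}"
  have S: "{j\<in>?S. i < j} = insert l ?S'"
    using assms by auto
  have "tail i (upd l m \<kappa>) = (\<Prod>j\<in>{j\<in>?S. i < j}. wt (Poly_Mapping.lookup (upd l m \<kappa>) j))"
    using keys_upd by (intro tail_superset) auto
  also have "\<dots> = wt m * (\<Prod>j\<in>?S'. wt (Poly_Mapping.lookup (upd l m \<kappa>) j))"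
    unfolding S by (subst prod.insert) (auto simp: lookup_update)
  also have "(\<Prod>j\<in>?S'. wt (Poly_Mapping.lookup (upd l m \<kappa>) j)) = (\<Prod>j\<in>?S'. wt (Poly_Mapping.lookup \<kappa> j))"
    by (intro prod.cong) (auto simp: lookup_update)
  finally have 1: "tail i (upd l m \<kappa>) = wt m * (\<Prod>j\<in>?S'. wt (Poly_Mapping.lookup \<kappa> j))" .
  have "tail i \<kappa> = (\<Prod>j\<in>{j\<in>?S. i < j}. wt (Poly_Mapping.lookup \<kappa> j))"
    by (intro tail_superset) auto
  also have "\<dots> = wt (Poly_Mapping.lookup \<kappa> l) * (\<Prod>j\<in>?S'. wt (Poly_Mapping.lookup \<kappa> j))"
    unfolding S by (subst prod.insert) auto
  finally show ?thesis
    using 1 by simp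
qed

definition site_fun :: "letter \<Rightarrow> nat \<Rightarrow> config \<Rightarrow> (config \<Rightarrow>\<^sub>0 complex)" where
  "site_fun l i \<kappa> = (\<Sum>m<3. Poly_Mapping.single (upd i m \<kappa>)
     (complex_of_real (tail i \<kappa>) * site_mat l m (Poly_Mapping.lookup \<kappa> i)))"

definition site :: "nat \<Rightarrow> letter \<Rightarrow> config adj_op" where
  "site i l = mk_op (site_fun l i) (site_fun (star_letter l) i)"

lemma lookup_site_fun:
  "Poly_Mapping.lookup (site_fun l i \<kappa>) \<kappa>' =
    (if \<kappa>' = upd i (Poly_Mapping.lookup \<kappa>' i) \<kappa>
     then complex_of_real (tail i \<kappa>) * site_mat l (Poly_Mapping.lookup \<kappa>' i) (Poly_Mapping.lookup \<kappa> i)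
     else 0)"
proof -
  let ?m = "Poly_Mapping.lookup \<kappa>' i"
  let ?c = "\<lambda>m. complex_of_real (tail i \<kappa>) * site_mat l m (Poly_Mapping.lookup \<kappa> i)"
  have eq: "upd i m \<kappa> = \<kappa>' \<longleftrightarrow> m = ?m \<and> \<kappa>' = upd i ?m \<kappa>" for m
    by (metis lookup_update)
  have "Poly_Mapping.lookup (site_fun l i \<kappa>) \<kappa>' =
      (\<Sum>m<3. if m = ?m then if \<kappa>' = upd i ?m \<kappa> then ?c m else 0 else 0)"
    unfolding site_fun_def lookup_sum
    by (intro sum.cong) (auto simp: lookup_single when_def eq)
  also have "\<dots> = (if \<kappa>' = upd i ?m \<kappa> then ?c ?m else 0)"
    using site_mat_range[of l ?m "Poly_Mapping.lookup \<kappa> i"] by (auto simp: sum.delta)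
  finally show ?thesis .
qed

text \<open>The string is real and does not see site \<open>i\<close>, so the adjoint only
  conjugates and transposes the matrix at site \<open>i\<close>.\<close>

lemma site_fun_adj:
  "Poly_Mapping.lookup (site_fun (star_letter l) i \<kappa>') \<kappa> = cnj (Poly_Mapping.lookup (site_fun l i \<kappa>) \<kappa>')"
proof -
  have "\<kappa>' = upd i (Poly_Mapping.lookup \<kappa>' i) \<kappa> \<longleftrightarrow> \<kappa> = upd i (Poly_Mapping.lookup \<kappa> i) \<kappa>'"
  proof -
    have "\<mu> = upd i (Poly_Mapping.lookup \<mu> i) \<nu>" if "\<nu> = upd i (Poly_Mapping.lookup \<nu> i) \<mu>"
      for \<mu> \<nu> :: config
      by (subst that, intro poly_mapping_eqI) (simp add: lookup_update)
    then show ?thesis by blast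
  qed
  moreover have "tail i \<kappa>' = tail i \<kappa>" if "\<kappa>' = upd i (Poly_Mapping.lookup \<kappa>' i) \<kappa>"
    by (subst that) (simp add: tail_upd_le)
  ultimately show ?thesis
    by (auto simp: lookup_site_fun site_mat_star)
qed

lemma app_site_basis: "app (site i l) (basis \<kappa>) = site_fun l i \<kappa>"
  unfolding site_def by (subst app_mk_op) (simp_all add: site_fun_adj)

lemma adj_site [simp]: "adj (site i l) = site i (star_letter l)"
  unfolding site_def by (subst adj_mk_op) (simp_all add: site_fun_adj)

lemma app_site: "app (site i l) (Poly_Mapping.single \<kappa> c) =
   (\<Sum>m<3. Poly_Mapping.single (upd i m \<kappa>)
     (c * complex_of_real (tail i \<kappa>) * site_mat l m (Poly_Mapping.lookup \<kappa> i)))"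
  by (subst app_single)
     (simp add: app_site_basis site_fun_def cscale_sum mult.assoc)

text \<open>If \<open>l\<close> acts first at the later site \<open>k\<close>, it multiplies the
  string of \<open>i\<close> by \<open>q\<close> to the power \<open>- charge [l]\<close>, by
  \<open>wt_site_mat\<close>, whereas the string of \<open>k\<close> does not see site
  \<open>i\<close>.\<close>

lemma site_commute:
  assumes "i < k"
  shows "site k l * site i l' = qpow q (charge [l]) *\<^sub>C (site i l' * site k l)"
proof (rule app_inject)
  fix \<kappa> :: config
  let ?a = "Poly_Mapping.lookup \<kappa> i" and ?b = "Poly_Mapping.lookup \<kappa> k"
  have ik: "i \<noteq> k" using assms by simp
  have "app (site k l * site i l') (basis \<kappa>) = (\<Sum>m<3. \<Sum>p<3. Poly_Mapping.single (upd k p (upd i m \<kappa>))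
      (complex_of_real (tail i \<kappa>) * site_mat l' m ?a * complex_of_real (tail k \<kappa>) * site_mat l p ?b))"
    using assms by (simp add: app_site app_sum_right lookup_update tail_upd_le)
  also have "\<dots> = (\<Sum>m<3. \<Sum>p<3. cscale (qpow q (charge [l])) (Poly_Mapping.single (upd i m (upd k p \<kappa>))
      (complex_of_real (tail k \<kappa>) * site_mat l p ?b * complex_of_real (tail i (upd k p \<kappa>)) * site_mat l' m ?a)))"
  proof (intro sum.cong refl)
    fix m p :: nat
    show "Poly_Mapping.single (upd k p (upd i m \<kappa>))
      (complex_of_real (tail i \<kappa>) * site_mat l' m ?a * complex_of_real (tail k \<kappa>) * site_mat l p ?b) =
      cscale (qpow q (charge [l])) (Poly_Mapping.single (upd i m (upd k p \<kappa>))
      (complex_of_real (tail k \<kappa>) * site_mat l p ?b * complex_of_real (tail i (upd k p \<kappa>)) * site_mat l' m ?a))"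
    proof (cases "site_mat l p ?b = 0")
      case False
      have "wt p * (q powi charge [l] * tail i (upd k p \<kappa>)) = wt p * tail i \<kappa>"
        using tail_upd_gr[OF assms, of \<kappa> p] wt_site_mat[OF False] by (simp add: ac_simps)
      then have "tail i \<kappa> = q powi charge [l] * tail i (upd k p \<kappa>)"
        using wt_nz[of p] by simp
      then show ?thesis
        by (simp add: upd_commute[OF ik] ac_simps)
    qed simp
  qed
  also have "\<dots> = app (qpow q (charge [l]) *\<^sub>C (site i l' * site k l)) (basis \<kappa>)"
    using ik by (subst sum.swap) (simp add: app_site app_sum_right lookup_update cscale_sum)
  finally show "app (site k l * site i l') (basis \<kappa>) =
    app (qpow q (charge [l]) *\<^sub>C (site i l' * site k l)) (basis \<kappa>)" .
qed

end

text \<open>Configurations form a monoid too, but \<open>basis 0\<close> is the vacuum vector and not a unit.\<close>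

declare single_one [simp del]

section \<open>Locality of operators and factorisation of the vacuum state\<close>

definition preserves :: "config set \<Rightarrow> config adj_op \<Rightarrow> bool" where
  "preserves C a \<longleftrightarrow> (\<forall>u. Poly_Mapping.keys u \<subseteq> C \<longrightarrow> Poly_Mapping.keys (app a u) \<subseteq> C)"

definition on_sites :: "nat set \<Rightarrow> config set" where
  "on_sites J = {\<kappa>. Poly_Mapping.keys \<kappa> \<subseteq> J}"

lemma preserves_one: "preserves C 1"
  by (simp add: preserves_def)

lemma preserves_times: "preserves C a \<Longrightarrow> preserves C b \<Longrightarrow> preserves C (a * b)"
  by (simp add: preserves_def)

lemma keys_cscale: "Poly_Mapping.keys (cscale c u) \<subseteq> Poly_Mapping.keys u"
  by (auto simp: in_keys_iff)

lemma keys_sum_subset: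
  assumes "\<And>i. i \<in> I \<Longrightarrow> Poly_Mapping.keys (f i) \<subseteq> S"
  shows "Poly_Mapping.keys (\<Sum>i\<in>I. f i) \<subseteq> S"
  using assms
proof (induction I rule: infinite_finite_induct)
  case (insert i I)
  then show ?case
    using Poly_Mapping.keys_add[of "f i" "sum f I"] by (simp add: order_trans[OF _ Un_least])
qed simp_all

lemma preserves_cmult: "preserves C a \<Longrightarrow> preserves C (c *\<^sub>C a)"
  unfolding preserves_def app_simps by (meson keys_cscale order_trans)

lemma preserves_add: "preserves C a \<Longrightarrow> preserves C b \<Longrightarrow> preserves C (a + b)"
  unfolding preserves_def app_simps by (meson Poly_Mapping.keys_add Un_least order_trans)

lemma preserves_sum: "(\<And>i. i \<in> S \<Longrightarrow> preserves C (f i)) \<Longrightarrow> preserves C (sum f S)"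
  by (induction S rule: infinite_finite_induct) (auto intro: preserves_add simp: preserves_def[of _ 0])

lemma preserves_prod_list: "(\<And>a. a \<in> set as \<Longrightarrow> preserves C a) \<Longrightarrow> preserves C (prod_list as)"
  by (induction as) (simp_all add: preserves_one preserves_times)

text \<open>The vectors that \<open>adj a\<close> and \<open>b\<close> create from the vacuum live
  on disjoint sets of sites, so the vacuum is the only configuration they can share.\<close>

lemma vec_state_split:
  assumes "preserves (on_sites I) (adj a)" "preserves (on_sites J) b" "I \<inter> J = {}"
  shows "vec_state 0 (a * b) = vec_state 0 a * vec_state 0 b"
proof -
  have "Poly_Mapping.keys (app (adj a) (basis 0)) \<subseteq> on_sites I"
    using assms(1) by (simp add: preserves_def on_sites_def)
  moreover have "Poly_Mapping.keys (app b (basis 0)) \<subseteq> on_sites J"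
    using assms(2) by (simp add: preserves_def on_sites_def)
  moreover have "on_sites I \<inter> on_sites J = {0}"
    using assms(3) by (auto simp: on_sites_def) (metis Int_greatest keys_eq_empty subset_empty)
  ultimately have "vec_state 0 (a * b) = cnj (vec_state 0 (adj a)) * vec_state 0 b"
    unfolding vec_state_times by (subst ip_disjoint[where k = 0]) (auto simp: vec_state_def)
  then show ?thesis
    by (simp add: vec_state_adj)
qed

lemma single_sum: "Poly_Mapping.single k (sum f S) = (\<Sum>i\<in>S. Poly_Mapping.single k (f i))"
  by (induction S rule: infinite_finite_induct) (simp_all add: single_add)

context braided_sites
begin

lemma keys_site_fun:
  "Poly_Mapping.keys (site_fun l i \<kappa>) \<subseteq>
     {upd i m \<kappa> | m. site_mat l m (Poly_Mapping.lookup \<kappa> i) \<noteq> 0}"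
  by (auto simp: in_keys_iff lookup_site_fun split: if_splits)

text \<open>The string is diagonal: a site operator reads the levels of all later sites but changes
  only its own.\<close>

lemma preserves_site: "i \<in> J \<Longrightarrow> preserves (on_sites J) (site i l)"
  unfolding preserves_def
proof (intro allI impI, rule keys_app)
  fix u \<kappa> assume i: "i \<in> J" and "Poly_Mapping.keys u \<subseteq> on_sites J" "\<kappa> \<in> Poly_Mapping.keys u"
  then have "Poly_Mapping.keys (upd i m \<kappa>) \<subseteq> J" for m
    using keys_upd[of i m \<kappa>] by (force simp: on_sites_def)
  then show "Poly_Mapping.keys (app (site i l) (basis \<kappa>)) \<subseteq> on_sites J"
    by (auto simp: app_site_basis on_sites_def dest!: subsetD[OF keys_site_fun])
qed

text \<open>The total weight of a configuration. Site 0 is separate because \<open>tail 0\<close>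
  starts at site 1.\<close>

definition gauge :: "config \<Rightarrow> real" where
  "gauge \<kappa> = wt (Poly_Mapping.lookup \<kappa> 0) * tail 0 \<kappa>"

lemma gauge_upd:
  "wt (Poly_Mapping.lookup \<kappa> i) * gauge (upd i m \<kappa>) = wt m * gauge \<kappa>"
proof (cases "i = 0")
  case True
  then show ?thesis by (simp add: gauge_def lookup_update tail_upd_le)
next
  case False
  then show ?thesis
    using tail_upd_gr[of 0 i \<kappa> m] by (simp add: gauge_def lookup_update)
qed

lemma gauge_zero: "gauge 0 = 1"
  by (simp add: gauge_def tail_def)

lemma keys_gauge_site:
  assumes "Poly_Mapping.keys u \<subseteq> {\<kappa>. c * gauge \<kappa> = 1}"
  shows "Poly_Mapping.keys (app (site i l) u) \<subseteq> {\<kappa>. q powi charge [l] * c * gauge \<kappa> = 1}"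
proof (rule keys_app)
  fix \<kappa> assume "\<kappa> \<in> Poly_Mapping.keys u"
  then have \<kappa>: "c * gauge \<kappa> = 1" using assms by auto
  have "q powi charge [l] * c * gauge (upd i m \<kappa>) = 1" if "site_mat l m (Poly_Mapping.lookup \<kappa> i) \<noteq> 0" for m
  proof -
    have "wt m * (q powi charge [l] * gauge (upd i m \<kappa>)) = wt m * gauge \<kappa>"
      using gauge_upd[of \<kappa> i m] wt_site_mat[OF that] by (simp add: ac_simps)
    then have "q powi charge [l] * gauge (upd i m \<kappa>) = gauge \<kappa>"
      using wt_nz by simp
    with \<kappa> show ?thesis by (metis mult.assoc mult.commute)
  qed
  then show "Poly_Mapping.keys (app (site i l) (basis \<kappa>)) \<subseteq> {\<kappa>. q powi charge [l] * c * gauge \<kappa> = 1}"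
    using keys_site_fun[of l i \<kappa>] by (auto simp: app_site_basis)
qed

lemma keys_gauge_word:
  assumes Y: "\<And>l. \<exists>c I. Y l = c *\<^sub>C (\<Sum>i\<in>I. site i l)"
  shows "Poly_Mapping.keys (app (word_eval Y ls) (basis 0)) \<subseteq> {\<kappa>. q powi charge ls * gauge \<kappa> = 1}"
proof (induction ls)
  case Nil
  show ?case by (simp add: gauge_zero)
next
  case (Cons l ls)
  obtain c I where Yl: "Y l = c *\<^sub>C (\<Sum>i\<in>I. site i l)" using Y by blast
  let ?u = "app (word_eval Y ls) (basis 0)"
  let ?S = "{\<kappa>. q powi charge (l # ls) * gauge \<kappa> = 1}"
  have "Poly_Mapping.keys (app (site i l) ?u) \<subseteq> ?S" for i
    using keys_gauge_site[OF Cons] q_nz by (simp add: charge_Cons[of l ls] power_int_add)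
  then have "Poly_Mapping.keys (\<Sum>i\<in>I. app (site i l) ?u) \<subseteq> ?S"
    by (rule keys_sum_subset)
  then have "Poly_Mapping.keys (cscale c (\<Sum>i\<in>I. app (site i l) ?u)) \<subseteq> ?S"
    by (meson keys_cscale order_trans)
  then show ?case
    by (simp add: Yl app_sum)
qed

text \<open>Each letter multiplies the total weight by \<open>q\<close> to minus its charge, and a
  word with nonzero vacuum expectation has to return to the weight 1 of the vacuum.\<close>

lemma vec_state_charge:
  assumes "\<And>l. \<exists>c I. Y l = c *\<^sub>C (\<Sum>i\<in>I. site i l)" "vec_state 0 (word_eval Y ls) \<noteq> 0"
  shows "q powi charge ls = 1"
  using keys_gauge_word[of Y ls] assms gauge_zero by (auto simp: vec_state_def in_keys_iff)

text \<open>A site that occurs only once is excited by the word and never returns to the vacuum.\<close>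

lemma vec_state_single_site:
  assumes "\<And>z. z \<in> set zs \<union> set zs' \<Longrightarrow> fst z \<noteq> i"
  shows "vec_state 0 (prod_list (map (case_prod site) zs) * site i l * prod_list (map (case_prod site) zs')) = 0"
proof -
  \<comment> \<open>The factor at site \<open>i\<close> can be pulled to the far left at the price
    of a scalar, whose value is irrelevant here.\<close>
  have move: "\<exists>c. prod_list (map (case_prod site) zs) * site i l =
      c *\<^sub>C (site i l * prod_list (map (case_prod site) zs))"
    if "\<And>z. z \<in> set zs \<Longrightarrow> fst z \<noteq> i" for zs
    using that
  proof (induction zs)
    case Nil
    show ?case by (intro exI[of _ 1]) simp
  next
    case (Cons z zs)
    obtain k l' where z: "z = (k, l')" by (cases z)
    obtain c where c: "prod_list (map (case_prod site) zs) * site i l =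
        c *\<^sub>C (site i l * prod_list (map (case_prod site) zs))"
      using Cons by auto
    have "\<exists>d. site k l' * site i l = d *\<^sub>C (site i l * site k l')"
    proof (cases "i < k")
      case False
      then have "k < i" using Cons.prems[of z] z by force
      then have "inverse (qpow q (charge [l])) *\<^sub>C (site i l * site k l') = site k l' * site i l"
        using q_nz by (simp add: site_commute)
      then show ?thesis by metis
    qed (metis site_commute)
    then obtain d where d: "site k l' * site i l = d *\<^sub>C (site i l * site k l')" by blast
    have "prod_list (map (case_prod site) (z # zs)) * site i l =
        c *\<^sub>C ((site k l' * site i l) * prod_list (map (case_prod site) zs))"
      by (simp add: z c mult.assoc)
    also have "\<dots> = (c * d) *\<^sub>C (site i l * prod_list (map (case_prod site) (z # zs)))"
      by (simp add: d z mult.assoc)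
    finally show ?case by blast
  qed
  obtain c where c: "prod_list (map (case_prod site) zs) * site i l =
      c *\<^sub>C (site i l * prod_list (map (case_prod site) zs))"
    using move[of zs] assms by auto
  let ?b = "prod_list (map (case_prod site) (zs @ zs'))"
  \<comment> \<open>The other factors leave site \<open>i\<close> in level 0, while the adjoint of
    \<open>site i l\<close> takes it out of level 0.\<close>
  have "preserves (on_sites (- {i})) ?b"
    using assms by (intro preserves_prod_list) (force intro!: preserves_site)
  then have 1: "Poly_Mapping.keys (app ?b (basis 0)) \<subseteq> on_sites (- {i})"
    by (simp add: preserves_def on_sites_def)
  have 2: "upd i m 0 \<notin> on_sites (- {i})" if "site_mat l' m 0 \<noteq> 0" for m l'
  proof -
    have "m \<noteq> 0" using that site_mat_vacuum by metis
    then show ?thesis by (auto simp: on_sites_def keys_update)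
  qed
  have "Poly_Mapping.keys (app (adj (site i l)) (basis 0)) \<inter> Poly_Mapping.keys (app ?b (basis 0)) = {}"
  proof (rule equals0I)
    fix \<kappa>
    assume \<kappa>: "\<kappa> \<in> Poly_Mapping.keys (app (adj (site i l)) (basis 0)) \<inter> Poly_Mapping.keys (app ?b (basis 0))"
    then obtain m where "\<kappa> = upd i m 0" "site_mat (star_letter l) m 0 \<noteq> 0"
      using keys_site_fun[of "star_letter l" i 0] by (auto simp: app_site_basis)
    then show False using 1 2[of "star_letter l" m] \<kappa> by blast
  qed
  then have "vec_state 0 (site i l * ?b) = 0"
    unfolding vec_state_times
    by (subst ip_disjoint[where k = 0]) (auto simp: in_keys_iff)
  then show ?thesis
    by (simp add: c mult.assoc)
qed

section \<open>Bounds for words of site operators that do not depend on the sites\<close>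

definition site_bound :: real where
  "site_bound = \<bar>\<alpha>\<bar> + \<bar>\<beta>\<bar> + cmod \<eta>"

definition wt_bound :: real where
  "wt_bound = 1 + \<bar>q\<bar> + inverse \<bar>q\<bar>"

lemma norm_site_mat: "cmod (site_mat l m p) \<le> site_bound"
  by (cases l) (auto simp: x_mat_def site_bound_def)

lemma wt_bound_ge_1: "1 \<le> wt_bound"
  by (simp add: wt_bound_def)

text \<open>Only occupied sites have a weight other than 1, so their number controls the string,
  wherever they lie.\<close>

lemma abs_tail: "\<bar>tail i \<kappa>\<bar> \<le> wt_bound ^ card (Poly_Mapping.keys \<kappa>)"
proof -
  have "\<bar>wt p\<bar> \<le> wt_bound" for p
    by (simp add: wt_def wt_bound_def abs_inverse)
  then have "\<bar>tail i \<kappa>\<bar> \<le> (\<Prod>j\<in>{j\<in>Poly_Mapping.keys \<kappa>. i < j}. wt_bound)"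
    unfolding tail_def abs_prod by (intro prod_mono) simp
  also have "\<dots> = wt_bound ^ card {j\<in>Poly_Mapping.keys \<kappa>. i < j}" by simp
  also have "\<dots> \<le> wt_bound ^ card (Poly_Mapping.keys \<kappa>)"
    by (intro power_increasing card_mono wt_bound_ge_1) auto
  finally show ?thesis .
qed

lemma norm1_site:
  assumes "card (Poly_Mapping.keys \<kappa>) \<le> r"
  shows "norm1 (app (site i l) (basis \<kappa>)) \<le> 3 * wt_bound ^ r * site_bound"
proof -
  have "norm1 (app (site i l) (basis \<kappa>)) \<le> (\<Sum>m<3::nat. wt_bound ^ r * site_bound)"
    unfolding app_site_basis site_fun_def
  proof (rule order_trans[OF norm1_sum], intro sum_mono)
    fix m
    have "\<bar>tail i \<kappa>\<bar> \<le> wt_bound ^ r"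
      using abs_tail assms wt_bound_ge_1 by (meson order_trans power_increasing)
    then show "norm1 (Poly_Mapping.single (upd i m \<kappa>)
        (complex_of_real (tail i \<kappa>) * site_mat l m (Poly_Mapping.lookup \<kappa> i))) \<le> wt_bound ^ r * site_bound"
      using norm_site_mat wt_bound_ge_1 by (auto simp: norm_mult intro!: mult_mono)
  qed
  then show ?thesis by simp
qed

text \<open>When the letter with \<open>k\<close> letters to its right acts, at most
  \<open>k\<close> sites are occupied; the factor 3 counts the levels.\<close>

primrec word_bound :: "nat \<Rightarrow> real" where
  "word_bound 0 = 1"
| "word_bound (Suc k) = 3 * wt_bound ^ k * site_bound * word_bound k"

lemma norm1_site_word:
  "Poly_Mapping.keys (app (prod_list (map (case_prod site) zs)) (basis 0)) \<subseteq>
     {\<kappa>. card (Poly_Mapping.keys \<kappa>) \<le> length zs} \<and>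
   norm1 (app (prod_list (map (case_prod site) zs)) (basis 0)) \<le> word_bound (length zs)"
proof (induction zs)
  case (Cons z zs)
  obtain i l where z: "z = (i, l)" by (cases z)
  let ?u = "app (prod_list (map (case_prod site) zs)) (basis 0)"
  have card_upd: "card (Poly_Mapping.keys (upd i m \<kappa>)) \<le> Suc (card (Poly_Mapping.keys \<kappa>))" for m \<kappa>
    by (rule order_trans[OF card_mono[OF _ keys_upd]]) (simp_all add: card_insert_if)
  have "Poly_Mapping.keys (app (site i l) ?u) \<subseteq> {\<kappa>. card (Poly_Mapping.keys \<kappa>) \<le> Suc (length zs)}"
  proof (rule keys_app, rule subsetI)
    fix \<kappa> \<kappa>'
    assume "\<kappa> \<in> Poly_Mapping.keys ?u" "\<kappa>' \<in> Poly_Mapping.keys (app (site i l) (basis \<kappa>))"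
    then obtain m where "\<kappa>' = upd i m \<kappa>" "card (Poly_Mapping.keys \<kappa>) \<le> length zs"
      using Cons keys_site_fun[of l i \<kappa>] by (auto simp: app_site_basis)
    then show "\<kappa>' \<in> {\<kappa>. card (Poly_Mapping.keys \<kappa>) \<le> Suc (length zs)}"
      using card_upd[of m \<kappa>] by simp
  qed
  moreover have "norm1 (app (site i l) ?u) \<le> 3 * wt_bound ^ length zs * site_bound * norm1 ?u"
    using Cons by (intro norm1_app norm1_site) auto
  moreover have "\<dots> \<le> 3 * wt_bound ^ length zs * site_bound * word_bound (length zs)"
    using Cons wt_bound_ge_1 by (intro mult_left_mono) (simp_all add: site_bound_def)
  ultimately show ?case by (simp add: z)
qed simp

lemma norm_vec_state_site_word:
  "cmod (vec_state 0 (prod_list (map (case_prod site) zs))) \<le> word_bound (length zs)"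
  unfolding vec_state_def
  by (rule order_trans[OF norm_lookup_le_norm1 conjunct2[OF norm1_site_word]])

text \<open>Amplitudes of the vector that the word creates from the vacuum of one isolated site;
  entry 0 is the vacuum moment.\<close>

primrec site_vec :: "letter list \<Rightarrow> nat \<Rightarrow> complex" where
  "site_vec [] m = (if m = 0 then 1 else 0)"
| "site_vec (l # ls) m = (\<Sum>p<3. site_mat l m p * site_vec ls p)"

lemma app_one_site_word:
  "app (word_eval (site i) ls) (basis 0) = (\<Sum>m<3. Poly_Mapping.single (upd i m 0) (site_vec ls m))"
proof (induction ls)
  case Nil
  show ?case by (simp add: numeral_3_eq_3)
next
  case (Cons l ls)
  \<comment> \<open>All later sites are in the vacuum, so the string acts as 1.\<close>
  have t: "tail i (upd i p 0) = 1" for p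
    using tail_upd_le[of i i p 0] by (simp add: tail_def)
  have "app (word_eval (site i) (l # ls)) (basis 0) =
      (\<Sum>p<3. \<Sum>m<3. Poly_Mapping.single (upd i m 0) (site_mat l m p * site_vec ls p))"
    by (simp add: Cons app_sum_right app_site t lookup_update mult.commute)
  then show ?case
    by (subst (asm) sum.swap) (simp add: single_sum)
qed

lemma vec_state_one_site: "vec_state 0 (word_eval (site i) ls) = site_vec ls 0"
  by (simp add: vec_state_def app_one_site_word lookup_sum lookup_single when_def sum.delta)

lemma site_vec_single: "site_vec [l] 0 = 0"
  using site_mat_vacuum by (simp add: numeral_3_eq_3)

text \<open>These are the inner products of v|0> = \<alpha>|1> and x|0> = \<eta>|1> + \<beta>|2>,
  the Cholesky form of the prescribed matrix.\<close>

lemma site_vec_pair: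
  "site_vec [Lx, Lv] 0 = of_real (\<alpha>\<^sup>2)" "site_vec [Lv, Lx] 0 = of_real ((cmod \<eta>)\<^sup>2 + \<beta>\<^sup>2)"
  "site_vec [Lx, Lx] 0 = of_real \<alpha> * \<eta>" "site_vec [Lv, Lv] 0 = of_real \<alpha> * cnj \<eta>"
  by (simp_all add: x_mat_def numeral_3_eq_3 power2_eq_square)
     (metis complex_norm_square mult.commute of_real_mult power2_eq_square)

end

section \<open>Factorisation over braid-commuting families\<close>

text \<open>Abstract form of independence: \<open>split_first\<close> treats products whose earliest
  factor stands first, \<open>commute\<close> sorts any other order at the cost of powers of
  \<open>q\<close>, and \<open>charged\<close> controls these powers.\<close>

context
  fixes q :: real and n :: nat and Y :: "nat \<Rightarrow> letter \<Rightarrow> 'a::complex_star_algebra"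
    and \<omega> :: "'a \<Rightarrow> complex"
  assumes q_nz: "q \<noteq> 0"
    and \<omega>_one: "\<omega> 1 = 1" and \<omega>_cmult: "\<And>c a. \<omega> (c *\<^sub>C a) = c * \<omega> a"
    and \<omega>_add: "\<And>a b. \<omega> (a + b) = \<omega> a + \<omega> b"
    and commute: "\<And>i k. i < k \<Longrightarrow> k < n \<Longrightarrow> braid_commute q (Y i) (Y k)"
    and split_first: "\<And>i ls zs. i < n \<Longrightarrow> (\<And>z. z \<in> set zs \<Longrightarrow> i < fst z \<and> fst z < n) \<Longrightarrow>
      \<omega> (word_eval (Y i) ls * prod_list (map (\<lambda>(k, ms). word_eval (Y k) ms) zs)) =
      \<omega> (word_eval (Y i) ls) * \<omega> (prod_list (map (\<lambda>(k, ms). word_eval (Y k) ms) zs))"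
    and charged: "\<And>i ls. i < n \<Longrightarrow> \<omega> (word_eval (Y i) ls) \<noteq> 0 \<Longrightarrow> q powi charge ls = 1"
begin

text \<open>The scalar is a product of powers of \<open>q\<close> whose exponents are multiples of
  the charges of the words passed, hence the condition under which it is 1.\<close>

lemma move_to_front:
  assumes "\<And>z. z \<in> set zs \<Longrightarrow> i < fst z \<and> fst z < n"
  shows "\<exists>s. prod_list (map (\<lambda>(k, ms). word_eval (Y k) ms) zs) * word_eval (Y i) ls =
      s *\<^sub>C (word_eval (Y i) ls * prod_list (map (\<lambda>(k, ms). word_eval (Y k) ms) zs)) \<and>
    ((\<forall>z\<in>set zs. q powi charge (snd z) = 1) \<longrightarrow> s = 1)"
  using assms
proof (induction zs)
  case Nil
  show ?case by (intro exI[of _ 1]) simp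
next
  case (Cons z zs)
  obtain k ms where z: "z = (k, ms)" by (cases z)
  obtain s where s: "prod_list (map (\<lambda>(k, ms). word_eval (Y k) ms) zs) * word_eval (Y i) ls =
      s *\<^sub>C (word_eval (Y i) ls * prod_list (map (\<lambda>(k, ms). word_eval (Y k) ms) zs))"
    "(\<forall>z\<in>set zs. q powi charge (snd z) = 1) \<longrightarrow> s = 1"
    using Cons by auto
  let ?t = "qpow q (charge ms * int (length ls))"
  have ik: "i < k" "k < n" using Cons.prems[of z] z by auto
  have "prod_list (map (\<lambda>(k, ms). word_eval (Y k) ms) (z # zs)) * word_eval (Y i) ls =
      s *\<^sub>C ((word_eval (Y k) ms * word_eval (Y i) ls) * prod_list (map (\<lambda>(k, ms). word_eval (Y k) ms) zs))"
    by (simp add: z s(1) mult.assoc)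
  also have "\<dots> = (s * ?t) *\<^sub>C (word_eval (Y i) ls * prod_list (map (\<lambda>(k, ms). word_eval (Y k) ms) (z # zs)))"
    by (simp add: z braid_commute_word_word[OF commute[OF ik] q_nz] mult.assoc)
  finally have "prod_list (map (\<lambda>(k, ms). word_eval (Y k) ms) (z # zs)) * word_eval (Y i) ls =
     (s * ?t) *\<^sub>C (word_eval (Y i) ls * prod_list (map (\<lambda>(k, ms). word_eval (Y k) ms) (z # zs)))" .
  moreover have "(\<forall>z\<in>set (z # zs). q powi charge (snd z) = 1) \<longrightarrow> s * ?t = 1"
    using s(2) by (auto simp: z power_int_mult simp flip: of_real_power_int)
  ultimately show ?case by blast
qed

text \<open>Induction on the number of words: the one with the smallest index is brought to the
  front and split off. Either the scalar so created is 1, or a word that was passed has mean 0 and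
  both sides vanish.\<close>

lemma factor_words:
  assumes "distinct (map fst zs)" "\<And>z. z \<in> set zs \<Longrightarrow> fst z < n"
  shows "\<omega> (prod_list (map (\<lambda>(k, ms). word_eval (Y k) ms) zs)) =
    prod_list (map (\<lambda>(k, ms). \<omega> (word_eval (Y k) ms)) zs)"
  using assms
proof (induction "length zs" arbitrary: zs)
  case 0
  then show ?case by (simp add: \<omega>_one)
next
  case (Suc r)
  let ?W = "\<lambda>(k, ms). word_eval (Y k) ms" and ?w = "\<lambda>(k, ms). \<omega> (word_eval (Y k) ms)"
  define i where "i = Min (fst ` set zs)"
  have "fst ` set zs \<noteq> {}" using Suc.hyps(2) by auto
  then have "i \<in> fst ` set zs" unfolding i_def by (intro Min_in) auto
  then obtain ls ps qs where zs: "zs = ps @ (i, ls) # qs"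
    by (auto dest: split_list)
  have later: "i < fst z \<and> fst z < n" if "z \<in> set (ps @ qs)" for z
  proof -
    have "fst z \<noteq> i" using Suc.prems(1) that unfolding zs by (auto simp: rev_image_eqI)
    moreover have "i \<le> fst z" unfolding i_def using that zs by (intro Min_le) auto
    ultimately show ?thesis using Suc.prems(2)[of z] that zs by auto
  qed
  have i: "i < n" using Suc.prems(2)[of "(i, ls)"] zs by simp
  obtain s where s: "prod_list (map ?W ps) * word_eval (Y i) ls = s *\<^sub>C (word_eval (Y i) ls * prod_list (map ?W ps))"
    "(\<forall>z\<in>set ps. q powi charge (snd z) = 1) \<longrightarrow> s = 1"
    using move_to_front[of ps i ls] later by auto
  have "prod_list (map ?W zs) = s *\<^sub>C (word_eval (Y i) ls * prod_list (map ?W (ps @ qs)))"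
    by (simp add: zs s(1) flip: mult.assoc)
  then have "\<omega> (prod_list (map ?W zs)) = s * (\<omega> (word_eval (Y i) ls) * \<omega> (prod_list (map ?W (ps @ qs))))"
    using split_first[OF i, of "ps @ qs"] later by (simp add: \<omega>_cmult)
  also have "\<omega> (prod_list (map ?W (ps @ qs))) = prod_list (map ?w (ps @ qs))"
    using Suc.prems Suc.hyps(2) by (intro Suc.hyps(1)) (auto simp: zs)
  finally have eq: "\<omega> (prod_list (map ?W zs)) = s * (\<omega> (word_eval (Y i) ls) * prod_list (map ?w (ps @ qs)))" .
  show ?case
  proof (cases "\<forall>z\<in>set ps. ?w z \<noteq> 0")
    case True
    then have "s = 1"
      using s(2) charged later by (fastforce simp: case_prod_unfold)
    then show ?thesis unfolding eq by (simp add: zs ac_simps)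
  next
    case False
    then have "prod_list (map ?w ps) = 0"
      by (auto simp: prod_list_zero_iff image_iff)
    then show ?thesis unfolding eq by (simp add: zs)
  qed
qed

text \<open>The polynomials are expanded into words one at a time from the left: \<open>zs\<close>
  holds those already expanded, \<open>ys\<close> those still to come.\<close>

lemma factor_evals_aux:
  assumes "distinct (map fst zs @ map fst ys)" "\<And>i. i \<in> fst ` set zs \<union> fst ` set ys \<Longrightarrow> i < n"
  shows "\<omega> (prod_list (map (\<lambda>(k, ms). word_eval (Y k) ms) zs) * prod_list (map (\<lambda>(k, p). eval (Y k) p) ys)) =
    prod_list (map (\<lambda>(k, ms). \<omega> (word_eval (Y k) ms)) zs) * prod_list (map (\<lambda>(k, p). \<omega> (eval (Y k) p)) ys)"
  using assms
proof (induction ys arbitrary: zs)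
  case Nil
  then show ?case using factor_words[of zs] by simp
next
  case (Cons y ys)
  obtain k p where y: "y = (k, p)" by (cases y)
  have "\<omega> (prod_list (map (\<lambda>(k, ms). word_eval (Y k) ms) zs) *
        (eval (Y k) p * prod_list (map (\<lambda>(k, p). eval (Y k) p) ys))) =
      prod_list (map (\<lambda>(k, ms). \<omega> (word_eval (Y k) ms)) zs) *
        (\<omega> (eval (Y k) p) * prod_list (map (\<lambda>(k, p). \<omega> (eval (Y k) p)) ys))"
  proof (induction p rule: free_induct)
    case (single w c)
    have "distinct (map fst (zs @ [(k, letters w)]) @ map fst ys)"
      using Cons.prems(1) y by auto
    moreover have "\<And>i. i \<in> fst ` set (zs @ [(k, letters w)]) \<union> fst ` set ys \<Longrightarrow> i < n"
      using Cons.prems(2) y by auto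
    ultimately show ?case
      using Cons.IH[of "zs @ [(k, letters w)]"]
      by (simp add: eval_single \<omega>_cmult mult.assoc)
  next
    case (add p r)
    then show ?case by (simp add: eval_add \<omega>_add algebra_simps)
  qed
  then show ?case by (simp add: y)
qed

lemma factor_evals:
  assumes "distinct (map fst ys)" "\<And>i. i \<in> fst ` set ys \<Longrightarrow> i < n"
  shows "\<omega> (prod_list (map (\<lambda>(k, p). eval (Y k) p) ys)) = prod_list (map (\<lambda>(k, p). \<omega> (eval (Y k) p)) ys)"
  using factor_evals_aux[of "[]" ys] assms by simp

end


section \<open>Increments\<close>

context braided_sites
begin

definition block :: "nat set \<Rightarrow> letter \<Rightarrow> config adj_op" where
  "block I l = (\<Sum>i\<in>I. site i l)"

definition incr :: "real \<Rightarrow> (letter \<Rightarrow> complex) \<Rightarrow> nat set \<Rightarrow> letter \<Rightarrow> config adj_op" where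
  "incr r c I l = complex_of_real r *\<^sub>C block I l + c l *\<^sub>C 1"

lemma adj_block [simp]: "adj (block I l) = block I (star_letter l)"
  by (simp add: block_def adj_sum)

lemma block_commute:
  assumes "\<And>i k. i \<in> I \<Longrightarrow> k \<in> J \<Longrightarrow> i < k"
  shows "block J l * block I l' = qpow q (charge [l]) *\<^sub>C (block I l' * block J l)"
proof -
  have "block J l * block I l' = (\<Sum>k\<in>J. \<Sum>i\<in>I. site k l * site i l')"
    by (simp add: block_def sum_product)
  also have "\<dots> = (\<Sum>k\<in>J. \<Sum>i\<in>I. qpow q (charge [l]) *\<^sub>C (site i l' * site k l))"
    using assms by (intro sum.cong refl site_commute) auto
  also have "\<dots> = qpow q (charge [l]) *\<^sub>C (block I l' * block J l)"
    by (subst sum.swap) (simp add: block_def sum_product cmult_sum_right)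
  finally show ?thesis .
qed

text \<open>Scalars commute without a factor, so a drift fits the braid relation only for
  \<open>q = 1\<close>.\<close>

lemma braid_commute_incr:
  assumes "\<And>i k. i \<in> I \<Longrightarrow> k \<in> J \<Longrightarrow> i < k"
    and "q = 1 \<or> (\<forall>l. c l = 0 \<and> d l = 0)"
  shows "braid_commute q (incr r c I) (incr r d J)"
  using assms(2) unfolding braid_commute_def
  by (auto simp: incr_def block_commute[OF assms(1)] algebra_simps cmult_add_right)

lemma preserves_block: "I \<subseteq> J \<Longrightarrow> preserves (on_sites J) (block I l)"
  unfolding block_def by (intro preserves_sum preserves_site) auto

lemma preserves_incr: "I \<subseteq> J \<Longrightarrow> preserves (on_sites J) (incr r c I l)"
  unfolding incr_def by (intro preserves_add preserves_cmult preserves_block preserves_one)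

lemma preserves_adj_incr: "I \<subseteq> J \<Longrightarrow> preserves (on_sites J) (adj (incr r c I l))"
  unfolding incr_def adj_add adj_cmult adj_block adj_one
  by (intro preserves_add preserves_cmult preserves_block preserves_one)

lemma factor_incr:
  fixes n :: nat
  assumes "\<And>i k. i < k \<Longrightarrow> k < n \<Longrightarrow> (\<forall>a\<in>Iv i. \<forall>b\<in>Iv k. a < b)"
    and "q = 1 \<or> (\<forall>i l. c i l = 0)"
    and "distinct (map fst ys)" "\<And>i. i \<in> fst ` set ys \<Longrightarrow> i < n"
  shows "vec_state 0 (prod_list (map (\<lambda>(k, p). eval (incr r (c k) (Iv k)) p) ys)) =
    prod_list (map (\<lambda>(k, p). vec_state 0 (eval (incr r (c k) (Iv k)) p)) ys)"
proof (rule factor_evals[OF q_nz, where n = n and Y = "\<lambda>k. incr r (c k) (Iv k)"])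
  fix i and ls :: "letter list" and zs :: "(nat \<times> letter list) list"
  assume i: "i < n" and zs: "\<And>z. z \<in> set zs \<Longrightarrow> i < fst z \<and> fst z < n"
  show "vec_state 0 (word_eval (incr r (c i) (Iv i)) ls *
        prod_list (map (\<lambda>(k, ms). word_eval (incr r (c k) (Iv k)) ms) zs)) =
      vec_state 0 (word_eval (incr r (c i) (Iv i)) ls) *
        vec_state 0 (prod_list (map (\<lambda>(k, ms). word_eval (incr r (c k) (Iv k)) ms) zs))"
  proof (rule vec_state_split)
    show "preserves (on_sites (Iv i)) (adj (word_eval (incr r (c i) (Iv i)) ls))"
      by (auto simp: adj_prod_list intro!: preserves_prod_list preserves_adj_incr)
    show "preserves (on_sites (\<Union>k\<in>{i<..<n}. Iv k))
        (prod_list (map (\<lambda>(k, ms). word_eval (incr r (c k) (Iv k)) ms) zs))"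
    proof (rule preserves_prod_list)
      fix a assume "a \<in> set (map (\<lambda>(k, ms). word_eval (incr r (c k) (Iv k)) ms) zs)"
      then obtain k ms where k: "(k, ms) \<in> set zs" and a: "a = word_eval (incr r (c k) (Iv k)) ms"
        by auto
      have "Iv k \<subseteq> (\<Union>k\<in>{i<..<n}. Iv k)" using zs[OF k] by auto
      then show "preserves (on_sites (\<Union>k\<in>{i<..<n}. Iv k)) a"
        unfolding a by (auto intro!: preserves_prod_list preserves_incr)
    qed
    show "Iv i \<inter> (\<Union>k\<in>{i<..<n}. Iv k) = {}"
    proof (rule equals0I)
      fix a assume "a \<in> Iv i \<inter> (\<Union>k\<in>{i<..<n}. Iv k)"
      then obtain k where k: "i < k" "k < n" and a: "a \<in> Iv i" "a \<in> Iv k" by auto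
      show False using assms(1)[OF k] a by blast
    qed
  qed
next
  fix i ls
  assume nz: "vec_state 0 (word_eval (incr r (c i) (Iv i)) ls) \<noteq> 0"
  show "q powi charge ls = 1"
  \<comment> \<open>For \<open>q = 1\<close> every power is 1; otherwise the drift vanishes and
    charge conservation applies.\<close>
  proof (cases "q = 1")
    case False
    then have "incr r (c i) (Iv i) l = complex_of_real r *\<^sub>C (\<Sum>j\<in>Iv i. site j l)" for l
      using assms(2) by (simp add: incr_def block_def)
    then show ?thesis
      using vec_state_charge[OF _ nz] by blast
  qed simp
next
  fix i k :: nat assume ik: "i < k" "k < n"
  show "braid_commute q (incr r (c i) (Iv i)) (incr r (c k) (Iv k))"
    using assms(1)[OF ik] assms(2) by (intro braid_commute_incr) blast+
qed (fact assms(3) | simp add: assms(4))+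


subsection \<open>Uniform moment bounds\<close>

definition repeats :: "'b list \<Rightarrow> bool" where
  "repeats xs \<longleftrightarrow> (\<forall>x\<in>set xs. count_list xs x \<noteq> 1)"

text \<open>\<open>ps\<close> are sites already chosen and \<open>k\<close> sites remain to be
  chosen; the prefix lets the count follow the expansion of one block after another.\<close>

definition repeating_lists :: "nat \<Rightarrow> nat list \<Rightarrow> nat \<Rightarrow> nat list set" where
  "repeating_lists N ps k = {is. length is = k \<and> set is \<subseteq> {..<N} \<and> repeats (ps @ is)}"

lemma finite_repeating_lists: "finite (repeating_lists N ps k)"
  by (rule finite_subset[OF _ finite_lists_length_eq[of "{..<N}" k]]) (auto simp: repeating_lists_def)

lemma card_repeating_lists_Suc:
  "card (repeating_lists N ps (Suc k)) = (\<Sum>i<N. card (repeating_lists N (ps @ [i]) k))"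
proof -
  have "repeating_lists N ps (Suc k) =
      (\<lambda>(i, is). i # is) ` (SIGMA i:{..<N}. repeating_lists N (ps @ [i]) k)" (is "?A = ?B")
  proof
    show "?A \<subseteq> ?B"
    proof
      fix xs assume xs: "xs \<in> ?A"
      then obtain i "is" where "xs = i # is"
        by (cases xs) (auto simp: repeating_lists_def)
      with xs show "xs \<in> ?B"
        by (auto simp: repeating_lists_def image_iff)
    qed
  qed (auto simp: repeating_lists_def)
  moreover have "inj_on (\<lambda>(i, is). i # is) (SIGMA i:{..<N}. repeating_lists N (ps @ [i]) k)"
    by (auto simp: inj_on_def)
  ultimately show ?thesis
    by (simp add: card_image card_SigmaI finite_repeating_lists)
qed

text \<open>\<open>ws\<close> is the part already expanded into single sites. A fully expanded word
  in which some site occurs exactly once has expectation 0; all others obey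
  \<open>word_bound\<close>.\<close>

lemma norm_vec_state_blocks_aux:
  assumes "\<And>I l. (I, l) \<in> set zs \<Longrightarrow> I \<subseteq> {..<N}"
  shows "cmod (vec_state 0 (prod_list (map (case_prod site) ws) * prod_list (map (case_prod block) zs))) \<le>
    real (card (repeating_lists N (map fst ws) (length zs))) * word_bound (length ws + length zs)"
  using assms
proof (induction zs arbitrary: ws)
  case Nil
  show ?case
  proof (cases "repeats (map fst ws)")
    case True
    then have "repeating_lists N (map fst ws) 0 = {[]}"
      by (auto simp: repeating_lists_def)
    then show ?thesis using norm_vec_state_site_word[of ws] by simp
  next
    case False
    then obtain i where i: "i \<in> set (map fst ws)" "count_list (map fst ws) i = 1"
      by (auto simp: repeats_def)
    then obtain l ps qs where ws: "ws = ps @ (i, l) # qs"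
      by (auto dest: split_list)
    have "count_list (map fst ps) i = 0" "count_list (map fst qs) i = 0"
      using i(2) by (simp_all add: ws)
    then have "i \<notin> fst ` set ps \<union> fst ` set qs"
      by (simp add: count_list_0_iff)
    then have "vec_state 0 (prod_list (map (case_prod site) ws)) = 0"
      using vec_state_single_site[of ps qs i l] by (auto simp: ws mult.assoc)
    moreover have "repeating_lists N (map fst ws) 0 = {}"
      using False by (auto simp: repeating_lists_def)
    ultimately show ?thesis by simp
  qed
next
  case (Cons z zs)
  obtain I l where z: "z = (I, l)" by (cases z)
  have I: "I \<subseteq> {..<N}" using Cons.prems z by auto
  let ?P = "prod_list (map (case_prod site) ws)" and ?Q = "prod_list (map (case_prod block) zs)"
  have "?P * prod_list (map (case_prod block) (z # zs)) = (\<Sum>i\<in>I. ?P * site i l * ?Q)"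
    by (simp add: z block_def sum_distrib_left sum_distrib_right mult.assoc)
  then have "cmod (vec_state 0 (?P * prod_list (map (case_prod block) (z # zs)))) \<le>
      (\<Sum>i\<in>I. cmod (vec_state 0 (?P * site i l * ?Q)))"
    by (simp add: vec_state_sum sum_norm_le)
  also have "\<dots> \<le> (\<Sum>i<N. cmod (vec_state 0 (?P * site i l * ?Q)))"
    using I by (intro sum_mono2) auto
  also have "\<dots> \<le> (\<Sum>i<N. real (card (repeating_lists N (map fst ws @ [i]) (length zs)))
      * word_bound (length ws + length (z # zs)))"
  proof (intro sum_mono)
    fix i
    show "cmod (vec_state 0 (?P * site i l * ?Q)) \<le>
      real (card (repeating_lists N (map fst ws @ [i]) (length zs))) * word_bound (length ws + length (z # zs))"
      using Cons.IH[of "ws @ [(i, l)]"] Cons.prems by auto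
  qed
  also have "\<dots> = real (card (repeating_lists N (map fst ws) (length (z # zs))))
      * word_bound (length ws + length (z # zs))"
    by (simp add: card_repeating_lists_Suc sum_distrib_right)
  finally show ?case .
qed

text \<open>Every value occurs at least twice, so there are at most \<open>k div 2\<close> distinct
  ones. A list is thus encoded by a table of \<open>k div 2\<close> sites and a table index for each
  position.\<close>

lemma card_repeating_lists: "card (repeating_lists N [] k) \<le> N ^ (k div 2) * (k div 2) ^ k"
proof -
  let ?h = "k div 2"
  let ?A = "{ys. set ys \<subseteq> {..<N} \<and> length ys = ?h}" and ?B = "{g. set g \<subseteq> {..<?h} \<and> length g = k}"
  have "repeating_lists N [] k \<subseteq> (\<lambda>(ys, g). map (\<lambda>j. ys ! j) g) ` (?A \<times> ?B)"
  proof
    fix xs assume "xs \<in> repeating_lists N [] k"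
    then have len: "length xs = k" and N: "set xs \<subseteq> {..<N}" and rep: "repeats xs"
      by (auto simp: repeating_lists_def)
    let ?r = "remdups xs"
    have "2 * card (set xs) = (\<Sum>x\<in>set xs. 2)" by simp
    also have "\<dots> \<le> (\<Sum>x\<in>set xs. count_list xs x)"
    proof (intro sum_mono)
      fix x assume "x \<in> set xs"
      then have "count_list xs x \<noteq> 0" "count_list xs x \<noteq> 1"
        using rep by (auto simp: repeats_def count_list_0_iff)
      then show "2 \<le> count_list xs x" by linarith
    qed
    also have "\<dots> = k" using len by (simp add: sum_count_set)
    finally have r: "length ?r \<le> ?h" by (simp add: length_remdups_card_conv)
    define ys where "ys = ?r @ replicate (?h - length ?r) 0"
    have "\<exists>j<length ?r. ?r ! j = x" if "x \<in> set xs" for x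
      using that by (metis in_set_conv_nth set_remdups)
    then obtain f where f: "\<And>x. x \<in> set xs \<Longrightarrow> f x < length ?r \<and> ?r ! f x = x"
      by metis
    have "ys \<in> ?A"
    proof -
      \<comment> \<open>The padding 0 must be a legal site: if \<open>N = 0\<close>, the list is
        empty and the table has no entries.\<close>
      have "0 < N \<or> ?h = 0"
        using N len by (cases xs) auto
      then show ?thesis using N r by (auto simp: ys_def)
    qed
    moreover have "map f xs \<in> ?B"
      using f r len by (auto intro: less_le_trans)
    moreover have "xs = map (\<lambda>j. ys ! j) (map f xs)"
      using f by (auto simp: ys_def nth_append intro!: nth_equalityI)
    ultimately show "xs \<in> (\<lambda>(ys, g). map (\<lambda>j. ys ! j) g) ` (?A \<times> ?B)"
      by (intro image_eqI[of _ _ "(ys, map f xs)"]) auto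
  qed
  then have "card (repeating_lists N [] k) \<le> card (?A \<times> ?B)"
    by (intro surj_card_le[of _ _ "\<lambda>(ys, g). map (\<lambda>j. ys ! j) g"] finite_cartesian_product
        finite_lists_length_eq) auto
  also have "\<dots> = N ^ ?h * ?h ^ k"
    by (simp add: card_cartesian_product card_lists_length_eq)
  finally show ?thesis .
qed

lemma word_bound_nonneg: "0 \<le> word_bound k"
  using wt_bound_ge_1 by (induction k) (simp_all add: site_bound_def)

text \<open>For words of length k, the power N^(k div 2) is what the normalisation n^(-k/2)
  compensates when \<open>N\<close> grows in proportion to n.\<close>

lemma norm_vec_state_blocks:
  assumes "\<And>I l. (I, l) \<in> set zs \<Longrightarrow> I \<subseteq> {..<N}"
  shows "cmod (vec_state 0 (prod_list (map (case_prod block) zs))) \<le>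
    real N ^ (length zs div 2) * real (length zs div 2) ^ length zs * word_bound (length zs)"
proof -
  have "real (card (repeating_lists N [] (length zs))) \<le> real (N ^ (length zs div 2) * (length zs div 2) ^ length zs)"
    using card_repeating_lists by (intro of_nat_mono)
  then show ?thesis
    using norm_vec_state_blocks_aux[of zs N "[]"] assms word_bound_nonneg[of "length zs"]
    by (fastforce intro: order_trans mult_right_mono)
qed

end

section \<open>Moments of one increment\<close>

text \<open>Polynomials of degree at most \<open>h\<close> in the binomial basis, in which summation
  over \<open>j < m\<close> merely shifts the index by one.\<close>

definition binomial_poly :: "nat \<Rightarrow> (nat \<Rightarrow> complex) set" where
  "binomial_poly h = {f. \<exists>c. \<forall>m. f m = (\<Sum>k\<le>h. c k * of_nat (m choose k))}"

lemma binomial_polyI: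
  assumes "\<And>m. f m = (\<Sum>k\<le>h. c k * of_nat (m choose k))"
  shows "f \<in> binomial_poly h"
  unfolding binomial_poly_def mem_Collect_eq using assms by (intro exI[of _ c]) blast

lemma binomial_poly_const: "(\<lambda>_. a) \<in> binomial_poly h"
proof -
  have "a = (\<Sum>k\<le>h. (if k = 0 then a else 0) * of_nat (m choose k))" for m
  proof -
    have "(\<Sum>k\<le>h. (if k = 0 then a else 0) * of_nat (m choose k)) = (\<Sum>k\<le>h. if k = 0 then a else 0)"
      by (intro sum.cong) auto
    then show ?thesis by simp
  qed
  then show ?thesis by (rule binomial_polyI)
qed

lemma binomial_poly_add:
  assumes "f \<in> binomial_poly h" "g \<in> binomial_poly h"
  shows "(\<lambda>m. f m + g m) \<in> binomial_poly h"
proof -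
  obtain c d where "\<forall>m. f m = (\<Sum>k\<le>h. c k * of_nat (m choose k))" "\<forall>m. g m = (\<Sum>k\<le>h. d k * of_nat (m choose k))"
    using assms unfolding binomial_poly_def by blast
  then have "f m + g m = (\<Sum>k\<le>h. (c k + d k) * of_nat (m choose k))" for m
    by (simp add: distrib_right sum.distrib)
  then show ?thesis by (rule binomial_polyI)
qed

lemma binomial_poly_cmult:
  assumes "f \<in> binomial_poly h"
  shows "(\<lambda>m. a * f m) \<in> binomial_poly h"
proof -
  obtain c where "\<forall>m. f m = (\<Sum>k\<le>h. c k * of_nat (m choose k))"
    using assms unfolding binomial_poly_def by blast
  then have "a * f m = (\<Sum>k\<le>h. (a * c k) * of_nat (m choose k))" for m
    by (simp add: sum_distrib_left mult.assoc)
  then show ?thesis by (rule binomial_polyI)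
qed

lemma binomial_poly_sum:
  "(\<And>i. i \<in> S \<Longrightarrow> f i \<in> binomial_poly h) \<Longrightarrow> (\<lambda>m. \<Sum>i\<in>S. f i m) \<in> binomial_poly h"
  by (induction S rule: infinite_finite_induct) (simp_all add: binomial_poly_const binomial_poly_add)

lemma binomial_poly_mono:
  assumes "f \<in> binomial_poly h" "h \<le> h'"
  shows "f \<in> binomial_poly h'"
proof -
  obtain c where c: "\<forall>m. f m = (\<Sum>k\<le>h. c k * of_nat (m choose k))"
    using assms unfolding binomial_poly_def by blast
  have "f m = (\<Sum>k\<le>h'. (if k \<le> h then c k else 0) * of_nat (m choose k))" for m
    unfolding c[rule_format] using assms(2) by (intro sum.mono_neutral_cong_left) auto
  then show ?thesis by (rule binomial_polyI)
qed

lemma binomial_poly_partial_sums: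
  assumes "f \<in> binomial_poly h"
  shows "(\<lambda>m. \<Sum>j<m. f j) \<in> binomial_poly (Suc h)"
proof -
  obtain c where c: "\<forall>m. f m = (\<Sum>k\<le>h. c k * of_nat (m choose k))"
    using assms unfolding binomial_poly_def by blast
  have "(\<Sum>j<m. f j) = (\<Sum>k\<le>Suc h. (if k = 0 then 0 else c (k - 1)) * of_nat (m choose k))" for m
  proof -
    have "(\<Sum>j<m. f j) = (\<Sum>k\<le>h. c k * of_nat (\<Sum>j<m. j choose k))"
      by (simp add: c sum.swap[of _ "{..<m}"] sum_distrib_left)
    also have "\<dots> = (\<Sum>k\<le>h. c k * of_nat (m choose Suc k))"
    proof -
      have "(\<Sum>j<m. j choose k) = m choose Suc k" for k
        using sum_choose_upper[of k "m - 1"] by (cases m) (simp_all add: lessThan_Suc_atMost)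
      then show ?thesis by (simp only:)
    qed
    also have "\<dots> = (\<Sum>k\<le>Suc h. (if k = 0 then 0 else c (k - 1)) * of_nat (m choose k))"
      by (subst sum.atMost_Suc_shift) simp
    finally show ?thesis .
  qed
  then show ?thesis by (rule binomial_polyI)
qed

text \<open>Each of the \<open>k\<close> factors of the falling factorial is divided by
  \<open>n\<close>; the shifts \<open>i / n\<close> tend to 0.\<close>

lemma tendsto_binomial_scaled:
  assumes "(\<lambda>n. real (m n) / real n) \<longlonglongrightarrow> \<tau>"
  shows "(\<lambda>n. real (m n choose k) / real n ^ k) \<longlonglongrightarrow> \<tau> ^ k / fact k"
proof -
  have "(\<lambda>n. (\<Prod>i<k. real (m n) / real n - real i / real n) / fact k) \<longlonglongrightarrow> (\<Prod>i<k. \<tau> - 0) / fact k"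
    by (intro tendsto_intros assms fact_nonzero lim_const_over_n)
  also have "(\<lambda>n. (\<Prod>i<k. real (m n) / real n - real i / real n) / fact k) =
      (\<lambda>n. real (m n choose k) / real n ^ k)"
    by (auto simp: binomial_gbinomial gbinomial_prod_rev prod_dividef atLeast0LessThan
        simp flip: diff_divide_distrib)
  finally show ?thesis by simp
qed

lemma binomial_poly_limit:
  assumes "f \<in> binomial_poly h"
  obtains C where "\<And>m \<tau>. (\<lambda>n. real (m n) / real n) \<longlonglongrightarrow> \<tau> \<Longrightarrow>
    (\<lambda>n. f (m n) / of_nat n ^ h) \<longlonglongrightarrow> C * of_real \<tau> ^ h"
proof -
  obtain c where c: "\<forall>m. f m = (\<Sum>k\<le>h. c k * of_nat (m choose k))"
    using assms unfolding binomial_poly_def by blast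
  show ?thesis
  \<comment> \<open>Only the top binomial coefficient survives division by \<open>n ^ h\<close>, and
    its limit carries the factor \<open>1 / fact h\<close>.\<close>
  proof (rule that[of "c h / fact h"])
    fix m :: "nat \<Rightarrow> nat" and \<tau> :: real assume lim: "(\<lambda>n. real (m n) / real n) \<longlonglongrightarrow> \<tau>"
    have "(\<lambda>n. c k * of_nat (m n choose k) / of_nat n ^ h) \<longlonglongrightarrow> (if k = h then c h / fact h * of_real \<tau> ^ h else 0)"
      if "k \<le> h" for k
    proof -
      have z: "(\<lambda>n. inverse (real n) ^ (h - k)) \<longlonglongrightarrow> 0 ^ (h - k)"
        by (intro tendsto_power lim_inverse_n)
      have "(\<lambda>n. c k * of_real (real (m n choose k) / real n ^ k * inverse (real n) ^ (h - k)))
          \<longlonglongrightarrow> c k * of_real (\<tau> ^ k / fact k * 0 ^ (h - k))"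
        by (intro tendsto_intros tendsto_binomial_scaled lim z)
      moreover have "inverse (of_nat n) ^ (h - k) / of_nat n ^ k = 1 / (of_nat n :: complex) ^ h" for n
        using that by (simp add: power_inverse field_simps flip: power_add)
      then have "c k * of_real (real (m n choose k) / real n ^ k * inverse (real n) ^ (h - k)) =
          c k * of_nat (m n choose k) / of_nat n ^ h" for n
        by (simp add: field_simps)
      ultimately show ?thesis using that by (auto simp: power_0_left split: if_splits)
    qed
    then have "(\<lambda>n. \<Sum>k\<le>h. c k * of_nat (m n choose k) / of_nat n ^ h) \<longlonglongrightarrow>
        (\<Sum>k\<le>h. if k = h then c h / fact h * of_real \<tau> ^ h else 0)"
      by (intro tendsto_sum) auto
    then show "(\<lambda>n. f (m n) / of_nat n ^ h) \<longlonglongrightarrow> c h / fact h * of_real \<tau> ^ h"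
      by (simp add: c sum_divide_distrib)
  qed
qed

lemma keys_braided_mult_single:
  "Poly_Mapping.keys (braided_mult q (Poly_Mapping.single (a, b) s) z) \<subseteq>
     (\<lambda>(c, d). (a + c, b + d)) ` Poly_Mapping.keys z"
proof -
  have "braided_mult q (Poly_Mapping.single (a, b) s) z =
    lin_ext (\<lambda>(c, d). Poly_Mapping.single (a + c, b + d) (s * complex_of_real
       (q powi ((int (num_letter Lx b) - int (num_letter Lv b)) * int (length (letters c)))))) z"
  proof (induction z rule: free_induct)
    case (single k t)
    then show ?case by (cases k) (simp add: braided_mult_single ac_simps)
  qed simp
  then show ?thesis
    using keys_lin_ext by (fastforce split: if_splits)
qed

text \<open>Only the leading tensor \<open>w \<otimes> 1\<close> of \<open>\<Delta> w\<close> has a trivial right factor.\<close>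

lemma comult_letters_leading:
  "\<exists>z. comult_letters q ls = basis (Word ls, 0) + z \<and>
     (\<forall>(u, w)\<in>Poly_Mapping.keys z. length (letters u) + length (letters w) = length ls \<and> letters w \<noteq> [])"
proof (induction ls)
  case Nil
  show ?case by (intro exI[of _ 0]) (simp add: zero_word_def)
next
  case (Cons l ls)
  then obtain z where z: "comult_letters q ls = basis (Word ls, 0) + z"
    "\<And>u w. (u, w) \<in> Poly_Mapping.keys z \<Longrightarrow> length (letters u) + length (letters w) = length ls \<and> letters w \<noteq> []"
    by blast
  let ?b1 = "braided_mult q (basis (0, Word [l])) (basis (Word ls, 0))"
  let ?b2 = "braided_mult q (basis (Word [l], 0)) z" and ?b3 = "braided_mult q (basis (0, Word [l])) z"
  have "comult_letters q (l # ls) = basis (Word (l # ls), 0) + (?b1 + ?b2 + ?b3)"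
    by (simp add: z(1) braided_mult_single plus_word_def zero_word_def num_letter_zero[unfolded zero_word_def])
  moreover have "length (letters u) + length (letters w) = length (l # ls) \<and> letters w \<noteq> []"
    if "(u, w) \<in> Poly_Mapping.keys (?b1 + ?b2 + ?b3)" for u w
  proof -
    have "(u, w) \<in> Poly_Mapping.keys ?b1 \<or> (u, w) \<in> Poly_Mapping.keys ?b2 \<or> (u, w) \<in> Poly_Mapping.keys ?b3"
      using that by (meson Poly_Mapping.keys_add UnE subsetD)
    then show ?thesis
    proof (elim disjE)
      assume "(u, w) \<in> Poly_Mapping.keys ?b1"
      then show ?thesis
        by (auto dest!: subsetD[OF keys_braided_mult_single] simp: plus_word_def zero_word_def)
    next
      assume "(u, w) \<in> Poly_Mapping.keys ?b2"
      then show ?thesis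
        by (auto dest!: subsetD[OF keys_braided_mult_single] z(2) simp: plus_word_def zero_word_def)
    next
      assume "(u, w) \<in> Poly_Mapping.keys ?b3"
      then show ?thesis
        by (auto dest!: subsetD[OF keys_braided_mult_single] z(2) simp: plus_word_def zero_word_def)
    qed
  qed
  ultimately show ?case by blast
qed

lemma vec_state_pext: "vec_state k (pext f p) = (\<Sum>j\<in>Poly_Mapping.keys p. Poly_Mapping.lookup p j * vec_state k (f j))"
  by (simp add: pext_def vec_state_sum)

context braided_sites
begin

text \<open>The coproduct of the word, evaluated with the old sites on the left and the new last
  site on the right. One \<open>z\<close> serves all \<open>I\<close> and \<open>m\<close>, so the
  recursion has constant coefficients.\<close>

lemma block_insert_moment:
  "\<exists>z::free_alg2.
    (\<forall>u w. (u, w) \<in> Poly_Mapping.keys z \<longrightarrow> length (letters u) + length (letters w) = length ls \<and> letters w \<noteq> []) \<and>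
    (\<forall>I m. finite I \<longrightarrow> (\<forall>i\<in>I. i < m) \<longrightarrow>
      vec_state 0 (word_eval (block (insert m I)) ls) = vec_state 0 (word_eval (block I) ls) +
      (\<Sum>(u, w)\<in>Poly_Mapping.keys z. Poly_Mapping.lookup z (u, w) *
         (vec_state 0 (word_eval (block I) (letters u)) * site_vec (letters w) 0)))"
proof -
  obtain z where z: "comult_letters q ls = basis (Word ls, 0) + z"
    "\<And>u w. (u, w) \<in> Poly_Mapping.keys z \<Longrightarrow> length (letters u) + length (letters w) = length ls \<and> letters w \<noteq> []"
    using comult_letters_leading[of q ls] by blast
  show ?thesis
  proof (intro exI[of _ z] conjI allI impI)
    fix I and m :: nat assume I: "finite I" "\<forall>i\<in>I. i < m"
    have bc: "braid_commute q (block I) (site m)"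
      using block_commute[of I "{m}"] I by (simp add: braid_commute_def block_def)
    have split: "vec_state 0 (word_eval (block I) us * word_eval (site m) ws) =
        vec_state 0 (word_eval (block I) us) * site_vec ws 0" for us ws
    proof -
      have "vec_state 0 (word_eval (block I) us * word_eval (site m) ws) =
        vec_state 0 (word_eval (block I) us) * vec_state 0 (word_eval (site m) ws)"
      proof (rule vec_state_split)
        show "preserves (on_sites I) (adj (word_eval (block I) us))"
          by (auto simp: adj_prod_list intro!: preserves_prod_list preserves_block)
        show "preserves (on_sites {m}) (word_eval (site m) ws)"
          by (auto intro!: preserves_prod_list preserves_site)
      qed (use I in auto)
      then show ?thesis by (simp add: vec_state_one_site)
    qed
    have "block (insert m I) = (\<lambda>l. block I l + site m l)"
      using I by (auto simp: block_def fun_eq_iff add.commute)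
    then have "vec_state 0 (word_eval (block (insert m I)) ls) =
        vec_state 0 (tensor_eval (block I) (site m) (comult q (basis (Word ls))))"
      by (subst tensor_eval_comult[OF bc q_nz]) (simp add: eval_single)
    also have "comult q (basis (Word ls)) = basis (Word ls, 0) + z"
      by (simp add: comult_def z(1))
    also have "vec_state 0 (tensor_eval (block I) (site m) (basis (Word ls, 0) + z)) =
        vec_state 0 (word_eval (block I) ls) + vec_state 0 (tensor_eval (block I) (site m) z)"
      by (simp add: tensor_eval_def zero_word_def)
    also have "vec_state 0 (tensor_eval (block I) (site m) z) =
      (\<Sum>(u, w)\<in>Poly_Mapping.keys z. Poly_Mapping.lookup z (u, w) *
         (vec_state 0 (word_eval (block I) (letters u)) * site_vec (letters w) 0))"
      by (simp add: tensor_eval_def vec_state_pext case_prod_unfold split)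
    finally show "vec_state 0 (word_eval (block (insert m I)) ls) = vec_state 0 (word_eval (block I) ls) +
      (\<Sum>(u, w)\<in>Poly_Mapping.keys z. Poly_Mapping.lookup z (u, w) *
         (vec_state 0 (word_eval (block I) (letters u)) * site_vec (letters w) 0))" .
  qed (use z(2) in blast)+
qed

lemma vec_state_block_single: "vec_state 0 (block I l) = 0"
  using vec_state_one_site[of _ "[l]"] site_vec_single by (simp add: block_def vec_state_sum)

lemma vec_state_block_pair:
  assumes "finite I"
  shows "vec_state 0 (block I l * block I l') = of_nat (card I) * site_vec [l, l'] 0"
proof -
  have "vec_state 0 (site i l * site j l') = (if j = i then site_vec [l, l'] 0 else 0)" for i j
    using vec_state_one_site[of i "[l, l']"] vec_state_single_site[of "[]" "[(j, l')]" i l]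
    by (cases "i = j") simp_all
  then have "vec_state 0 (block I l * block I l') = (\<Sum>i\<in>I. \<Sum>j\<in>I. if j = i then site_vec [l, l'] 0 else 0)"
    by (simp add: block_def sum_product vec_state_sum)
  then show ?thesis using assms by simp
qed

text \<open>A new site changes the moment by a sum over splittings into \<open>u\<close> on the old
  sites and a nonempty \<open>w\<close> on the new one. One-letter \<open>w\<close> have mean 0, so
  otherwise \<open>u\<close> is at least two letters shorter: the difference has degree one less,
  and summation restores it. Independence of \<open>a\<close> yields stationarity.\<close>

lemma block_moment_poly:
  "\<exists>f\<in>binomial_poly (length ls div 2). \<forall>a m. vec_state 0 (word_eval (block {a..<a + m}) ls) = f m"
proof (induction "length ls" arbitrary: ls rule: less_induct)
  case less
  show ?case
  proof (cases "length ls < 2")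
    case True
    then consider "ls = []" | l where "ls = [l]"
      by (cases ls; cases "tl ls") auto
    then show ?thesis
    proof cases
      case 1
      then show ?thesis
        by (intro bexI[of _ "\<lambda>_. 1"]) (simp_all add: binomial_poly_const)
    next
      case 2
      then show ?thesis
        by (intro bexI[of _ "\<lambda>_. 0"]) (simp_all add: binomial_poly_const vec_state_block_single)
    qed
  next
    case False
    obtain z :: free_alg2 where
      z0: "\<forall>u w. (u, w) \<in> Poly_Mapping.keys z \<longrightarrow> length (letters u) + length (letters w) = length ls \<and> letters w \<noteq> []"
      and step0: "\<forall>I m. finite I \<longrightarrow> (\<forall>i\<in>I. i < m) \<longrightarrow>
      vec_state 0 (word_eval (block (insert m I)) ls) = vec_state 0 (word_eval (block I) ls) +
      (\<Sum>(u, w)\<in>Poly_Mapping.keys z. Poly_Mapping.lookup z (u, w) *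
         (vec_state 0 (word_eval (block I) (letters u)) * site_vec (letters w) 0))"
      using block_insert_moment[of ls] by (elim exE conjE) (rule that)
    note z = z0[rule_format] and step = step0[rule_format]
    let ?h = "length ls div 2"
    have "\<exists>f\<in>binomial_poly (length (letters u) div 2). \<forall>a m. vec_state 0 (word_eval (block {a..<a + m}) (letters u)) = f m"
      if "length (letters u) < length ls" for u
      using less that by blast
    then obtain f where f: "\<And>u. length (letters u) < length ls \<Longrightarrow> f u \<in> binomial_poly (length (letters u) div 2)"
      "\<And>u a m. length (letters u) < length ls \<Longrightarrow> vec_state 0 (word_eval (block {a..<a + m}) (letters u)) = f u m"
      by metis
    define g where "g m = (\<Sum>(u, w)\<in>Poly_Mapping.keys z. Poly_Mapping.lookup z (u, w) *
      (f u m * site_vec (letters w) 0))" for m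
    have "(\<lambda>m. Poly_Mapping.lookup z (u, w) * (f u m * site_vec (letters w) 0)) \<in> binomial_poly (?h - 1)"
      if "(u, w) \<in> Poly_Mapping.keys z" for u w
    proof (cases "length (letters w) = 1")
      case True
      then obtain l where "letters w = [l]" by (cases "letters w") auto
      then show ?thesis by (simp add: site_vec_single binomial_poly_const del: site_vec.simps)
    next
      case False
      then have w: "2 \<le> length (letters w)" "length (letters u) + length (letters w) = length ls"
        using z[OF that] by (cases "letters w"; cases "tl (letters w)"; force)+
      then have "f u \<in> binomial_poly (?h - 1)"
        by (intro binomial_poly_mono[OF f(1)]) auto
      then have "(\<lambda>m. Poly_Mapping.lookup z (u, w) * (site_vec (letters w) 0 * f u m)) \<in> binomial_poly (?h - 1)"
        by (intro binomial_poly_cmult)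
      then show ?thesis by (simp add: mult.commute)
    qed
    then have g: "g \<in> binomial_poly (?h - 1)"
      unfolding g_def case_prod_unfold by (intro binomial_poly_sum) (metis prod.collapse)
    have "vec_state 0 (word_eval (block {a..<a + m}) ls) = (\<Sum>j<m. g j)" for a m
    proof (induction m)
      case 0
      show ?case using False by (cases ls) (simp_all add: block_def)
    next
      case (Suc m)
      have eq: "{a..<a + Suc m} = insert (a + m) {a..<a + m}" by auto
      have "vec_state 0 (word_eval (block {a..<a + Suc m}) ls) = (\<Sum>j<m. g j) +
        (\<Sum>(u, w)\<in>Poly_Mapping.keys z. Poly_Mapping.lookup z (u, w) *
         (vec_state 0 (word_eval (block {a..<a + m}) (letters u)) * site_vec (letters w) 0))"
        unfolding eq by (subst step) (auto simp: Suc)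
      also have "(\<Sum>(u, w)\<in>Poly_Mapping.keys z. Poly_Mapping.lookup z (u, w) *
         (vec_state 0 (word_eval (block {a..<a + m}) (letters u)) * site_vec (letters w) 0)) = g m"
        unfolding g_def
      proof (intro sum.cong refl, clarify)
        fix u w assume "(u, w) \<in> Poly_Mapping.keys z"
        then have "length (letters u) < length ls" using z[of u w] by (cases "letters w") auto
        then show "Poly_Mapping.lookup z (u, w) *
         (vec_state 0 (word_eval (block {a..<a + m}) (letters u)) * site_vec (letters w) 0) =
           Poly_Mapping.lookup z (u, w) * (f u m * site_vec (letters w) 0)"
          by (simp add: f(2))
      qed
      finally show ?case by simp
    qed
    moreover have "(\<lambda>m. \<Sum>j<m. g j) \<in> binomial_poly ?h"
      using binomial_poly_partial_sums[OF g] False by simp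
    ultimately show ?thesis by (intro bexI[of _ "\<lambda>m. \<Sum>j<m. g j"]) simp_all
  qed
qed

text \<open>In odd length one factor n^(-1/2) is left over after the polynomial growth has been
  absorbed, so the limit is 0.\<close>

lemma scaled_block_moment:
  obtains C where "\<And>a m \<tau>. (\<lambda>n. real (m n) / real n) \<longlonglongrightarrow> \<tau> \<Longrightarrow>
    (\<lambda>n. of_real (1 / sqrt (real n)) ^ length ls * vec_state 0 (word_eval (block {a n..<a n + m n}) ls))
      \<longlonglongrightarrow> (if even (length ls) then C * of_real \<tau> ^ (length ls div 2) else 0)"
proof -
  let ?h = "length ls div 2"
  obtain f where f: "f \<in> binomial_poly ?h"
    "\<And>a m. vec_state 0 (word_eval (block {a..<a + m}) ls) = f m"
    using block_moment_poly[of ls] by blast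
  obtain C where C: "\<And>m \<tau>. (\<lambda>n. real (m n) / real n) \<longlonglongrightarrow> \<tau> \<Longrightarrow>
    (\<lambda>n. f (m n) / of_nat n ^ ?h) \<longlonglongrightarrow> C * of_real \<tau> ^ ?h"
    using binomial_poly_limit[OF f(1)] by blast
  show ?thesis
  proof (rule that[of C])
    fix a m :: "nat \<Rightarrow> nat" and \<tau> :: real assume lim: "(\<lambda>n. real (m n) / real n) \<longlonglongrightarrow> \<tau>"
    have sq: "(complex_of_real (1 / sqrt (real n)))\<^sup>2 = 1 / of_nat n" for n
      by (simp add: power_divide flip: of_real_power)
    have pow: "complex_of_real (1 / sqrt (real n)) ^ length ls =
        (if even (length ls) then 1 else complex_of_real (1 / sqrt (real n))) / of_nat n ^ ?h" for n
    proof -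
      have "complex_of_real (1 / sqrt (real n)) ^ length ls =
          ((complex_of_real (1 / sqrt (real n)))\<^sup>2) ^ ?h * complex_of_real (1 / sqrt (real n)) ^ (length ls mod 2)"
        by (metis div_mult_mod_eq mult.commute power_add power_mult)
      then show ?thesis
        unfolding sq by (auto simp: power_divide odd_iff_mod_2_eq_one even_iff_mod_2_eq_zero)
    qed
    have "(\<lambda>n. complex_of_real (1 / sqrt (real n))) \<longlonglongrightarrow> of_real 0"
      by (intro tendsto_of_real) real_asymp
    then have "(\<lambda>n. (if even (length ls) then 1 else complex_of_real (1 / sqrt (real n))) * (f (m n) / of_nat n ^ ?h))
       \<longlonglongrightarrow> (if even (length ls) then 1 else 0) * (C * of_real \<tau> ^ ?h)"
      by (intro tendsto_mult C[OF lim]) auto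
    then show "(\<lambda>n. of_real (1 / sqrt (real n)) ^ length ls * vec_state 0 (word_eval (block {a n..<a n + m n}) ls))
      \<longlonglongrightarrow> (if even (length ls) then C * of_real \<tau> ^ ?h else 0)"
      unfolding pow f(2) by (auto split: if_splits)
  qed
qed

end

section \<open>The limiting process\<close>

text \<open>Tychonoff: the vectors of values stay in a product of closed discs. The index type may
  be uncountable, so a cluster point yields a finer filter in place of a subsequence.\<close>

lemma pointwise_limit_filter:
  fixes f :: "'i \<Rightarrow> nat \<Rightarrow> complex"
  assumes "\<And>i. \<exists>B. \<forall>n. cmod (f i n) \<le> B"
  obtains G where "G \<noteq> bot" "G \<le> sequentially" "\<And>i. \<exists>l. (f i \<longlongrightarrow> l) G"
proof -
  obtain B where B: "\<And>i n. cmod (f i n) \<le> B i" using assms by metis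
  define g where "g n = (\<lambda>i. f i n)" for n
  define K where "K = PiE UNIV (\<lambda>i. cball (0::complex) (B i))"
  have "compactin (product_topology (\<lambda>i::'i. euclidean :: complex topology) UNIV) K"
    unfolding K_def compactin_PiE by (simp add: compactin_euclidean_iff)
  then have "compact K"
    by (simp add: euclidean_product_topology compactin_euclidean_iff)
  moreover have "filtermap g sequentially \<noteq> bot"
    by (simp add: filtermap_bot_iff)
  moreover have "eventually (\<lambda>x. x \<in> K) (filtermap g sequentially)"
    using B by (simp add: eventually_filtermap K_def g_def PiE_iff)
  ultimately obtain x where x: "inf (nhds x) (filtermap g sequentially) \<noteq> bot"
    unfolding compact_filter by metis
  \<comment> \<open>This filter sees those \<open>n\<close> whose value vector is close to the
    cluster point \<open>x\<close>; clustering keeps it nontrivial.\<close>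
  let ?G = "inf sequentially (filtercomap g (nhds x))"
  have "?G \<noteq> bot"
  proof
    assume "?G = bot"
    then have "eventually (\<lambda>_. False) ?G" by simp
    then obtain P R where P: "eventually P sequentially" and R: "eventually R (nhds x)"
      and PR: "\<And>n. P n \<Longrightarrow> R (g n) \<Longrightarrow> False"
      unfolding eventually_inf eventually_filtercomap by blast
    have "eventually (\<lambda>y. \<not> R y) (filtermap g sequentially)"
      unfolding eventually_filtermap using P by eventually_elim (use PR in blast)
    with R have "eventually (\<lambda>_. False) (inf (nhds x) (filtermap g sequentially))"
      unfolding eventually_inf by blast
    with x show False by (simp add: trivial_limit_def)
  qed
  moreover have "?G \<le> sequentially" by simp
  moreover have "(f i \<longlongrightarrow> x i) ?G" for i
  proof -
    have "filterlim g (nhds x) ?G"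
      by (rule filterlim_mono[OF filterlim_filtercomap order_refl]) simp
    then have "((\<lambda>n. g n i) \<longlongrightarrow> x i) ?G"
      by (rule continuous_on_tendsto_compose[OF continuous_on_product_coordinates[of i]]) simp_all
    then show ?thesis by (simp add: g_def)
  qed
  ultimately show ?thesis using that by blast
qed

declare plus_fun_apply [simp del] zero_fun_apply [simp del] times_fun_apply [simp del]
  one_fun_apply [simp del]

lemmas fun_algebra_apply =
  plus_fun_apply zero_fun_apply times_fun_apply one_fun_apply cmult_fun_def adj_fun_def

type_synonym op_seq = "nat \<Rightarrow> config adj_op"

text \<open>Rounding up makes membership of \<open>i\<close> in \<open>{grid n s..<grid n t}\<close>
  equivalent to n s <= i < n t. Adjacent intervals give adjacent blocks, so additivity is exact at
  every n.\<close>

definition grid :: "nat \<Rightarrow> real \<Rightarrow> nat" where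
  "grid n t = nat \<lceil>real n * t\<rceil>"

lemma grid_mono: "s \<le> t \<Longrightarrow> grid n s \<le> grid n t"
  unfolding grid_def by (intro nat_mono ceiling_mono mult_left_mono) auto

lemma grid_bounds:
  assumes "0 \<le> t"
  shows "real n * t \<le> real (grid n t)" "real (grid n t) \<le> real n * t + 1"
proof -
  have "0 \<le> real n * t" using assms by simp
  then have "0 \<le> \<lceil>real n * t\<rceil>" by linarith
  then have "real (grid n t) = of_int \<lceil>real n * t\<rceil>" by (simp add: grid_def)
  then show "real n * t \<le> real (grid n t)" "real (grid n t) \<le> real n * t + 1"
    by (simp_all add: ceiling_correct less_imp_le of_int_ceiling_le_add_one)
qed

lemma tendsto_grid:
  assumes "0 \<le> t"
  shows "(\<lambda>n. real (grid n t) / real n) \<longlonglongrightarrow> t"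
proof (rule tendsto_sandwich)
  have "\<forall>\<^sub>F n in sequentially. 0 < n" by (rule eventually_gt_at_top)
  then show "\<forall>\<^sub>F n in sequentially. t \<le> real (grid n t) / real n"
    by eventually_elim (use grid_bounds[OF assms] in \<open>simp add: field_simps\<close>)
  have "\<forall>\<^sub>F n in sequentially. 0 < n" by (rule eventually_gt_at_top)
  then show "\<forall>\<^sub>F n in sequentially. real (grid n t) / real n \<le> t + 1 / real n"
    by eventually_elim (use grid_bounds[OF assms] in \<open>simp add: field_simps\<close>)
  have "(\<lambda>n. t + 1 / real n) \<longlonglongrightarrow> t + 0"
    by (intro tendsto_intros lim_const_over_n)
  then show "(\<lambda>n. t + 1 / real n) \<longlonglongrightarrow> t" by simp
qed simp

lemma tendsto_grid_diff:
  assumes "0 \<le> s" "s \<le> t"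
  shows "(\<lambda>n. real (grid n t - grid n s) / real n) \<longlonglongrightarrow> t - s"
proof -
  have "(\<lambda>n. real (grid n t) / real n - real (grid n s) / real n) \<longlonglongrightarrow> t - s"
    using assms by (intro tendsto_diff tendsto_grid) auto
  then show ?thesis
    using grid_mono[OF assms(2)] by (simp add: of_nat_diff diff_divide_distrib)
qed

lemma scaled_grid_bound:
  assumes "0 \<le> T"
  shows "(1 / sqrt (real n)) ^ k * real (grid n T) ^ (k div 2) \<le> (T + 1) ^ (k div 2)"
\<comment> \<open>Here \<open>1 / sqrt 0\<close> is 0 by the convention on division, and
  \<open>grid 0 T\<close> is 0.\<close>
proof (cases "n = 0")
  case True
  then show ?thesis using assms by (cases k) (auto simp: grid_def)
next
  case False
  let ?h = "k div 2"
  \<comment> \<open>For odd \<open>k\<close> the surplus factor, at most 1, is dropped.\<close>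
  have "(1 / sqrt (real n)) ^ k \<le> (1 / sqrt (real n)) ^ (2 * ?h)"
    using False by (intro power_decreasing) auto
  also have "\<dots> = (1 / real n) ^ ?h"
    by (simp add: power_mult power_divide)
  finally have "(1 / sqrt (real n)) ^ k * real (grid n T) ^ ?h \<le> (1 / real n) ^ ?h * real (grid n T) ^ ?h"
    by (intro mult_right_mono) auto
  also have "\<dots> = (real (grid n T) / real n) ^ ?h"
    by (simp add: power_divide)
  also have "\<dots> \<le> (T + 1) ^ ?h"
  proof (intro power_mono)
    have "real (grid n T) \<le> real n * T + real n"
      using grid_bounds(2)[OF assms, of n] False by linarith
    then show "real (grid n T) / real n \<le> T + 1"
      using False by (simp add: field_simps)
  qed simp
  finally show ?thesis .
qed

lemma ordered_intervals:
  fixes s t :: "nat \<Rightarrow> real"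
  assumes "\<And>i. i < n \<Longrightarrow> s i \<le> t i" "\<And>i. Suc i < n \<Longrightarrow> t i \<le> s (Suc i)" "i < k" "k < n"
  shows "t i \<le> s k"
  using assms(3,4)
proof (induction k)
  case (Suc k)
  show ?case
  proof (cases "i = k")
    case True
    then show ?thesis using assms(2) Suc.prems by auto
  next
    case False
    then have "t i \<le> s k" using Suc by auto
    also have "s k \<le> t k" using assms(1) Suc.prems by auto
    also have "t k \<le> s (Suc k)" using assms(2) Suc.prems by auto
    finally show ?thesis .
  qed
qed simp

locale braided_process = braided_sites +
  fixes c :: complex and T :: real
  assumes drift_constraint: "q = 1 \<or> c = 0" and T_nonneg: "0 \<le> T"
begin

definition noise :: "real \<Rightarrow> real \<Rightarrow> letter \<Rightarrow> op_seq" where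
  "noise s t l = (\<lambda>n. complex_of_real (1 / sqrt (real n)) *\<^sub>C block {grid n s..<grid n t} l)"

definition drift :: "letter \<Rightarrow> complex" where
  "drift l = (case l of Lx \<Rightarrow> c | Lv \<Rightarrow> cnj c)"

text \<open>The drift uses the exact length \<open>t - s\<close> and not a number of sites; both
  parts are additive over adjacent intervals.\<close>

definition increment :: "real \<Rightarrow> real \<Rightarrow> letter \<Rightarrow> op_seq" where
  "increment s t l = noise s t l + (drift l * complex_of_real (t - s)) *\<^sub>C 1"

lemma increment_apply:
  "increment s t l n =
    incr (1 / sqrt (real n)) (\<lambda>l. drift l * complex_of_real (t - s)) {grid n s..<grid n t} l"
  by (simp add: increment_def noise_def incr_def fun_algebra_apply)

lemma drift_star: "drift (star_letter l) = cnj (drift l)"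
  by (cases l) (simp_all add: drift_def)

lemma adj_noise: "adj (noise s t l) = noise s t (star_letter l)"
  by (simp add: noise_def adj_fun_def)

lemma adj_increment: "adj (increment s t l) = increment s t (star_letter l)"
  by (simp add: increment_def adj_noise drift_star)

lemma increment_add:
  assumes "r \<le> s" "s \<le> t"
  shows "increment r t l = increment r s l + increment s t l"
proof -
  have "{grid n r..<grid n t} = {grid n r..<grid n s} \<union> {grid n s..<grid n t}" for n
    using grid_mono[OF assms(1), of n] grid_mono[OF assms(2), of n] by auto
  then have "block {grid n r..<grid n t} l = block {grid n r..<grid n s} l + block {grid n s..<grid n t} l" for n
    unfolding block_def by (subst sum.union_disjoint[symmetric]) auto
  then have "noise r t l = noise r s l + noise s t l"
    by (simp add: noise_def fun_eq_iff fun_algebra_apply cmult_add_right)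
  moreover have "(drift l * complex_of_real (t - r)) = drift l * complex_of_real (s - r) + drift l * complex_of_real (t - s)"
    by (simp add: algebra_simps)
  ultimately show ?thesis
    by (simp add: increment_def cmult_add_left)
qed

lemma increment_self: "increment t t l = 0"
  by (simp add: increment_def noise_def block_def fun_eq_iff fun_algebra_apply)

lemma grid_disjoint: "t \<le> s' \<Longrightarrow> i \<in> {grid n s..<grid n t} \<Longrightarrow> k \<in> {grid n s'..<grid n t'} \<Longrightarrow> i < k"
  using grid_mono[of t s' n] by auto

lemma increment_commute:
  assumes "t \<le> s'"
  shows "braid_commute q (increment s t) (increment s' t')"
proof -
  have "braid_commute q (\<lambda>l. increment s t l n) (\<lambda>l. increment s' t' l n)" for n
    unfolding increment_apply
    using drift_constraint grid_disjoint[OF assms]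
    by (intro braid_commute_incr) (auto simp: drift_def split: letter.splits)
  then show ?thesis
    by (auto simp: braid_commute_def fun_eq_iff fun_algebra_apply)
qed

section \<open>The algebra generated by the noise\<close>

definition noise_word :: "(real \<times> real \<times> letter) list \<Rightarrow> op_seq" where
  "noise_word zs = prod_list (map (\<lambda>(s, t, l). noise s t l) zs)"

text \<open>The empty word supplies the unit and with it the drift. The bound
  \<open>t \<le> T\<close> confines all blocks to the first \<open>grid n T\<close> sites, which
  makes the moments bounded in n.\<close>

definition Alg :: "op_seq set" where
  "Alg = {a. \<exists>xs. (\<forall>(d, zs)\<in>set xs. \<forall>(s, t, l)\<in>set zs. t \<le> T) \<and>
     a = (\<Sum>(d, zs)\<leftarrow>xs. d *\<^sub>C noise_word zs)}"

lemma Alg_zero: "0 \<in> Alg"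
  by (auto simp: Alg_def intro!: exI[of _ "[]"])

lemma Alg_step:
  assumes "a \<in> Alg" "\<And>s t l. (s, t, l) \<in> set zs \<Longrightarrow> t \<le> T"
  shows "d *\<^sub>C noise_word zs + a \<in> Alg"
proof -
  obtain xs where "\<forall>(d, zs)\<in>set xs. \<forall>(s, t, l)\<in>set zs. t \<le> T" "a = (\<Sum>(d, zs)\<leftarrow>xs. d *\<^sub>C noise_word zs)"
    using assms(1) unfolding Alg_def by blast
  then show ?thesis
    unfolding Alg_def mem_Collect_eq using assms(2) by (intro exI[of _ "(d, zs) # xs"]) auto
qed

lemma Alg_induct [consumes 1, case_names zero step]:
  assumes "a \<in> Alg" and zero: "P 0"
    and step: "\<And>a zs d. a \<in> Alg \<Longrightarrow> P a \<Longrightarrow> (\<And>s t l. (s, t, l) \<in> set zs \<Longrightarrow> t \<le> T) \<Longrightarrow>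
      P (d *\<^sub>C noise_word zs + a)"
  shows "P a"
proof -
  obtain xs where "\<forall>(d, zs)\<in>set xs. \<forall>(s, t, l)\<in>set zs. t \<le> T" and a: "a = (\<Sum>(d, zs)\<leftarrow>xs. d *\<^sub>C noise_word zs)"
    using assms(1) unfolding Alg_def by blast
  from this(1) have "(\<Sum>(d, zs)\<leftarrow>xs. d *\<^sub>C noise_word zs) \<in> Alg \<and> P (\<Sum>(d, zs)\<leftarrow>xs. d *\<^sub>C noise_word zs)"
  proof (induction xs)
    case Nil
    show ?case using zero Alg_zero by simp
  next
    case (Cons x xs)
    obtain d zs where x: "x = (d, zs)" by (cases x)
    have zs: "\<And>s t l. (s, t, l) \<in> set zs \<Longrightarrow> t \<le> T" using Cons.prems x by auto
    have IH: "(\<Sum>(d, zs)\<leftarrow>xs. d *\<^sub>C noise_word zs) \<in> Alg" "P (\<Sum>(d, zs)\<leftarrow>xs. d *\<^sub>C noise_word zs)"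
      using Cons by auto
    have "P (d *\<^sub>C noise_word zs + (\<Sum>(d, zs)\<leftarrow>xs. d *\<^sub>C noise_word zs))"
      using IH zs by (rule step)
    moreover have "d *\<^sub>C noise_word zs + (\<Sum>(d, zs)\<leftarrow>xs. d *\<^sub>C noise_word zs) \<in> Alg"
      using IH(1) zs by (rule Alg_step)
    ultimately show ?case by (simp add: x)
  qed
  then show ?thesis using a by simp
qed

lemma Alg_add: "a \<in> Alg \<Longrightarrow> b \<in> Alg \<Longrightarrow> a + b \<in> Alg"
  by (induction rule: Alg_induct) (simp_all add: add.assoc Alg_step)

lemma Alg_cmult: "a \<in> Alg \<Longrightarrow> e *\<^sub>C a \<in> Alg"
  by (induction rule: Alg_induct) (simp_all add: cmult_add_right Alg_zero Alg_step)

lemma Alg_word: "(\<And>s t l. (s, t, l) \<in> set zs \<Longrightarrow> t \<le> T) \<Longrightarrow> noise_word zs \<in> Alg"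
  using Alg_step[OF Alg_zero, of zs 1] by simp

lemma noise_word_append: "noise_word (zs @ ys) = noise_word zs * noise_word ys"
  by (simp add: noise_word_def)

lemma Alg_word_mult:
  assumes "\<And>s t l. (s, t, l) \<in> set zs \<Longrightarrow> t \<le> T"
  shows "b \<in> Alg \<Longrightarrow> noise_word zs * b \<in> Alg"
proof (induction rule: Alg_induct)
  case (step a ys d)
  have "noise_word (zs @ ys) \<in> Alg"
    using assms step by (intro Alg_word) auto
  then show ?case
    using step by (simp add: distrib_left Alg_add Alg_cmult flip: noise_word_append)
qed (simp add: Alg_zero)

lemma Alg_mult:
  assumes "b \<in> Alg"
  shows "a \<in> Alg \<Longrightarrow> a * b \<in> Alg"
proof (induction rule: Alg_induct)
  case (step a zs d)
  then show ?case
    using Alg_word_mult[OF step(2) assms] by (simp add: distrib_right Alg_add Alg_cmult)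
qed (simp add: Alg_zero)

lemma Alg_adj: "a \<in> Alg \<Longrightarrow> adj a \<in> Alg"
proof (induction rule: Alg_induct)
  case (step a zs d)
  have "adj (noise_word zs) = noise_word (rev (map (\<lambda>(s, t, l). (s, t, star_letter l)) zs))"
    unfolding noise_word_def adj_prod_list rev_map[symmetric] map_map
    by (intro arg_cong[where f = "\<lambda>xs. prod_list (rev xs)"] map_cong) (auto simp: adj_noise)
  moreover have "noise_word (rev (map (\<lambda>(s, t, l). (s, t, star_letter l)) zs)) \<in> Alg"
    using step(2) by (intro Alg_word) auto
  ultimately show ?case
    using step by (simp add: Alg_add Alg_cmult)
qed (simp add: Alg_zero)

lemma Alg_one: "1 \<in> Alg"
  using Alg_word[of "[]"] by (simp add: noise_word_def)

lemma Alg_noise: "t \<le> T \<Longrightarrow> noise s t l \<in> Alg"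
  using Alg_word[of "[(s, t, l)]"] by (simp add: noise_word_def)

lemma Alg_increment: "t \<le> T \<Longrightarrow> increment s t l \<in> Alg"
  by (simp add: increment_def Alg_add Alg_noise Alg_cmult Alg_one)

lemma Alg_prod_list: "(\<And>a. a \<in> set as \<Longrightarrow> a \<in> Alg) \<Longrightarrow> prod_list as \<in> Alg"
  by (induction as) (simp_all add: Alg_one Alg_mult)

lemma Alg_eval:
  assumes "\<And>l. Y l \<in> Alg"
  shows "eval Y p \<in> Alg"
  using assms by (induction p rule: free_induct)
    (auto simp: eval_single eval_add intro!: Alg_cmult Alg_add Alg_prod_list)

text \<open>A noise word of length k carries the factor n^(-k/2), while at most a constant times
  n^(k div 2) tuples of sites contribute to its vacuum moment.\<close>

lemma Alg_bounded: "a \<in> Alg \<Longrightarrow> \<exists>B. \<forall>n. cmod (vec_state 0 (a n)) \<le> B"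
proof (induction rule: Alg_induct)
  case zero
  show ?case by (intro exI[of _ 0]) (simp add: fun_algebra_apply)
next
  case (step a zs d)
  obtain B where B: "\<And>n. cmod (vec_state 0 (a n)) \<le> B" using step by blast
  let ?k = "length zs"
  define bs where "bs n = map (\<lambda>(s, t, l). ({grid n s..<grid n t}, l)) zs" for n
  have word: "noise_word zs n = complex_of_real (1 / sqrt (real n)) ^ ?k *\<^sub>C prod_list (map (case_prod block) (bs n))" for n
    unfolding noise_word_def bs_def prod_list_fun
    by (induction zs) (auto simp: noise_def mult.commute)
  let ?C = "(T + 1) ^ (?k div 2) * (real (?k div 2) ^ ?k * word_bound ?k)"
  have bound: "cmod (vec_state 0 (noise_word zs n)) \<le> ?C" for n
  proof -
    have "cmod (vec_state 0 (prod_list (map (case_prod block) (bs n)))) \<le>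
        real (grid n T) ^ (?k div 2) * real (?k div 2) ^ ?k * word_bound ?k"
    proof -
      have "I \<subseteq> {..<grid n T}" if "(I, l) \<in> set (bs n)" for I l
      proof -
        obtain s t where "(s, t, l) \<in> set zs" and I: "I = {grid n s..<grid n t}"
          using \<open>(I, l) \<in> set (bs n)\<close> by (auto simp: bs_def)
        then have "grid n t \<le> grid n T" using step by (intro grid_mono)
        then show ?thesis using I by auto
      qed
      from norm_vec_state_blocks[OF this, of "bs n"] show ?thesis by (simp add: bs_def)
    qed
    then have "cmod (vec_state 0 (noise_word zs n)) \<le> (1 / sqrt (real n)) ^ ?k *
        (real (grid n T) ^ (?k div 2) * real (?k div 2) ^ ?k * word_bound ?k)"
      by (simp add: word norm_mult norm_power mult_left_mono norm_divide)
    also have "\<dots> = ((1 / sqrt (real n)) ^ ?k * real (grid n T) ^ (?k div 2)) * (real (?k div 2) ^ ?k * word_bound ?k)"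
      by (simp add: ac_simps)
    also have "\<dots> \<le> ?C"
      by (intro mult_right_mono scaled_grid_bound T_nonneg mult_nonneg_nonneg word_bound_nonneg) auto
    finally show ?thesis .
  qed
  have "cmod (vec_state 0 ((d *\<^sub>C noise_word zs + a) n)) \<le> cmod d * ?C + B" for n
  proof -
    have "cmod (vec_state 0 ((d *\<^sub>C noise_word zs + a) n)) \<le> cmod d * cmod (vec_state 0 (noise_word zs n)) + cmod (vec_state 0 (a n))"
      using norm_triangle_ineq[of "d * vec_state 0 (noise_word zs n)" "vec_state 0 (a n)"]
      by (simp add: fun_algebra_apply norm_mult)
    also have "\<dots> \<le> cmod d * ?C + B"
      by (intro add_mono mult_left_mono bound B) auto
    finally show ?thesis .
  qed
  then show ?case by blast
qed

section \<open>The limit state\<close>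

definition lim_filter :: "nat filter" where
  "lim_filter = (SOME G. G \<noteq> bot \<and> G \<le> sequentially \<and>
     (\<forall>a\<in>Alg. \<exists>l. ((\<lambda>n. vec_state 0 (a n)) \<longlongrightarrow> l) G))"

text \<open>One filter is fixed for the whole algebra, since linearity of the state needs
  simultaneous limits.\<close>

lemma lim_filter: "lim_filter \<noteq> bot" "lim_filter \<le> sequentially"
    "a \<in> Alg \<Longrightarrow> \<exists>l. ((\<lambda>n. vec_state 0 (a n)) \<longlongrightarrow> l) lim_filter"
proof -
  \<comment> \<open>\<open>pointwise_limit_filter\<close> is indexed by a whole type, so the family
    is extended by 0 outside \<open>Alg\<close>.\<close>
  have "\<exists>B. \<forall>n. cmod (if a \<in> Alg then vec_state 0 (a n) else 0) \<le> B" for a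
    using Alg_bounded[of a] by (cases "a \<in> Alg") auto
  from pointwise_limit_filter[OF this] obtain G where "G \<noteq> bot" "G \<le> sequentially"
    and G: "\<And>a. \<exists>l. ((\<lambda>n. if a \<in> Alg then vec_state 0 (a n) else 0) \<longlongrightarrow> l) G"
    by metis
  moreover have "\<forall>a\<in>Alg. \<exists>l. ((\<lambda>n. vec_state 0 (a n)) \<longlongrightarrow> l) G"
  proof
    fix a assume "a \<in> Alg"
    then show "\<exists>l. ((\<lambda>n. vec_state 0 (a n)) \<longlongrightarrow> l) G" using G[of a] by simp
  qed
  ultimately have "\<exists>G. G \<noteq> bot \<and> G \<le> sequentially \<and> (\<forall>a\<in>Alg. \<exists>l. ((\<lambda>n. vec_state 0 (a n)) \<longlongrightarrow> l) G)"
    by blast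
  from someI_ex[OF this] show "lim_filter \<noteq> bot" "lim_filter \<le> sequentially"
    "a \<in> Alg \<Longrightarrow> \<exists>l. ((\<lambda>n. vec_state 0 (a n)) \<longlongrightarrow> l) lim_filter"
    unfolding lim_filter_def by blast+
qed

definition lim_state :: "op_seq \<Rightarrow> complex" where
  "lim_state a = Lim lim_filter (\<lambda>n. vec_state 0 (a n))"

lemma lim_state_eqI: "((\<lambda>n. vec_state 0 (a n)) \<longlongrightarrow> l) lim_filter \<Longrightarrow> lim_state a = l"
  unfolding lim_state_def by (intro tendsto_Lim lim_filter)

text \<open>The filter refines \<open>sequentially\<close>, so an ordinary limit is unaffected by
  the choice. The marginal laws are computed this way.\<close>

lemma lim_state_sequentially: "(\<lambda>n. vec_state 0 (a n)) \<longlonglongrightarrow> l \<Longrightarrow> lim_state a = l"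
  by (rule lim_state_eqI, rule tendsto_mono[OF lim_filter(2)])

lemma tendsto_lim_state: "a \<in> Alg \<Longrightarrow> ((\<lambda>n. vec_state 0 (a n)) \<longlongrightarrow> lim_state a) lim_filter"
  using lim_filter(3) lim_state_eqI by metis

lemma lim_state_add: "a \<in> Alg \<Longrightarrow> b \<in> Alg \<Longrightarrow> lim_state (a + b) = lim_state a + lim_state b"
  by (rule lim_state_eqI) (simp add: fun_algebra_apply tendsto_add tendsto_lim_state)

lemma lim_state_cmult: "a \<in> Alg \<Longrightarrow> lim_state (d *\<^sub>C a) = d * lim_state a"
  by (rule lim_state_eqI) (simp add: fun_algebra_apply tendsto_mult_left tendsto_lim_state)

lemma lim_state_one: "lim_state 1 = 1"
  by (rule lim_state_eqI) (simp add: fun_algebra_apply)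

lemma lim_state_nonneg:
  assumes "a \<in> Alg"
  shows "lim_state (adj a * a) \<in> \<real>\<^sub>\<ge>\<^sub>0"
proof (rule Lim_in_closed_set[OF closed_nonneg_Reals_complex _ lim_filter(1)])
  show "((\<lambda>n. vec_state 0 ((adj a * a) n)) \<longlongrightarrow> lim_state (adj a * a)) lim_filter"
    using assms by (intro tendsto_lim_state Alg_mult Alg_adj)
  show "\<forall>\<^sub>F n in lim_filter. vec_state 0 ((adj a * a) n) \<in> \<real>\<^sub>\<ge>\<^sub>0"
    by (simp add: fun_algebra_apply vec_state_nonneg)
qed

lemma eval_apply: "eval Y p n = eval (\<lambda>l. Y l n) p"
  by (simp add: eval_def pext_fun prod_list_fun o_def)

lemma tendsto_prod_list:
  fixes f :: "'b \<Rightarrow> 'c \<Rightarrow> complex"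
  assumes "\<And>x. x \<in> set xs \<Longrightarrow> (f x \<longlongrightarrow> g x) F"
  shows "((\<lambda>n. prod_list (map (\<lambda>x. f x n) xs)) \<longlongrightarrow> prod_list (map g xs)) F"
  using assms by (induction xs) (auto intro!: tendsto_intros)

text \<open>Factorisation is exact at every level by \<open>factor_incr\<close>; the limit only has
  to pass through a finite product.\<close>

lemma lim_state_factor:
  fixes m :: nat
  assumes st: "\<And>i. i < m \<Longrightarrow> s i \<le> t i \<and> t i \<le> T" and order: "\<And>i. Suc i < m \<Longrightarrow> t i \<le> s (Suc i)"
    and ys: "distinct (map fst ys)" "\<And>i. i \<in> fst ` set ys \<Longrightarrow> i < m"
  shows "lim_state (prod_list (map (\<lambda>(k, p). eval (increment (s k) (t k)) p) ys)) =
    prod_list (map (\<lambda>(k, p). lim_state (eval (increment (s k) (t k)) p)) ys)"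
proof (rule lim_state_eqI)
  have later: "t i \<le> s k" if "i < k" "k < m" for i k
    by (rule ordered_intervals[of m s t]) (use st order that in auto)
  have "vec_state 0 (prod_list (map (\<lambda>(k, p). eval (increment (s k) (t k)) p) ys) n) =
      prod_list (map (\<lambda>y. vec_state 0 (eval (increment (s (fst y)) (t (fst y))) (snd y) n)) ys)" for n
  proof -
    define Y where "Y k = incr (1 / sqrt (real n)) (\<lambda>l. drift l * complex_of_real (t k - s k))
      {grid n (s k)..<grid n (t k)}" for k
    have Y: "eval (increment (s k) (t k)) p n = eval (Y k) p" for k p
      unfolding eval_apply increment_apply Y_def ..
    have "\<forall>a\<in>{grid n (s i)..<grid n (t i)}. \<forall>b\<in>{grid n (s k)..<grid n (t k)}. a < b"
      if "i < k" "k < m" for i k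
      using grid_disjoint[OF later[OF that]] by blast
    moreover have "q = 1 \<or> (\<forall>i l. drift l * complex_of_real (t i - s i) = 0)"
      using drift_constraint by (auto simp: drift_def split: letter.splits)
    ultimately have "vec_state 0 (prod_list (map (\<lambda>(k, p). eval (Y k) p) ys)) =
        prod_list (map (\<lambda>(k, p). vec_state 0 (eval (Y k) p)) ys)"
      unfolding Y_def using ys by (intro factor_incr[of m])
    then show ?thesis
      by (simp add: prod_list_fun Y o_def case_prod_unfold)
  qed
  moreover have "((\<lambda>n. prod_list (map (\<lambda>y. vec_state 0 (eval (increment (s (fst y)) (t (fst y))) (snd y) n)) ys)) \<longlongrightarrow>
      prod_list (map (\<lambda>y. lim_state (eval (increment (s (fst y)) (t (fst y))) (snd y))) ys)) lim_filter"
    using st ys(2) by (intro tendsto_prod_list tendsto_lim_state Alg_eval Alg_increment) auto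
  ultimately show "((\<lambda>n. vec_state 0 (prod_list (map (\<lambda>(k, p). eval (increment (s k) (t k)) p) ys) n)) \<longlongrightarrow>
    prod_list (map (\<lambda>(k, p). lim_state (eval (increment (s k) (t k)) p)) ys)) lim_filter"
    by (simp add: case_prod_unfold)
qed

end

context braided_process
begin

section \<open>Limiting moments of a single increment\<close>

lemma vec_state_noise_word:
  "vec_state 0 (word_eval (noise s t) ls n) = complex_of_real (1 / sqrt (real n)) ^ length ls *
     vec_state 0 (word_eval (block {grid n s..<grid n t}) ls)"
proof -
  have "word_eval (noise s t) ls n = complex_of_real (1 / sqrt (real n)) ^ length ls *\<^sub>C
      word_eval (block {grid n s..<grid n t}) ls"
    unfolding prod_list_fun
    by (induction ls) (simp_all add: noise_def mult.commute)
  then show ?thesis by simp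
qed

text \<open>The constant is quantified before \<open>s\<close> and \<open>t\<close>, so that the
  limit is a function of \<open>t - s\<close>.\<close>

lemma noise_mean_exists:
  "\<exists>C. \<forall>s t. 0 \<le> s \<longrightarrow> s \<le> t \<longrightarrow> (\<lambda>n. vec_state 0 (word_eval (noise s t) ls n)) \<longlonglongrightarrow>
    (if even (length ls) then C * of_real (t - s) ^ (length ls div 2) else 0)"
proof -
  obtain C where C: "\<And>a m \<tau>. (\<lambda>n. real (m n) / real n) \<longlonglongrightarrow> \<tau> \<Longrightarrow>
    (\<lambda>n. of_real (1 / sqrt (real n)) ^ length ls * vec_state 0 (word_eval (block {a n..<a n + m n}) ls))
      \<longlonglongrightarrow> (if even (length ls) then C * of_real \<tau> ^ (length ls div 2) else 0)"
    using scaled_block_moment[of ls] by blast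
  have "(\<lambda>n. vec_state 0 (word_eval (noise s t) ls n)) \<longlonglongrightarrow>
    (if even (length ls) then C * of_real (t - s) ^ (length ls div 2) else 0)" if "0 \<le> s" "s \<le> t" for s t
    using C[OF tendsto_grid_diff[OF that], of "\<lambda>n. grid n s"] grid_mono[OF that(2)]
    by (simp add: vec_state_noise_word)
  then show ?thesis by blast
qed

definition mean_coeff :: "letter list \<Rightarrow> complex" where
  "mean_coeff ls = (SOME C. \<forall>s t. 0 \<le> s \<longrightarrow> s \<le> t \<longrightarrow> (\<lambda>n. vec_state 0 (word_eval (noise s t) ls n)) \<longlonglongrightarrow>
    (if even (length ls) then C * of_real (t - s) ^ (length ls div 2) else 0))"

lemma mean_coeff:
  assumes "0 \<le> s" "s \<le> t"
  shows "(\<lambda>n. vec_state 0 (word_eval (noise s t) ls n)) \<longlonglongrightarrow>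
    (if even (length ls) then mean_coeff ls * of_real (t - s) ^ (length ls div 2) else 0)"
  using someI_ex[OF noise_mean_exists[of ls], folded mean_coeff_def] assms by blast

text \<open>Length 2 is separated because it gives the derivative at 0, so its constant must be
  explicit. For longer even words the unspecified \<open>mean_coeff\<close> comes with a power of
  \<tau> of at least 2.\<close>

definition noise_mean :: "letter list \<Rightarrow> real \<Rightarrow> complex" where
  "noise_mean ls \<tau> =
    (if ls = [] then 1
     else if length ls = 2 then of_real \<tau> * site_vec ls 0
     else if even (length ls) then mean_coeff ls * of_real \<tau> ^ (length ls div 2) else 0)"

lemma tendsto_noise_mean:
  assumes "0 \<le> s" "s \<le> t"
  shows "(\<lambda>n. vec_state 0 (word_eval (noise s t) ls n)) \<longlonglongrightarrow> noise_mean ls (t - s)"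
proof -
  consider "ls = []" | l l' where "ls = [l, l']" | "ls \<noteq> []" "length ls \<noteq> 2"
    by (cases ls; cases "tl ls"; cases "tl (tl ls)") auto
  then show ?thesis
  proof cases
    case 1
    then show ?thesis by (simp add: noise_mean_def fun_algebra_apply)
  next
    case 2
    have "vec_state 0 (word_eval (noise s t) ls n) =
        complex_of_real (real (grid n t - grid n s) / real n) * site_vec ls 0" for n
      unfolding vec_state_noise_word 2
      by (simp add: vec_state_block_pair power2_eq_square[symmetric] power_divide
          del: site_vec.simps flip: of_real_power)
    moreover have "(\<lambda>n. complex_of_real (real (grid n t - grid n s) / real n) * site_vec ls 0) \<longlonglongrightarrow>
        complex_of_real (t - s) * site_vec ls 0"
      using assms by (intro tendsto_intros tendsto_grid_diff)
    ultimately show ?thesis by (simp add: noise_mean_def 2 del: site_vec.simps)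
  next
    case 3
    then show ?thesis
      using mean_coeff[OF assms, of ls] by (simp add: noise_mean_def)
  qed
qed

text \<open>Each letter of an increment is noise plus drift; the letters resolved as noise collect
  in \<open>us\<close>.\<close>

fun incr_mean :: "letter list \<Rightarrow> letter list \<Rightarrow> real \<Rightarrow> complex" where
  "incr_mean us [] \<tau> = noise_mean us \<tau>"
| "incr_mean us (l # ls) \<tau> = incr_mean (us @ [l]) ls \<tau> + drift l * of_real \<tau> * incr_mean us ls \<tau>"

lemma tendsto_incr_mean:
  assumes "0 \<le> s" "s \<le> t"
  shows "(\<lambda>n. vec_state 0 ((word_eval (noise s t) us * word_eval (increment s t) ls) n)) \<longlonglongrightarrow> incr_mean us ls (t - s)"
proof (induction ls arbitrary: us)
  case Nil
  show ?case using tendsto_noise_mean[OF assms] by simp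
next
  case (Cons l ls)
  have "word_eval (noise s t) us * word_eval (increment s t) (l # ls) =
      word_eval (noise s t) (us @ [l]) * word_eval (increment s t) ls +
      (drift l * complex_of_real (t - s)) *\<^sub>C (word_eval (noise s t) us * word_eval (increment s t) ls)"
    by (simp add: increment_def distrib_left distrib_right mult.assoc)
  then have "vec_state 0 ((word_eval (noise s t) us * word_eval (increment s t) (l # ls)) n) =
      vec_state 0 ((word_eval (noise s t) (us @ [l]) * word_eval (increment s t) ls) n) +
      (drift l * complex_of_real (t - s)) * vec_state 0 ((word_eval (noise s t) us * word_eval (increment s t) ls) n)" for n
    by (simp add: plus_fun_apply cmult_fun_def)
  then show ?case
    using Cons by (simp only: incr_mean.simps) (intro tendsto_intros)
qed

definition mean :: "free_alg \<Rightarrow> real \<Rightarrow> complex" where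
  "mean p \<tau> = (\<Sum>w\<in>Poly_Mapping.keys p. Poly_Mapping.lookup p w * incr_mean [] (letters w) \<tau>)"

lemma lim_state_increment:
  assumes "0 \<le> s" "s \<le> t"
  shows "lim_state (eval (increment s t) p) = mean p (t - s)"
proof (rule lim_state_sequentially)
  have "vec_state 0 (eval (increment s t) p n) =
      (\<Sum>w\<in>Poly_Mapping.keys p. Poly_Mapping.lookup p w * vec_state 0 (word_eval (increment s t) (letters w) n))" for n
    unfolding eval_def pext_fun vec_state_pext ..
  moreover have "(\<lambda>n. \<Sum>w\<in>Poly_Mapping.keys p. Poly_Mapping.lookup p w * vec_state 0 (word_eval (increment s t) (letters w) n))
      \<longlonglongrightarrow> mean p (t - s)"
    unfolding mean_def using tendsto_incr_mean[OF assms, of "[]"] by (intro tendsto_intros) simp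
  ultimately show "(\<lambda>n. vec_state 0 (eval (increment s t) p n)) \<longlonglongrightarrow> mean p (t - s)"
    by simp
qed

lemma incr_mean_0: "incr_mean us ls 0 = (if us @ ls = [] then 1 else 0)"
  by (induction ls arbitrary: us) (auto simp: noise_mean_def)

lemma mean_0: "mean p 0 = counit p"
proof -
  have "mean p 0 = (\<Sum>w\<in>Poly_Mapping.keys p. if w = 0 then Poly_Mapping.lookup p w else 0)"
    unfolding mean_def by (intro sum.cong) (auto simp: incr_mean_0 zero_word_def word.expand)
  then show ?thesis by (simp add: counit_def in_keys_iff)
qed

definition gen_word :: "letter list \<Rightarrow> complex" where
  "gen_word ls = (if length ls = 2 then site_vec ls 0 else if length ls = 1 then drift (hd ls) else 0)"

lemma noise_mean_deriv:
  "(noise_mean ls has_vector_derivative (if length ls = 2 then site_vec ls 0 else 0)) (at 0)"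
proof -
  have pow: "((\<lambda>\<tau>. a * complex_of_real \<tau> ^ k) has_vector_derivative a * (of_nat k * 0 ^ (k - 1))) (at 0)" for a k
    by (rule has_vector_derivative_real_field) (auto intro!: derivative_eq_intros)
  consider "ls = []" | "length ls = 2" | "ls \<noteq> []" "length ls \<noteq> 2" "even (length ls)" | "odd (length ls)"
    by (cases ls) auto
  then show ?thesis
  proof cases
    case 1
    then have "noise_mean ls = (\<lambda>_. 1)" by (simp add: noise_mean_def fun_eq_iff)
    then show ?thesis using 1 by simp
  next
    case 2
    then have "noise_mean ls = (\<lambda>\<tau>. site_vec ls 0 * complex_of_real \<tau> ^ 1)"
      by (auto simp: noise_mean_def fun_eq_iff)
    then show ?thesis using pow[of "site_vec ls 0" 1] 2 by simp
  next
    case 3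
    then have "noise_mean ls = (\<lambda>\<tau>. mean_coeff ls * complex_of_real \<tau> ^ (length ls div 2))"
      by (auto simp: noise_mean_def fun_eq_iff)
    \<comment> \<open>The exponent is at least 2, so the derivative at 0 vanishes.\<close>
    moreover have "length ls div 2 - 1 \<noteq> 0"
      using 3 by (cases ls; cases "tl ls"; cases "tl (tl ls)"; cases "tl (tl (tl ls))") auto
    ultimately show ?thesis
      using pow[of "mean_coeff ls" "length ls div 2"] 3 by (simp add: power_0_left)
  next
    case 4
    then have "noise_mean ls = (\<lambda>_. 0)" by (auto simp: noise_mean_def fun_eq_iff)
    then show ?thesis using 4 by auto
  qed
qed

text \<open>In the product rule the drift term contributes \<open>drift l\<close> times the
  remaining mean at 0, which is 1 only if no other letter is left.\<close>

lemma incr_mean_deriv: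
  "(incr_mean us ls has_vector_derivative
     (if length (us @ ls) = 2 then site_vec (us @ ls) 0 else 0) +
     (if us = [] \<and> length ls = 1 then drift (hd ls) else 0)) (at 0)"
proof (induction ls arbitrary: us)
  case Nil
  show ?case using noise_mean_deriv[of us] by (simp add: incr_mean.simps[abs_def] del: site_vec.simps split: if_splits)
next
  case (Cons l ls)
  let ?D = "\<lambda>us ls. (if length (us @ ls) = 2 then site_vec (us @ ls) 0 else 0) +
     (if us = [] \<and> length ls = 1 then drift (hd ls) else 0)"
  have id: "((\<lambda>\<tau>. drift l * complex_of_real \<tau>) has_vector_derivative drift l) (at 0)"
    by (rule has_vector_derivative_real_field) (auto intro!: derivative_eq_intros)
  have "((\<lambda>\<tau>. incr_mean (us @ [l]) ls \<tau> + drift l * of_real \<tau> * incr_mean us ls \<tau>) has_vector_derivative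
      ?D (us @ [l]) ls + (drift l * of_real 0 * ?D us ls + drift l * incr_mean us ls 0)) (at 0)"
    by (intro has_vector_derivative_add Cons has_vector_derivative_mult id)
  moreover have "?D (us @ [l]) ls + (drift l * of_real 0 * ?D us ls + drift l * incr_mean us ls 0) = ?D us (l # ls)"
    by (simp add: incr_mean_0 del: site_vec.simps)
  moreover have "incr_mean us (l # ls) = (\<lambda>\<tau>. incr_mean (us @ [l]) ls \<tau> + drift l * of_real \<tau> * incr_mean us ls \<tau>)"
    by (simp add: fun_eq_iff)
  ultimately show ?case by (simp del: site_vec.simps)
qed

lemma mean_deriv:
  "(mean p has_vector_derivative (\<Sum>w\<in>Poly_Mapping.keys p. Poly_Mapping.lookup p w * gen_word (letters w))) (at 0)"
proof -
  have "(incr_mean [] ls has_vector_derivative gen_word ls) (at 0)" for ls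
    using incr_mean_deriv[of "[]" ls] by (auto simp: gen_word_def split: if_splits)
  then show ?thesis
    unfolding mean_def[abs_def]
    by (intro has_vector_derivative_sum has_vector_derivative_mult_right)
qed

lemma tendsto_mean: "(mean p \<longlongrightarrow> counit p) (at 0)"
  using has_vector_derivative_continuous[OF mean_deriv[of p]] by (simp add: continuous_within mean_0)

end

section \<open>Realisation inside a type of continuum cardinality\<close>

text \<open>A copy of the subalgebra \<open>C\<close> inside a type of which only the cardinality is
  known.\<close>

definition transport :: "('b::complex_star_algebra \<Rightarrow> 'a) \<Rightarrow> 'b set \<Rightarrow> 'a star_algebra" where
  "transport g C = \<lparr>carrier = g ` C, mult = \<lambda>x y. g (the_inv g x * the_inv g y), one = g 1, zero = g 0,
     add = \<lambda>x y. g (the_inv g x + the_inv g y), smult = \<lambda>c x. g (c *\<^sub>C the_inv g x),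
     star = \<lambda>x. g (adj (the_inv g x))\<rparr>"

locale transported_algebra =
  fixes g :: "'b::complex_star_algebra \<Rightarrow> 'a" and C :: "'b set"
  assumes inj_g: "inj g"
    and C_zero: "0 \<in> C" and C_one: "1 \<in> C"
    and C_add: "\<And>a b. a \<in> C \<Longrightarrow> b \<in> C \<Longrightarrow> a + b \<in> C"
    and C_mult: "\<And>a b. a \<in> C \<Longrightarrow> b \<in> C \<Longrightarrow> a * b \<in> C"
    and C_cmult: "\<And>c a. a \<in> C \<Longrightarrow> c *\<^sub>C a \<in> C"
    and C_adj: "\<And>a. a \<in> C \<Longrightarrow> adj a \<in> C"
begin

abbreviation A :: "'a star_algebra" where "A \<equiv> transport g C"

lemma inv_g [simp]: "the_inv g (g a) = a"
  using inj_g by (rule the_inv_f_f)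

lemma transport_simps [simp]:
  "carrier A = g ` C" "x \<otimes>\<^bsub>A\<^esub> y = g (the_inv g x * the_inv g y)" "\<one>\<^bsub>A\<^esub> = g 1" "\<zero>\<^bsub>A\<^esub> = g 0"
  "x \<oplus>\<^bsub>A\<^esub> y = g (the_inv g x + the_inv g y)" "c \<odot>\<^bsub>A\<^esub> x = g (c *\<^sub>C the_inv g x)" "star A x = g (adj (the_inv g x))"
  by (simp_all add: transport_def)

lemma unital_star_algebra_transport: "unital_star_algebra A"
proof -
  have ag: "abelian_group A"
  proof (rule abelian_groupI)
    fix x assume "x \<in> carrier A"
    then obtain a where a: "a \<in> C" "x = g a" by auto
    \<comment> \<open>Closure of \<open>C\<close> under negation comes from closure under
      scalars.\<close>
    have "(- 1) *\<^sub>C a + a = 0"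
      using cmult_add_left[of "- 1" 1 a] by simp
    then show "\<exists>y\<in>carrier A. y \<oplus>\<^bsub>A\<^esub> x = \<zero>\<^bsub>A\<^esub>"
      using a C_cmult[of a "- 1"] by (intro bexI[of _ "g ((- 1) *\<^sub>C a)"]) auto
  qed (auto simp: C_zero C_add ac_simps)
  have mon: "monoid A"
    by (rule monoidI) (auto simp: C_one C_mult mult.assoc)
  have r: "ring A"
    by (rule ringI[OF ag mon]) (auto simp: distrib_left distrib_right)
  have m: "Module.module complex_ring A"
    by (rule moduleI[OF cring_complex_ring ag])
       (auto simp: complex_ring_def C_cmult cmult_add_left cmult_add_right)
  show ?thesis
    by (intro unital_star_algebra.intro r m unital_star_algebra_axioms.intro) (auto simp: C_adj)
qed

lemma finsum_transport:
  assumes "finite S" "\<And>k. k \<in> S \<Longrightarrow> f k \<in> C"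
  shows "(\<Oplus>\<^bsub>A\<^esub>k\<in>S. g (f k)) = g (\<Sum>k\<in>S. f k)"
proof -
  interpret unital_star_algebra A by (rule unital_star_algebra_transport)
  from assms show ?thesis
  proof (induction S)
    case (insert k S)
    then show ?case by (simp add: Pi_iff)
  qed simp
qed

lemma mult_tensor_transport:
  assumes "\<And>l. X l \<in> C" "\<And>l. Y l \<in> C"
  shows "mult_tensor A (g \<circ> eval X) (g \<circ> eval Y) z = g (tensor_eval X Y z)"
proof -
  have "word_eval Z ls \<in> C" if "\<And>l. Z l \<in> C" for Z ls
    using that by (induction ls) (simp_all add: C_one C_mult)
  then have "mult_tensor A (g \<circ> eval X) (g \<circ> eval Y) z = g (\<Sum>k\<in>Poly_Mapping.keys z.
      Poly_Mapping.lookup z k *\<^sub>C (word_eval X (letters (fst k)) * word_eval Y (letters (snd k))))"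
    unfolding mult_tensor_def using assms
    by (subst finsum_transport[symmetric]) (simp_all add: eval_single C_cmult C_mult)
  then show ?thesis
    by (simp add: tensor_eval_def pext_def case_prod_unfold)
qed

lemma ordered_prod_transport:
  "ordered_prod A n (\<lambda>i. g (f i)) = g (prod_list (map f [0..<n]))"
proof -
  have "foldr (mult A) (map (\<lambda>i. g (f i)) is) \<one>\<^bsub>A\<^esub> = g (prod_list (map f is))" for "is"
    by (induction "is") simp_all
  then show ?thesis by (simp add: ordered_prod_def)
qed

lemma star_hom_transport:
  assumes "\<And>p. eval X p \<in> C" "\<And>l. adj (X l) = X (star_letter l)"
  shows "g \<circ> eval X \<in> star_hom V_alg A"
  unfolding star_hom_def ring_hom_def using assms
  by (auto simp: V_alg_def eval_mult eval_add eval_one eval_cscale eval_free_star)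

lemma quantum_prob_space_transport:
  assumes "\<And>a b. a \<in> C \<Longrightarrow> b \<in> C \<Longrightarrow> \<omega> (a + b) = \<omega> a + \<omega> b"
    and "\<And>c a. a \<in> C \<Longrightarrow> \<omega> (c *\<^sub>C a) = c * \<omega> a"
    and "\<omega> 1 = 1" "\<And>a. a \<in> C \<Longrightarrow> \<omega> (adj a * a) \<in> \<real>\<^sub>\<ge>\<^sub>0"
  shows "quantum_prob_space A (\<omega> \<circ> the_inv g)"
  unfolding quantum_prob_space_def is_state_def linear_functional_def
  using assms unital_star_algebra_transport by auto

end

lemma inj_config_nat: "\<exists>h :: config \<Rightarrow> nat. inj h"
proof -
  let ?graph = "\<lambda>\<kappa>::config. (\<lambda>i. (i, Poly_Mapping.lookup \<kappa> i)) ` Poly_Mapping.keys \<kappa>"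
  have "inj ?graph"
  proof (rule injI, rule poly_mapping_eqI)
    fix \<kappa> \<mu> :: config and i
    assume eq: "?graph \<kappa> = ?graph \<mu>"
    have *: "(i, m) \<in> ?graph \<nu> \<longleftrightarrow> m = Poly_Mapping.lookup \<nu> i \<and> m \<noteq> 0" for \<nu> :: config and m
      by (auto simp: in_keys_iff)
    show "Poly_Mapping.lookup \<kappa> i = Poly_Mapping.lookup \<mu> i"
      using *[of _ \<kappa>] *[of _ \<mu>] unfolding eq by metis
  qed
  moreover have "countable (range ?graph)"
    by (rule countable_subset[OF _ countable_Collect_finite]) auto
  ultimately have "countable (UNIV :: config set)"
    using countable_image_inj_on by blast
  then show ?thesis by (auto simp: countable_def)
qed

text \<open>A sequence of operators is determined by its countably many matrix entries in the
  configuration basis, and a real number can be coded by a set of naturals.\<close>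

lemma op_seq_lepoll_reals: "(UNIV :: op_seq set) \<lesssim> (UNIV :: real set)"
proof -
  obtain cn :: "config \<Rightarrow> nat" where cn: "inj cn" using inj_config_nat by blast
  obtain h :: "real \<Rightarrow> nat set" where h: "inj h"
    using eqpoll_imp_lepoll[OF eqpoll_sym[OF nat_sets_eqpoll_reals]] unfolding lepoll_def by blast
  let ?z = "\<lambda>(a :: op_seq) n k k'. Poly_Mapping.lookup (app (a n) (basis k)) k'"
  \<comment> \<open>The Boolean component tells the real part from the imaginary part.\<close>
  define S where "S a = {(n, cn k, cn k', b, m) | n k k' b m.
    m \<in> (if b then h (Re (?z a n k k')) else h (Im (?z a n k k')))}" for a
  have "inj S"
  proof (rule injI)
    fix a b assume eq: "S a = S b"
    have mem: "(n, cn k, cn k', t, m) \<in> S a \<longleftrightarrow> m \<in> (if t then h (Re (?z a n k k')) else h (Im (?z a n k k')))"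
      for a n k k' t m
      using cn by (auto simp: S_def inj_eq)
    have "?z a n k k' = ?z b n k k'" for n k k'
    proof (rule complex_eqI)
      have "h (Re (?z a n k k')) = h (Re (?z b n k k'))"
        using mem[of n k k' True _ a] mem[of n k k' True _ b] eq by auto
      then show "Re (?z a n k k') = Re (?z b n k k')" using h by (simp add: inj_eq)
      have "h (Im (?z a n k k')) = h (Im (?z b n k k'))"
        using mem[of n k k' False _ a] mem[of n k k' False _ b] eq by auto
      then show "Im (?z a n k k') = Im (?z b n k k')" using h by (simp add: inj_eq)
    qed
    then show "a = b"
      by (intro ext app_inject poly_mapping_eqI)
  qed
  then have "inj (\<lambda>a. to_nat ` S a)"
    by (simp add: inj_def inj_image_eq_iff)
  then have "(UNIV :: op_seq set) \<lesssim> (UNIV :: nat set set)"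
    unfolding lepoll_def by blast
  then show ?thesis
    using nat_sets_eqpoll_reals lepoll_trans2 by blast
qed

context braided_process
begin

lemma transported_algebra_Alg:
  assumes "inj g"
  shows "transported_algebra g Alg"
  using assms by unfold_locales (auto intro: Alg_zero Alg_one Alg_add Alg_mult Alg_cmult Alg_adj)

lemma prod_list_upt: "prod_list (map f [0..<n]) = (\<Prod>i<n. f i)" for f :: "nat \<Rightarrow> 'c::comm_monoid_mult"
  by (induction n) (simp_all add: mult.commute)

text \<open>Through \<open>mt\<close> and \<open>inv_g\<close> each axiom reduces to a fact about
  \<open>increment\<close>: additivity, the braid relations, factorisation, or the function
  \<open>mean\<close>.\<close>

theorem levy_process_transport:
  fixes g :: "op_seq \<Rightarrow> 'a"
  assumes "inj g"
  shows "levy_process q T (transport g Alg) (lim_state \<circ> the_inv g) (\<lambda>s t. g \<circ> eval (increment s t))"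
proof -
  interpret transported_algebra g Alg
    using assms by (rule transported_algebra_Alg)
  have inA: "eval (increment s t) p \<in> Alg" if "t \<le> T" for s t p
    using that by (intro Alg_eval Alg_increment)
  have mt: "mult_tensor A (g \<circ> eval (increment r s)) (g \<circ> eval (increment s' t)) z =
      g (tensor_eval (increment r s) (increment s' t) z)" if "s \<le> T" "t \<le> T" for r s s' t z
    using that by (intro mult_tensor_transport Alg_increment)
  have "quantum_prob_space A (lim_state \<circ> the_inv g)"
    by (intro quantum_prob_space_transport lim_state_add lim_state_cmult lim_state_one lim_state_nonneg)
  moreover have "g \<circ> eval (increment s t) \<in> star_hom V_alg A" if "t \<le> T" for s t
    using that by (intro star_hom_transport inA adj_increment)
  moreover have "mult_tensor A (g \<circ> eval (increment r s)) (g \<circ> eval (increment s t)) (comult q b) =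
      (g \<circ> eval (increment r t)) b" if "r \<le> s" "s \<le> t" "t \<le> T" for r s t b
  proof -
    have "increment r t = (\<lambda>l. increment r s l + increment s t l)"
      using that by (intro ext increment_add)
    then show ?thesis
      using that mt tensor_eval_comult[OF increment_commute[of s s] q_nz] by simp
  qed
  moreover have "(g \<circ> eval (increment t t)) b = counit b \<odot>\<^bsub>A\<^esub> \<one>\<^bsub>A\<^esub>" for t b
  proof -
    have "increment t t = (\<lambda>_. 0)" by (rule ext) (rule increment_self)
    then show ?thesis by (simp add: eval_zero_letters)
  qed
  moreover have "independent q A (lim_state \<circ> the_inv g) n (\<lambda>i. g \<circ> eval (increment (s i) (t i)))"
    if st: "\<forall>i<n. 0 \<le> s i \<and> s i \<le> t i \<and> t i \<le> T" and order: "\<forall>i. Suc i < n \<longrightarrow> t i \<le> s (Suc i)" for n s t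
    unfolding independent_def
  proof (intro conjI allI impI)
    fix \<sigma> :: "nat \<Rightarrow> nat" and b :: "nat \<Rightarrow> free_alg" assume \<sigma>: "\<sigma> permutes {..<n}"
    let ?ys = "map (\<lambda>i. (\<sigma> i, b i)) [0..<n]"
    have distinct: "distinct (map fst ?ys)"
      using permutes_inj_on[OF \<sigma>] by (simp add: o_def distinct_map inj_on_subset)
    have range: "i < n" if i: "i \<in> fst ` set ?ys" for i
    proof -
      obtain j where "j < n" "i = \<sigma> j" using i by auto
      then show ?thesis using permutes_in_image[OF \<sigma>, of j] by simp
    qed
    have "lim_state (prod_list (map (\<lambda>(k, p). eval (increment (s k) (t k)) p) ?ys)) =
      prod_list (map (\<lambda>(k, p). lim_state (eval (increment (s k) (t k)) p)) ?ys)"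
      by (rule lim_state_factor[of n s t, OF _ _ distinct range]) (use st order in blast)+
    then show "(lim_state \<circ> the_inv g) (ordered_prod A n (\<lambda>i. (g \<circ> eval (increment (s (\<sigma> i)) (t (\<sigma> i)))) (b i))) =
        (\<Prod>i<n. (lim_state \<circ> the_inv g) ((g \<circ> eval (increment (s (\<sigma> i)) (t (\<sigma> i)))) (b i)))"
      by (simp add: ordered_prod_transport o_def flip: prod_list_upt)
  next
    fix l k :: nat and z assume "l < n" "k < l"
    have "t k \<le> s l"
      by (rule ordered_intervals[of n s t]) (use st order \<open>l < n\<close> \<open>k < l\<close> in auto)
    then show "mult_tensor A (g \<circ> eval (increment (s l) (t l))) (g \<circ> eval (increment (s k) (t k))) z =
      mult_tensor A (g \<circ> eval (increment (s k) (t k))) (g \<circ> eval (increment (s l) (t l))) (braid q z)"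
      using st \<open>l < n\<close> \<open>k < l\<close> tensor_eval_braid[OF increment_commute q_nz] by (simp add: mt)
  qed
  moreover have mean: "(lim_state \<circ> the_inv g) ((g \<circ> eval (increment s t)) b) = mean b (t - s)"
    if "0 \<le> s" "s \<le> t" for s t b
    using lim_state_increment[OF that] by simp
  moreover have "((\<lambda>t. (lim_state \<circ> the_inv g) ((g \<circ> eval (increment s t)) b)) \<longlongrightarrow> counit b) (at_right s)"
    if "0 \<le> s" for s b
  proof -
    have "filterlim (\<lambda>t. t - s) (at 0) (at_right s)"
      unfolding filterlim_at
      by (auto intro!: tendsto_eq_intros simp: eventually_at_filter)
    then have "((\<lambda>t. mean b (t - s)) \<longlongrightarrow> counit b) (at_right s)"
      by (rule filterlim_compose[OF tendsto_mean])
    moreover have "eventually (\<lambda>t. mean b (t - s) = (lim_state \<circ> the_inv g) ((g \<circ> eval (increment s t)) b)) (at_right s)"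
      using eventually_at_right_less[of s] by eventually_elim (use mean that in force)
    ultimately show ?thesis by (rule Lim_transform_eventually)
  qed
  ultimately show ?thesis
    unfolding levy_process_def by auto
qed

theorem has_generator_transport:
  fixes g :: "op_seq \<Rightarrow> 'a"
  assumes "inj g" "linear_functional V_alg L"
    and "\<And>ls. L (basis (Word ls)) = gen_word ls"
  shows "has_generator T (lim_state \<circ> the_inv g) (\<lambda>s t. g \<circ> eval (increment s t)) L"
  unfolding has_generator_def
proof
  fix b
  have L_add: "L (p + r) = L p + L r" and L_cscale: "L (cscale d p) = d * L p" for p r d
    using assms(2) by (simp_all add: linear_functional_def V_alg_def)
  have L_zero: "L 0 = 0" using L_cscale[of 0 0] by simp
  have L_sum: "L (sum f S) = (\<Sum>i\<in>S. L (f i))" for f and S :: "word set"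
    by (induction S rule: infinite_finite_induct) (simp_all add: L_zero L_add)
  have "L b = L (lin_ext basis b)"
    by (rule arg_cong[where f = L], induction b rule: free_induct) simp_all
  also have "\<dots> = (\<Sum>w\<in>Poly_Mapping.keys b. Poly_Mapping.lookup b w * gen_word (letters w))"
    unfolding lin_ext_def L_sum L_cscale using assms(3) by (metis word.collapse)
  finally have "(mean b has_vector_derivative L b) (at 0)"
    using mean_deriv[of b] by simp
  then have "(mean b has_vector_derivative L b) (at 0 within {0..T})"
    by (rule has_vector_derivative_at_within)
  moreover have "mean b t = (lim_state \<circ> the_inv g) ((g \<circ> eval (increment 0 t)) b)" if "t \<in> {0..T}" for t
    using that lim_state_increment[of 0 t b] assms(1) by (simp add: the_inv_f_f)
  ultimately show "((\<lambda>t. (lim_state \<circ> the_inv g) ((g \<circ> eval (increment 0 t)) b)) has_vector_derivative L b) (at 0 within {0..T})"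
    using T_nonneg by (rule_tac has_vector_derivative_transform) auto
qed

end

section \<open>Positivity of two-by-two matrices\<close>

lemma positive_semidefinite_2:
  "positive_semidefinite (vector [vector [a, b], vector [c, d]] :: complex^2^2) \<longleftrightarrow>
    (\<forall>x y. cnj x * a * x + cnj x * b * y + cnj y * c * x + cnj y * d * y \<in> \<real>\<^sub>\<ge>\<^sub>0)"
proof -
  have "(\<forall>z :: complex^2. P (z $ 1) (z $ 2)) \<longleftrightarrow> (\<forall>x y. P x y)" for P :: "complex \<Rightarrow> complex \<Rightarrow> bool"
  proof
    assume P: "\<forall>z :: complex^2. P (z $ 1) (z $ 2)"
    show "\<forall>x y. P x y"
    proof (intro allI)
      fix x y :: complex
      show "P x y" using P[rule_format, of "vector [x, y]"] by simp
    qed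
  qed simp
  then show ?thesis
    by (simp add: positive_semidefinite_def sum_2 add.assoc)
qed

text \<open>The imaginary parts at (1, 1) and (1, i) give the symmetry; test vectors whose first
  entry is a real multiple of \<open>b\<close> give the determinant bound.\<close>

lemma positive_semidefinite_2D:
  assumes "\<And>x y. cnj x * a * x + cnj x * b * y + cnj y * c * x + cnj y * d * y \<in> \<real>\<^sub>\<ge>\<^sub>0"
  shows "a \<in> \<real>\<^sub>\<ge>\<^sub>0" "d \<in> \<real>\<^sub>\<ge>\<^sub>0" "c = cnj b" "(cmod b)\<^sup>2 \<le> Re a * Re d"
proof -
  show a: "a \<in> \<real>\<^sub>\<ge>\<^sub>0" using assms[of 1 0] by simp
  show d: "d \<in> \<real>\<^sub>\<ge>\<^sub>0" using assms[of 0 1] by simp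
  show c: "c = cnj b"
    using assms[of 1 1] assms[of 1 \<i>] a d
    by (auto simp: complex_nonneg_Reals_iff complex_eq_iff)
  have form: "0 \<le> r\<^sup>2 * (cmod b)\<^sup>2 * Re a + 2 * r * s * (cmod b)\<^sup>2 + s\<^sup>2 * Re d" for r s :: real
  proof -
    have "0 \<le> Re (cnj (of_real r * b) * a * (of_real r * b) + cnj (of_real r * b) * b * of_real s +
        cnj (of_real s) * c * (of_real r * b) + cnj (of_real s) * d * of_real s)"
      using assms[of "of_real r * b" "of_real s"] by (simp only: complex_nonneg_Reals_iff)
    also have "\<dots> = r\<^sup>2 * (cmod b)\<^sup>2 * Re a + 2 * r * s * (cmod b)\<^sup>2 + s\<^sup>2 * Re d"
      unfolding cmod_power2
      using a d by (simp add: c complex_nonneg_Reals_iff power2_eq_square algebra_simps)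
    finally show ?thesis .
  qed
  show "(cmod b)\<^sup>2 \<le> Re a * Re d"
  proof (cases "Re a = 0")
    case False
    then have "0 < Re a" using a by (simp add: complex_nonneg_Reals_iff)
    \<comment> \<open>For fixed \<open>s\<close> the form is smallest at
      \<open>r = - s / Re a\<close>; clearing the denominator gives this choice.\<close>
    moreover have "0 \<le> Re a * (Re a * Re d - (cmod b)\<^sup>2)"
      using form[of 1 "- Re a"] by (simp add: power2_eq_square algebra_simps)
    ultimately show ?thesis by (simp add: zero_le_mult_iff)
  next
    case True
    have "b = 0"
    proof (rule ccontr)
      assume "b \<noteq> 0"
      \<comment> \<open>With \<open>Re a = 0\<close> the form is affine in \<open>r\<close>, and
        this \<open>r\<close> makes it -1.\<close>
      then have "0 \<le> - (Re d + 1) + Re d"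
        using form[of "- (Re d + 1) / (2 * (cmod b)\<^sup>2)" 1] True by (simp add: field_simps)
      then show False by simp
    qed
    then show ?thesis using True by simp
  qed
qed


section \<open>Necessity\<close>

lemma word_length_cases:
  obtains "ls = []" | l where "ls = [l]" | l l' where "ls = [l, l']" | "3 \<le> length ls"
  by (cases ls; cases "tl ls"; cases "tl (tl ls)") auto

lemma quadratic_functional_long_word:
  assumes "quadratic_functional L" "3 \<le> length ls"
  shows "L (basis (Word ls)) = 0"
proof -
  obtain l l' ms where ls: "ls = l # l' # ms" "ms \<noteq> []"
    using assms(2) by (cases ls; cases "tl ls"; cases "tl (tl ls)") auto
  have "basis (Word ls) = basis (Word [l]) * basis (Word [l']) * basis (Word ms)"
    by (simp add: mult_single plus_word_def ls)
  moreover have "counit (basis (Word ks)) = 0" if "ks \<noteq> []" for ks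
    using that by (simp add: counit_def lookup_single zero_word_def)
  ultimately show ?thesis
    using assms(1) ls(2) unfolding quadratic_functional_def by (metis list.distinct(1))
qed

context
  fixes q T :: real and A :: "'a star_algebra" and \<Phi> j and L :: "free_alg \<Rightarrow> complex"
  assumes q: "q \<noteq> 0" and T: "0 < T" and lp: "levy_process q T A \<Phi> j" and gen: "has_generator T \<Phi> j L"
begin

definition law :: "real \<Rightarrow> free_alg \<Rightarrow> complex" where
  "law t b = \<Phi> (j 0 t b)"

interpretation unital_star_algebra A
  using lp by (simp add: levy_process_def quantum_prob_space_def)

lemma state: "linear_functional A \<Phi>" "\<Phi> \<one>\<^bsub>A\<^esub> = 1" "a \<in> carrier A \<Longrightarrow> \<Phi> (star A a \<otimes>\<^bsub>A\<^esub> a) \<in> \<real>\<^sub>\<ge>\<^sub>0"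
  using lp by (auto simp: levy_process_def quantum_prob_space_def is_state_def)

lemma hom:
  assumes "0 \<le> s" "s \<le> t" "t \<le> T"
  shows "j s t \<in> star_hom V_alg A"
  using lp assms by (simp add: levy_process_def)

lemma hom_simps:
  assumes "0 \<le> s" "s \<le> t" "t \<le> T"
  shows "j s t b \<in> carrier A" "j s t (b + b') = j s t b \<oplus>\<^bsub>A\<^esub> j s t b'"
    "j s t (b * b') = j s t b \<otimes>\<^bsub>A\<^esub> j s t b'" "j s t (cscale d b) = d \<odot>\<^bsub>A\<^esub> j s t b"
    "j s t 1 = \<one>\<^bsub>A\<^esub>" "j s t (free_star b) = star A (j s t b)"
  using hom[OF assms] by (auto simp: star_hom_def ring_hom_def V_alg_def)

lemma law_simps:
  assumes "0 \<le> t" "t \<le> T"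
  shows "law t (b + b') = law t b + law t b'" "law t (cscale d b) = d * law t b" "law t 1 = 1"
    "law t (free_star b * b) \<in> \<real>\<^sub>\<ge>\<^sub>0"
  using state assms hom_simps[of 0 t] by (auto simp: law_def linear_functional_def)

lemma law_0: "law 0 b = counit b"
proof -
  have "j 0 0 b = counit b \<odot>\<^bsub>A\<^esub> \<one>\<^bsub>A\<^esub>"
    using lp T by (simp add: levy_process_def)
  then show ?thesis
    using state by (simp add: law_def linear_functional_def)
qed

lemma generator_limit: "((\<lambda>t. (law t b - counit b) / of_real t) \<longlongrightarrow> L b) (at 0 within {0..T})"
proof -
  have "((\<lambda>t. law t b) has_vector_derivative L b) (at 0 within {0..T})"
    using gen by (simp add: has_generator_def law_def)
  then have "((\<lambda>t. (1 / \<bar>t\<bar>) *\<^sub>R (law t b - (law 0 b + t *\<^sub>R L b))) \<longlongrightarrow> 0) (at 0 within {0..T})"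
    by (simp add: has_vector_derivative_def has_derivative_within)
  then have "((\<lambda>t. (1 / \<bar>t\<bar>) *\<^sub>R (law t b - (law 0 b + t *\<^sub>R L b)) + L b) \<longlongrightarrow> 0 + L b) (at 0 within {0..T})"
    by (intro tendsto_intros)
  moreover have "\<forall>\<^sub>F t in at 0 within {0..T}. (1 / \<bar>t\<bar>) *\<^sub>R (law t b - (law 0 b + t *\<^sub>R L b)) + L b =
      (law t b - counit b) / of_real t"
    unfolding eventually_at_filter
    by (intro always_eventually) (auto simp: law_0 scaleR_conv_of_real field_simps)
  ultimately show ?thesis
    by (simp add: tendsto_cong)
qed

lemma at_0_nontrivial: "at (0::real) within {0..T} \<noteq> bot"
  using T by (simp add: trivial_limit_within islimpt_Icc)

text \<open>Stopping at \<open>T / 2\<close> leaves room for a second increment of the same length,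
  as \<open>law_charged_word\<close> requires.\<close>

lemma generator_closed:
  assumes "closed S" "\<And>t. 0 < t \<Longrightarrow> t \<le> T / 2 \<Longrightarrow> (law t b - counit b) / of_real t \<in> S"
  shows "L b \<in> S"
proof (rule Lim_in_closed_set[OF assms(1) _ at_0_nontrivial generator_limit])
  have "\<forall>\<^sub>F t in at 0 within {0..T}. t < T / 2"
    using T order_tendstoD(2)[OF tendsto_ident_at, of 0 "T / 2" "{0..T}"] by simp
  moreover have "\<forall>\<^sub>F t in at 0 within {0..T}. 0 < t"
    by (auto simp: eventually_at_filter)
  ultimately show "\<forall>\<^sub>F t in at 0 within {0..T}. (law t b - counit b) / of_real t \<in> S"
    by eventually_elim (use assms(2) in simp)
qed

text \<open>Since the counit vanishes on the product, the difference quotient is a nonnegative value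
  of a state divided by \<open>t\<close>.\<close>

lemma generator_positive:
  assumes "counit b = 0"
  shows "L (free_star b * b) \<in> \<real>\<^sub>\<ge>\<^sub>0"
proof (rule generator_closed[OF closed_nonneg_Reals_complex])
  fix t assume t: "0 < t" "t \<le> T / 2"
  then have "law t (free_star b * b) \<in> \<real>\<^sub>\<ge>\<^sub>0"
    using T by (intro law_simps) auto
  moreover have "counit (free_star b * b) = 0"
    by (simp add: counit_hom assms)
  ultimately show "(law t (free_star b * b) - counit (free_star b * b)) / of_real t \<in> \<real>\<^sub>\<ge>\<^sub>0"
    using t by (simp add: nonneg_Reals_divide_I)
qed

text \<open>Positivity at \<open>gx\<close> plus a scalar 0, 1 or i; the imaginary parts give the
  relation. The argument is run for \<open>law t\<close> because positivity of \<open>L\<close> is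
  known only on the kernel of \<open>counit\<close>.\<close>

lemma law_hermitian:
  assumes "0 \<le> t" "t \<le> T"
  shows "law t gv = cnj (law t gx)"
proof -
  have pos: "law t (gv * gx) + d * law t gv + cnj d * law t gx + cnj d * d \<in> \<real>\<^sub>\<ge>\<^sub>0" for d
  proof -
    have "free_star (gx + Poly_Mapping.single 0 d) * (gx + Poly_Mapping.single 0 d) =
        gv * gx + Poly_Mapping.single (Word [Lv]) d + Poly_Mapping.single (Word [Lx]) (cnj d)
          + Poly_Mapping.single 0 (cnj d * d)"
      by (simp add: zero_word_def plus_word_def mult_single distrib_left distrib_right)
    then have "law t (gv * gx) + law t (Poly_Mapping.single (Word [Lv]) d) +
        law t (Poly_Mapping.single (Word [Lx]) (cnj d)) + law t (Poly_Mapping.single 0 (cnj d * d)) \<in> \<real>\<^sub>\<ge>\<^sub>0"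
      using law_simps(4)[OF assms, of "gx + Poly_Mapping.single 0 d"] by (simp only: law_simps(1)[OF assms])
    moreover have "law t (Poly_Mapping.single w e) = e * law t (basis w)" for w e
      using law_simps(2)[OF assms, of e "basis w"] by simp
    note this[of "Word [Lv]" d] this[of "Word [Lx]" "cnj d"] this[of 0 "cnj d * d"]
    ultimately show ?thesis
      using law_simps(3)[OF assms] by (simp only: single_one mult_1_right)
  qed
  show ?thesis
    using pos[of 0] pos[of 1] pos[of \<i>] by (auto simp: complex_nonneg_Reals_iff complex_eq_iff)
qed

lemma generator_hermitian: "L gv = cnj (L gx)"
proof -
  have "((\<lambda>t. cnj ((law t gx - counit gx) / of_real t)) \<longlongrightarrow> cnj (L gx)) (at 0 within {0..T})"
    by (intro tendsto_cnj generator_limit)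
  moreover have "\<forall>\<^sub>F t in at 0 within {0..T}. cnj ((law t gx - counit gx) / of_real t) = (law t gv - counit gv) / of_real t"
    by (auto simp: eventually_at_filter law_hermitian counit_hom)
  ultimately have "((\<lambda>t. (law t gv - counit gv) / of_real t) \<longlongrightarrow> cnj (L gx)) (at 0 within {0..T})"
    by (rule Lim_transform_eventually)
  then show ?thesis
    using tendsto_unique[OF at_0_nontrivial generator_limit] by blast
qed

lemma mult_tensor_single:
  assumes "f (basis u) \<in> carrier A" "h (basis w) \<in> carrier A" "d \<noteq> 0"
  shows "mult_tensor A f h (Poly_Mapping.single (u, w) d) = d \<odot>\<^bsub>A\<^esub> (f (basis u) \<otimes>\<^bsub>A\<^esub> h (basis w))"
proof -
  have "e \<in> carrier complex_ring" for e by (simp add: complex_ring_def)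
  then show ?thesis using assms by (simp add: mult_tensor_def)
qed

lemma law_charged_word:
  assumes t: "0 < t" "t \<le> T / 2" and ch: "q powi (charge (letters w) * int (length (letters w))) \<noteq> 1"
  shows "law t (basis w) = 0"
proof -
  \<comment> \<open>Two adjacent intervals of equal length, so both variables have the law
    \<open>law t\<close>.\<close>
  define J where "J i = j (if i = 0 then 0 else t) (if i = 0 then t else 2 * t)" for i :: nat
  have J: "J 0 = j 0 t" "J (Suc 0) = j t (2 * t)" by (simp_all add: J_def)
  let ?b = "basis w :: free_alg" and ?d = "qpow q (charge (letters w) * int (length (letters w)))"
  have "independent q A \<Phi> 2 (\<lambda>i. j ((\<lambda>i. if i = 0 then 0 else t) i) ((\<lambda>i::nat. if i = 0 then t else 2 * t) i))"
    using lp t unfolding levy_process_def by auto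
  then have ind: "independent q A \<Phi> 2 J"
    by (simp add: J_def[abs_def])
  have carr: "J 0 ?b \<in> carrier A" "J (Suc 0) ?b \<in> carrier A"
    using t by (auto simp: J intro!: hom_simps)
  have same: "\<Phi> (J 0 ?b) = law t ?b" "\<Phi> (J (Suc 0) ?b) = law t ?b"
  proof -
    show "\<Phi> (J 0 ?b) = law t ?b" by (simp add: J law_def)
    have "\<forall>s t s' t' b. 0 \<le> s \<and> s \<le> t \<and> t \<le> T \<and> 0 \<le> s' \<and> s' \<le> t' \<and> t' \<le> T \<and> t - s = t' - s' \<longrightarrow>
        \<Phi> (j s t b) = \<Phi> (j s' t' b)"
      using lp by (simp add: levy_process_def)
    from this[rule_format, of t "2 * t" 0 t ?b] show "\<Phi> (J (Suc 0) ?b) = law t ?b"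
      using t by (simp add: J law_def)
  qed
  have prod: "\<Phi> (J (\<sigma> 0) ?b \<otimes>\<^bsub>A\<^esub> J (\<sigma> 1) ?b) = law t ?b * law t ?b" if "\<sigma> permutes {..<2}" for \<sigma>
  proof -
    have \<sigma>: "\<sigma> 0 \<in> {..<2}" "\<sigma> 1 \<in> {..<2}"
      using permutes_in_image[OF that] by simp_all
    then have "J (\<sigma> 0) ?b \<in> carrier A" "J (\<sigma> 1) ?b \<in> carrier A" "\<Phi> (J (\<sigma> 0) ?b) = law t ?b" "\<Phi> (J (\<sigma> 1) ?b) = law t ?b"
      using carr same by (auto simp: less_2_cases_iff)
    moreover have "\<Phi> (ordered_prod A 2 (\<lambda>i. J (\<sigma> i) ?b)) = (\<Prod>i<2. \<Phi> (J (\<sigma> i) ?b))"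
      using ind[unfolded independent_def, THEN conjunct1, rule_format, OF that, of "\<lambda>_. ?b"] .
    ultimately show ?thesis
      by (simp add: ordered_prod_def numeral_2_eq_2)
  qed
  have "mult_tensor A (J 1) (J 0) (basis (w, w)) = mult_tensor A (J 0) (J 1) (braid q (basis (w, w)))"
    by (rule ind[unfolded independent_def, THEN conjunct2, rule_format]) simp_all
  moreover have "1 \<odot>\<^bsub>A\<^esub> x = x" if "x \<in> carrier A" for x
    using smult_one[OF that] by (simp add: complex_ring_def)
  ultimately have "J (Suc 0) ?b \<otimes>\<^bsub>A\<^esub> J 0 ?b = ?d \<odot>\<^bsub>A\<^esub> (J 0 ?b \<otimes>\<^bsub>A\<^esub> J (Suc 0) ?b)"
    using carr q by (simp add: mult_tensor_single braid_def num_letter_def flip: charge_def)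
  then have "\<Phi> (J (Suc 0) ?b \<otimes>\<^bsub>A\<^esub> J 0 ?b) = ?d * \<Phi> (J 0 ?b \<otimes>\<^bsub>A\<^esub> J (Suc 0) ?b)"
    using state(1) carr by (simp add: linear_functional_def)
  moreover have "\<Phi> (J 0 ?b \<otimes>\<^bsub>A\<^esub> J (Suc 0) ?b) = law t ?b * law t ?b"
    using prod[OF permutes_id] by simp
  \<comment> \<open>The transposition yields the same value in the opposite order, so the braid
    factor must fix the square.\<close>
  moreover have "\<Phi> (J (Suc 0) ?b \<otimes>\<^bsub>A\<^esub> J 0 ?b) = law t ?b * law t ?b"
    using prod[OF permutes_swap_id[of 0 "{..<2}" 1]] by (simp add: transpose_def)
  ultimately have "(1 - ?d) * (law t ?b * law t ?b) = 0"
    by (simp add: algebra_simps)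
  moreover have "?d \<noteq> 1"
    using ch by (metis of_real_eq_1_iff)
  ultimately show ?thesis by simp
qed

lemma generator_charged_word:
  assumes "q powi (charge (letters w) * int (length (letters w))) \<noteq> 1"
  shows "L (basis w) = 0"
proof -
  \<comment> \<open>The empty word has exponent 0.\<close>
  have "w \<noteq> 0" using assms by (auto simp: zero_word_def)
  then have "counit (basis w) = 0" by (simp add: counit_def lookup_single)
  then have "L (basis w) \<in> {0}"
    using law_charged_word[OF _ _ assms] by (intro generator_closed) simp_all
  then show ?thesis by simp
qed

end


section \<open>The classification\<close>

text \<open>These are the numbers \<open>q powi (charge * length)\<close> for the words x, v, xx and
  vv.\<close>

lemma power_int_q_square_ne_1:
  fixes q :: real
  assumes "q\<^sup>2 \<noteq> 1"
  shows "q \<noteq> 1" "inverse q \<noteq> 1" "q ^ 4 \<noteq> 1" "inverse q ^ 4 \<noteq> 1"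
proof -
  show 1: "q \<noteq> 1" using assms by auto
  then show "inverse q \<noteq> 1" by (metis inverse_1 inverse_inverse_eq)
  show 4: "q ^ 4 \<noteq> 1"
  proof
    assume "q ^ 4 = 1"
    then have "(q\<^sup>2)\<^sup>2 = 1" by (simp flip: power_mult)
    then have "q\<^sup>2 = 1 \<or> q\<^sup>2 = - 1" by (simp only: power2_eq_1_iff)
    moreover have "0 \<le> q\<^sup>2" by simp
    ultimately show False using assms by linarith
  qed
  then show "inverse q ^ 4 \<noteq> 1"
    by (metis inverse_1 inverse_inverse_eq power_inverse)
qed

lemma linear_functionalD:
  assumes "linear_functional V_alg L"
  shows "L (p + r) = L p + L r" "L (cscale d p) = d * L p"
  using assms by (simp_all add: linear_functional_def V_alg_def)

text \<open>Coordinates are taken in the order v, x, which puts L(xv) in the upper left corner of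
  the matrix.\<close>

lemma generator_matrix_form:
  assumes "linear_functional V_alg L"
  shows "L (free_star (cscale x gv + cscale y gx) * (cscale x gv + cscale y gx)) =
    cnj x * L (gx * gv) * x + cnj x * L (gx * gx) * y + cnj y * L (gv * gv) * x + cnj y * L (gv * gx) * y"
proof -
  have "free_star (cscale x gv + cscale y gx) * (cscale x gv + cscale y gx) =
      cscale (cnj x * x) (gx * gv) + cscale (cnj x * y) (gx * gx) + cscale (cnj y * x) (gv * gv) + cscale (cnj y * y) (gv * gx)"
    by (simp add: mult_single distrib_left distrib_right)
  then show ?thesis
    by (simp add: linear_functionalD[OF assms] algebra_simps)
qed

lemma generator_necessary:
  fixes A :: "'a star_algebra"
  assumes q: "q \<noteq> 0" and T: "0 < T" and L: "linear_functional V_alg L" "quadratic_functional L" "L 1 = 0"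
    and lp: "levy_process q T A \<Phi> j" "has_generator T \<Phi> j L"
  shows "positive_semidefinite
       (vector [vector [L (gx * gv), L (gx * gx)], vector [L (gv * gv), L (gv * gx)]] :: complex^2^2)"
    and "L gv = cnj (L gx)" and "q \<noteq> 1 \<Longrightarrow> L gx = 0"
    and "q\<^sup>2 \<noteq> 1 \<Longrightarrow> w \<notin> {Word [Lx, Lv], Word [Lv, Lx]} \<Longrightarrow> L (basis w) = 0"
proof -
  have psd: "cnj x * L (gx * gv) * x + cnj x * L (gx * gx) * y + cnj y * L (gv * gv) * x + cnj y * L (gv * gx) * y \<in> \<real>\<^sub>\<ge>\<^sub>0" for x y
    unfolding generator_matrix_form[OF L(1), symmetric]
    by (rule generator_positive[OF q T lp]) (simp only: counit_hom, simp)
  then show "positive_semidefinite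
       (vector [vector [L (gx * gv), L (gx * gx)], vector [L (gv * gv), L (gv * gx)]] :: complex^2^2)"
    by (simp add: positive_semidefinite_2)
  show "L gv = cnj (L gx)"
    by (rule generator_hermitian[OF q T lp])
  note charged = generator_charged_word[OF q T lp]
  show gx: "L gx = 0" if "q \<noteq> 1"
    using that by (intro charged) simp
  show "L (basis w) = 0" if q2: "q\<^sup>2 \<noteq> 1" and w: "w \<notin> {Word [Lx, Lv], Word [Lv, Lx]}"
  proof -
    note qs = power_int_q_square_ne_1[OF q2]
    obtain ls where ls: "w = Word ls" by (cases w)
    show ?thesis
    proof (rule word_length_cases[of ls])
      assume "ls = []"
      then show ?thesis using L(3) by (simp add: ls zero_word_def flip: single_one)
    next
      fix l assume "ls = [l]"
      then show ?thesis using qs by (intro charged) (cases l; simp add: ls power_int_minus)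
    next
      fix l l' assume l: "ls = [l, l']"
      show ?thesis
        using w qs by (intro charged) (cases l; cases l'; simp add: ls l power_int_minus power_inverse)
    next
      assume "3 \<le> length ls"
      then show ?thesis using quadratic_functional_long_word[OF L(2)] by (simp add: ls)
    qed
  qed
qed

lemma generator_sufficient:
  fixes L :: "free_alg \<Rightarrow> complex"
  assumes universe: "(UNIV :: real set) \<lesssim> (UNIV :: 'a set)"
    and q: "q \<noteq> 0" and T: "0 < T"
    and L: "linear_functional V_alg L" "quadratic_functional L" "L 1 = 0"
    and pos: "L (gx * gv) \<in> \<real>\<^sub>\<ge>\<^sub>0" "L (gv * gx) \<in> \<real>\<^sub>\<ge>\<^sub>0" "L (gv * gv) = cnj (L (gx * gx))"
      "(cmod (L (gx * gx)))\<^sup>2 \<le> Re (L (gx * gv)) * Re (L (gv * gx))"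
    and herm: "L gv = cnj (L gx)"
    and constraints: "q = 1 \<or> L gx = 0" "q\<^sup>2 = 1 \<or> L (gx * gx) = 0"
  shows "\<exists>(A :: 'a star_algebra) \<Phi> j. levy_process q T A \<Phi> j \<and> has_generator T \<Phi> j L"
proof -
  define a b where "a = Re (L (gx * gv))" and "b = Re (L (gv * gx))"
  have a: "0 \<le> a" "L (gx * gv) = of_real a" and b: "0 \<le> b" "L (gv * gx) = of_real b"
    using pos(1,2) by (auto simp: a_def b_def complex_nonneg_Reals_iff complex_eq_iff)
  \<comment> \<open>Cholesky factors of the matrix. If \<open>a = 0\<close>, division by zero sets
    \<eta> to 0, which is right because the determinant bound then forces L(xx) = 0.\<close>
  define \<alpha> \<eta> \<beta> where "\<alpha> = sqrt a" and "\<eta> = L (gx * gx) / of_real \<alpha>" and "\<beta> = sqrt (b - (cmod \<eta>)\<^sup>2)"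
  have \<alpha>\<eta>: "of_real \<alpha> * \<eta> = L (gx * gx)"
  proof (cases "a = 0")
    case True
    then have "(cmod (L (gx * gx)))\<^sup>2 \<le> 0" using pos(4) unfolding a_def[symmetric] by simp
    then have "L (gx * gx) = 0" unfolding power2_less_eq_zero_iff by (simp only: norm_eq_zero)
    then show ?thesis by (simp add: \<eta>_def)
  next
    case False
    then have "complex_of_real \<alpha> \<noteq> 0" using a by (simp add: \<alpha>_def)
    then show ?thesis by (simp add: \<eta>_def)
  qed
  have \<eta>: "(cmod \<eta>)\<^sup>2 \<le> b"
  proof (cases "a = 0")
    case False
    then have "(cmod \<eta>)\<^sup>2 = (cmod (L (gx * gx)))\<^sup>2 / a"
      using a by (simp add: \<eta>_def \<alpha>_def norm_divide power_divide)
    moreover have "(cmod (L (gx * gx)))\<^sup>2 \<le> b * a"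
      using pos(4) by (simp only: a_def b_def mult.commute)
    ultimately show ?thesis using False a by (simp add: pos_divide_le_eq)
  qed (simp add: \<eta>_def \<alpha>_def b)
  \<comment> \<open>If q^2 is not 1, then L(xx) = 0 and hence \<eta> = 0; the drift is L(x).\<close>
  interpret braided_process q \<alpha> \<beta> \<eta> "L gx" T
    using q constraints T by unfold_locales (auto simp: \<eta>_def)
  obtain h :: "op_seq \<Rightarrow> 'a" where h: "inj h"
    using lepoll_trans[OF op_seq_lepoll_reals universe] unfolding lepoll_def by blast
  have "L (basis (Word ls)) = gen_word ls" for ls
  proof (rule word_length_cases[of ls])
    assume "ls = []"
    then show ?thesis using L(3) by (simp add: gen_word_def zero_word_def flip: single_one)
  next
    fix l assume "ls = [l]"
    then show ?thesis by (cases l) (simp_all add: gen_word_def drift_def herm)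
  next
    have two: "basis (Word [l, l']) = (basis (Word [l]) * basis (Word [l']) :: free_alg)" for l l'
      by (simp add: mult_single plus_word_def)
    fix l l' assume ls: "ls = [l, l']"
    have "site_vec [Lx, Lv] 0 = L (gx * gv)" "site_vec [Lv, Lx] 0 = L (gv * gx)"
      "site_vec [Lx, Lx] 0 = L (gx * gx)" "site_vec [Lv, Lv] 0 = L (gv * gv)"
      unfolding site_vec_pair using a b \<eta> \<alpha>\<eta> pos(3) complex_cnj_mult[of "of_real \<alpha>" \<eta>]
      by (simp_all add: \<alpha>_def \<beta>_def)
    then show ?thesis
      unfolding ls two gen_word_def by (cases l; cases l'; simp del: site_vec.simps)
  next
    assume "3 \<le> length ls"
    then show ?thesis
      using quadratic_functional_long_word[OF L(2), of ls] by (simp add: gen_word_def)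
  qed
  then show ?thesis
    using levy_process_transport[OF h] has_generator_transport[OF h L(1)] by blast
qed

theorem theorem5p7p1:
  fixes q T :: real and L :: "free_alg \<Rightarrow> complex"
  assumes universe: "(UNIV :: real set) \<lesssim> (UNIV :: 'a set)"
    and q: "q \<noteq> 0"
    and T: "T > 0"
    and L: "linear_functional V_alg L" "quadratic_functional L" "L 1 = 0"
  shows "(\<exists>(A :: 'a star_algebra) \<Phi> j. levy_process q T A \<Phi> j \<and> has_generator T \<Phi> j L) \<longleftrightarrow>
    (q = 1 \<longrightarrow>
       positive_semidefinite
         (vector [vector [L (gx * gv), L (gx * gx)], vector [L (gv * gv), L (gv * gx)]] :: complex^2^2) \<and>
       L gv = cnj (L gx)) \<and>
    (q = -1 \<longrightarrow>
       positive_semidefinite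
         (vector [vector [L (gx * gv), L (gx * gx)], vector [L (gv * gv), L (gv * gx)]] :: complex^2^2) \<and>
       L gx = 0 \<and> L gv = 0) \<and>
    (q\<^sup>2 \<noteq> 1 \<longrightarrow>
       L (gx * gv) \<in> \<real>\<^sub>\<ge>\<^sub>0 \<and> L (gv * gx) \<in> \<real>\<^sub>\<ge>\<^sub>0 \<and>
       (\<forall>w. w \<notin> {Word [Lx, Lv], Word [Lv, Lx]} \<longrightarrow> L (basis w) = 0))"
    (is "?lhs \<longleftrightarrow> ?one \<and> ?minus_one \<and> ?generic")
proof
  assume ?lhs
  then obtain A :: "'a star_algebra" and \<Phi> j where lp: "levy_process q T A \<Phi> j" "has_generator T \<Phi> j L"
    by blast
  note nec = generator_necessary[OF q T L lp]
  have "L (gx * gv) \<in> \<real>\<^sub>\<ge>\<^sub>0" "L (gv * gx) \<in> \<real>\<^sub>\<ge>\<^sub>0"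
    using nec(1) positive_semidefinite_2D unfolding positive_semidefinite_2 by metis+
  then show "?one \<and> ?minus_one \<and> ?generic"
    using nec by auto
next
  assume rhs: "?one \<and> ?minus_one \<and> ?generic"
  have one: "?one" and minus: "?minus_one" and generic: "?generic" using rhs by blast+
  show ?lhs
  proof (cases "q\<^sup>2 = 1")
    case True
    then have pm: "q = 1 \<or> q = - 1" by (simp add: power2_eq_1_iff)
    then have "positive_semidefinite
         (vector [vector [L (gx * gv), L (gx * gx)], vector [L (gv * gv), L (gv * gx)]] :: complex^2^2)"
      using one minus by blast
    then have psd: "\<And>x y. cnj x * L (gx * gv) * x + cnj x * L (gx * gx) * y + cnj y * L (gv * gv) * x + cnj y * L (gv * gx) * y \<in> \<real>\<^sub>\<ge>\<^sub>0"
      unfolding positive_semidefinite_2 by blast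
    have herm: "L gv = cnj (L gx)" and drift: "q = 1 \<or> L gx = 0" and sq: "q\<^sup>2 = 1 \<or> L (gx * gx) = 0"
      using pm one minus True by auto
    show ?thesis
      by (rule generator_sufficient[OF universe q T L positive_semidefinite_2D[OF psd] herm drift sq])
  next
    case False
    then have pos: "L (gx * gv) \<in> \<real>\<^sub>\<ge>\<^sub>0" "L (gv * gx) \<in> \<real>\<^sub>\<ge>\<^sub>0"
      and other: "\<And>w. w \<notin> {Word [Lx, Lv], Word [Lv, Lx]} \<Longrightarrow> L (basis w) = 0"
      using generic by blast+
    have zero: "L gx = 0" "L gv = 0" "L (gx * gx) = 0" "L (gv * gv) = 0"
      by (auto simp: mult_single plus_word_def intro!: other)
    \<comment> \<open>The matrix is diagonal here, so the determinant condition only asks that a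
      product of nonnegative numbers be nonnegative.\<close>
    have herm: "L gv = cnj (L gx)" and conj: "L (gv * gv) = cnj (L (gx * gx))"
      and det: "(cmod (L (gx * gx)))\<^sup>2 \<le> Re (L (gx * gv)) * Re (L (gv * gx))"
      and drift: "q = 1 \<or> L gx = 0" and sq: "q\<^sup>2 = 1 \<or> L (gx * gx) = 0"
      using zero pos by (auto simp: complex_nonneg_Reals_iff)
    show ?thesis
      by (rule generator_sufficient[OF universe q T L pos conj det herm drift sq])
  qed
qed

end
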